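(* Let $D^n_t$ be the distance at time $t$ from the starting point of the continuous time random adjacent transposition walk on $n$ markers, and let $p_t(u,v)$ be the transition function (density) of $\bar B$, a one-dimensional Brownian motion run at speed $2$ reflecting at $0$ and $1$. Let $t>0$. Then, as $n\to\infty$, $$\frac1{n^2}D^n_{n^3t}\to \int_0^1 du\int_u^1 dv\int_0^1 p_t(u,x)\,dx\int_0^x p_t(v,y)\,dy=P\big[\bar B_1(t)>\bar B_2(t)\big]$$ in probability, where $\bar B_1$ and $\bar B_2$ are independent copies of $\bar B$ started uniformly on $0\le \bar B_1(0)<\bar B_2(0)\le 1$ and evolving independently.
   Context: Random adjacent transposition walk on $n$ markers: the state at time $t$ is a permutation $X^n_t$ of $\{1,\dots,n\}$, where $X^n_t(j)$ is the location of particle $j$, and $X^n_0$ is the identity. At rate $1$, one picks $i\in\{1,\dots,n-1\}$ uniformly at random and exchanges the particles at locations $i$ and $i+1$. $D^n_t$ is the minimal number of adjacent transpositions needed to build $X^n_t$ from the identity; equivalently $D^n_t=\#\{1\le i<j\le n: X^n_t(i)>X^n_t(j)\}$, the number of inversions. Brownian motion run at speed $2$ means $t\mapsto B_{2t}$ with $B$ a standard Brownian motion (variance $2t$ at time $t$ away from the boundary).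
   Formalization: The final equality is proved as integral = (1/2) P[B1(t) > B2(t)], since for the normalised uniform start on the triangle (area 1/2) the displayed equality is off by a factor 2 (as t → ∞ the integral tends to 1/4, P to 1/2). *)

theory Defs
  imports "HOL-Probability.Probability" "HOL-Combinatorics.Transposition"
begin

section \<open>The random adjacent transposition walk\<close>

text \<open>Permutations of \<open>{1..n}\<close> are functions on \<open>nat\<close> that are the identity off \<open>{1..n}\<close>;
  the value at \<open>j\<close> is the location of particle \<open>j\<close>, so exchanging the particles at locations
  \<open>i\<close> and \<open>i + 1\<close> composes with the transposition on the left.\<close>

definition swap_locations :: "nat \<Rightarrow> (nat \<Rightarrow> nat) \<Rightarrow> (nat \<Rightarrow> nat)" where
  "swap_locations i \<sigma> = Transposition.transpose i (i + 1) \<circ> \<sigma>"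

primrec state_after :: "(nat \<Rightarrow> nat) \<Rightarrow> nat \<Rightarrow> (nat \<Rightarrow> nat)" where
  "state_after l 0 = id"
| "state_after l (Suc k) = swap_locations (l k) (state_after l k)"

definition adj_dist :: "nat \<Rightarrow> (nat \<Rightarrow> nat) \<Rightarrow> nat" where
  "adj_dist n \<sigma> = (LEAST k. \<exists>l. (\<forall>j<k. l j \<in> {1..<n}) \<and> \<sigma> = state_after l k)"

definition jump_count :: "(nat \<Rightarrow> real) \<Rightarrow> real \<Rightarrow> nat" where
  "jump_count h s = card {k. (\<Sum>j\<le>k. h j) \<le> s}"

text \<open>Rate 1: the holding times \<open>H k\<close> are i.i.d. standard exponential, and independent of the
  i.i.d. uniform locations \<open>L k\<close> at which the exchanges take place.\<close>

definition adjacent_transposition_walk ::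
    "nat \<Rightarrow> 'a measure \<Rightarrow> (real \<Rightarrow> 'a \<Rightarrow> nat \<Rightarrow> nat) \<Rightarrow> bool" where
  "adjacent_transposition_walk n M X \<longleftrightarrow> prob_space M \<and>
     (\<exists>(H :: nat \<Rightarrow> 'a \<Rightarrow> real) (L :: nat \<Rightarrow> 'a \<Rightarrow> nat).
        prob_space.indep_vars M (\<lambda>_. borel \<Otimes>\<^sub>M count_space UNIV) (\<lambda>k \<omega>. (H k \<omega>, L k \<omega>)) UNIV \<and>
        (\<forall>k. distr M (borel \<Otimes>\<^sub>M count_space UNIV) (\<lambda>\<omega>. (H k \<omega>, L k \<omega>)) =
               density lborel (exponential_density 1) \<Otimes>\<^sub>M measure_pmf (pmf_of_set {1..<n})) \<and>
        (\<forall>s\<ge>0. \<forall>\<omega>\<in>space M.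
           X s \<omega> = state_after (\<lambda>k. L k \<omega>) (jump_count (\<lambda>k. H k \<omega>) s)))"

text \<open>The random variables \<open>Y n\<close> may live on different probability spaces, since the limit is
  a constant.\<close>

definition tends_in_probability ::
    "(nat \<Rightarrow> 'a measure) \<Rightarrow> (nat \<Rightarrow> 'a \<Rightarrow> real) \<Rightarrow> real \<Rightarrow> bool" where
  "tends_in_probability M Y c \<longleftrightarrow>
     (\<forall>\<epsilon>>0. (\<lambda>n. measure (M n) {\<omega> \<in> space (M n). \<bar>Y n \<omega> - c\<bar> > \<epsilon>}) \<longlonglongrightarrow> 0)"

section \<open>Reflecting Brownian motion\<close>

definition standard_brownian_motion :: "'a measure \<Rightarrow> (real \<Rightarrow> 'a \<Rightarrow> real) \<Rightarrow> bool" where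
  "standard_brownian_motion M W \<longleftrightarrow> prob_space M \<and>
     (\<forall>s\<ge>0. W s \<in> borel_measurable M) \<and>
     (AE \<omega> in M. W 0 \<omega> = 0) \<and>
     (\<forall>(\<tau> :: nat \<Rightarrow> real) k. 0 \<le> \<tau> 0 \<longrightarrow> mono \<tau> \<longrightarrow>
        prob_space.indep_vars M (\<lambda>_. borel) (\<lambda>i \<omega>. W (\<tau> (Suc i)) \<omega> - W (\<tau> i) \<omega>) {..<k}) \<and>
     (\<forall>r s. 0 \<le> r \<longrightarrow> r < s \<longrightarrow>
        distributed M lborel (\<lambda>\<omega>. W s \<omega> - W r \<omega>) (normal_density 0 (sqrt (s - r)))) \<and>
     (AE \<omega> in M. continuous_on {0..} (\<lambda>s. W s \<omega>))"

text \<open>The distance to the nearest even integer, i.e. the even 2-periodic extension of the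
  identity on \<open>{0..1}\<close>. Folding the real line by it turns Brownian motion into Brownian motion
  reflecting at 0 and 1.\<close>

definition fold01 :: "real \<Rightarrow> real" where
  "fold01 y = \<bar>y - 2 * of_int (round (y / 2))\<bar>"

lemma fold01_range: "fold01 y \<in> {0..1}"
  using of_int_round_abs_le[of "y / 2"] unfolding fold01_def atLeastAtMost_iff by linarith

lemma fold01_id: "y \<in> {0..1} \<Longrightarrow> fold01 y = y"
proof (cases "y = 1")
  case False
  assume "y \<in> {0..1}"
  with False have "round (y / 2) = 0"
    by (intro round_unique') auto
  then show ?thesis using \<open>y \<in> {0..1}\<close> by (simp add: fold01_def)
qed (simp add: fold01_def round_def)

text \<open>Speed 2, started from \<open>u\<close>, driven by \<open>W\<close>.\<close>

definition reflecting_bm :: "(real \<Rightarrow> 'a \<Rightarrow> real) \<Rightarrow> real \<Rightarrow> real \<Rightarrow> 'a \<Rightarrow> real" where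
  "reflecting_bm W u s \<omega> = fold01 (u + W (2 * s) \<omega>)"

text \<open>For a family of \<open>{0..1}\<close>-valued processes \<open>Y u\<close> indexed by the starting point \<open>u\<close>.
  A density is determined only up to null sets in its last argument.\<close>

definition transition_density ::
    "'a measure \<Rightarrow> (real \<Rightarrow> real \<Rightarrow> 'a \<Rightarrow> real) \<Rightarrow> (real \<Rightarrow> real \<Rightarrow> real \<Rightarrow> real) \<Rightarrow> bool" where
  "transition_density M Y p \<longleftrightarrow>
     (\<forall>s>0. \<forall>u\<in>{0..1}. (\<forall>v\<in>{0..1}. 0 \<le> p s u v) \<and>
        distributed M (restrict_space lborel {0..1}) (Y u s) (\<lambda>v. ennreal (p s u v)))"

text \<open>\<open>uniform_measure\<close> is normalised: the starting point has density 2 on the triangle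
  \<open>0 \<le> u < v \<le> 1\<close>, whose area is 1/2. Hence a probability for such a pair is twice the
  corresponding integral against \<open>du dv\<close> over the triangle. Independence is that of the
  starting point and the two driving Brownian motions.\<close>

definition ordered_reflecting_bm_pair ::
    "'a measure \<Rightarrow> (real \<Rightarrow> 'a \<Rightarrow> real) \<Rightarrow> (real \<Rightarrow> 'a \<Rightarrow> real) \<Rightarrow> bool" where
  "ordered_reflecting_bm_pair M B1 B2 \<longleftrightarrow> prob_space M \<and>
     (\<exists>(U1 :: 'a \<Rightarrow> real) (U2 :: 'a \<Rightarrow> real) W1 W2.
        U1 \<in> borel_measurable M \<and> U2 \<in> borel_measurable M \<and>
        distr M borel (\<lambda>\<omega>. (U1 \<omega>, U2 \<omega>)) =
          uniform_measure lborel {(u, v). 0 \<le> u \<and> u < v \<and> v \<le> 1} \<and>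
        standard_brownian_motion M W1 \<and> standard_brownian_motion M W2 \<and>
        prob_space.indep_sets M
          (\<lambda>i. [sets (vimage_algebra (space M) (\<lambda>\<omega>. (U1 \<omega>, U2 \<omega>)) borel),
                sets (vimage_algebra (space M) (\<lambda>\<omega>. \<lambda>s\<in>{0..}. W1 s \<omega>) (PiM {0..} (\<lambda>_. borel))),
                sets (vimage_algebra (space M) (\<lambda>\<omega>. \<lambda>s\<in>{0..}. W2 s \<omega>) (PiM {0..} (\<lambda>_. borel)))] ! i)
          {..<3} \<and>
        (\<forall>s\<ge>0. \<forall>\<omega>\<in>space M.
           B1 s \<omega> = reflecting_bm W1 (U1 \<omega>) s \<omega> \<and> B2 s \<omega> = reflecting_bm W2 (U2 \<omega>) s \<omega>))"

definition crossing_integral :: "(real \<Rightarrow> real \<Rightarrow> real \<Rightarrow> real) \<Rightarrow> real \<Rightarrow> real" where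
  "crossing_integral p t =
     (LINT u:{0..1}|lborel. LINT v:{u..1}|lborel. LINT x:{0..1}|lborel.
        p t u x * (LINT y:{0..x}|lborel. p t v y))"

end

theory Submission
  imports Defs "HOL-Combinatorics.Permutations" "HOL-Real_Asymp.Real_Asymp"
begin

text \<open>The distance is the number of inversions, an affine function of the sum of
  \<open>sgn (\<sigma> i - \<sigma> j)\<close> over \<open>i < j\<close>. On antisymmetric functions of two particles the step operator of
  the walk coincides with that of two independent reflecting walks, \<open>1 + (\<Delta>\<^sub>1 + \<Delta>\<^sub>2) / (n - 1)\<close> with the
  Neumann Laplacian \<open>\<Delta>\<close>, so that the conditional expectations of the sum are again sums of this form,
  with the sign replaced by its evolution. This evolution stays monotone and its row sums have
  bounded gradient; hence the martingale increments are bounded, and the variance is of order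
  \<open>n\<^sup>3\<close>, negligible against \<open>n\<^sup>4\<close>. The fluctuation of the number of jumps, of order \<open>n\<close> to the power
  3/2, is negligible too, as one jump changes the distance by one. For the mean, the sign is
  approximated in the mean by cosine polynomials (the evolution is an \<open>L\<^sup>1\<close>-contraction), and
  products of cosines are eigenfunctions both of the discrete Laplacian and of reflecting Brownian
  motion.\<close>

section \<open>Inversions\<close>

text \<open>Scaling: on the grid of mesh \<open>1 / n\<close> a coordinate moves up or down with
  probability \<open>1 / (n - 1)\<close> each, so \<open>n ^ 3 * t\<close> steps produce variance
  about \<open>2 * t\<close>; this is the speed 2. The obstacle is the interaction of neighbours,
  which are exchanged with each other instead of moving independently. The indicator of an inversion
  feels it; the sign, antisymmetric and zero on the diagonal, does not, and this is why inversions
  are rewritten through \<open>sgn\<close>. Randomness of time is separated from randomness of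
  place: the embedded chain is studied at the deterministic step
  \<open>nat \<lfloor>s\<rfloor>\<close>, and the chain at the true number of jumps is compared with
  it path by path. Monotonicity matters because it removes absolute values: the L1 distance of two
  neighbouring rows of the evolved sign is then just a difference of row sums. The sign is
  discontinuous, so it is approximated off a thin strip around the diagonal; on the grid the strip
  holds few sites, in the limit ties have probability zero. Agreement on cosines then identifies the
  limit, without an invariance principle.\<close>

definition inversions :: "nat \<Rightarrow> (nat \<Rightarrow> nat) \<Rightarrow> (nat \<times> nat) set" where
  "inversions n \<sigma> = {(p, q). 1 \<le> p \<and> p < q \<and> q \<le> n \<and> \<sigma> q < \<sigma> p}"

lemma finite_inversions [simp]: "finite (inversions n \<sigma>)"
  by (rule finite_subset[of _ "{1..n} \<times> {1..n}"]) (auto simp: inversions_def)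

lemma inversions_id [simp]: "inversions n id = {}" "inversions n (\<lambda>a. a) = {}"
  by (auto simp: inversions_def)

lemma swap_locations_involutory [simp]: "swap_locations i (swap_locations i \<sigma>) = \<sigma>"
  by (auto simp: swap_locations_def fun_eq_iff)

lemma swap_locations_permutes:
  assumes "\<sigma> permutes {1..n}" "i \<in> {1..<n}"
  shows "swap_locations i \<sigma> permutes {1..n}"
  unfolding swap_locations_def using assms
  by (intro permutes_compose permutes_swap_id) auto

lemma state_after_permutes:
  "(\<And>j. j < k \<Longrightarrow> l j \<in> {1..<n}) \<Longrightarrow> state_after l k permutes {1..n}"
proof (induction k)
  case 0
  show ?case by (simp add: permutes_def)
next
  case (Suc k)
  then show ?case using swap_locations_permutes[of "state_after l k" n "l k"] by simp
qed

text \<open>The exchanged particles sit at adjacent locations, so no third particle lies between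
  them and every other pair keeps its order.\<close>

lemma inversions_swap_locations_insert:
  assumes "inj \<sigma>" "\<sigma> p = i" "\<sigma> q = i + 1" "1 \<le> p" "p < q" "q \<le> n"
  shows "inversions n (swap_locations i \<sigma>) = insert (p, q) (inversions n \<sigma>)"
    and "(p, q) \<notin> inversions n \<sigma>"
proof -
  have eq: "swap_locations i \<sigma> b < swap_locations i \<sigma> a \<longleftrightarrow> \<sigma> b < \<sigma> a \<or> (a, b) = (p, q)"
    if "a < b" for a b
  proof -
    have "\<sigma> a = i \<longleftrightarrow> a = p" "\<sigma> b = i \<longleftrightarrow> b = p" "\<sigma> a = i + 1 \<longleftrightarrow> a = q" "\<sigma> b = i + 1 \<longleftrightarrow> b = q"
      using assms(1-3) by (metis injD)+
    moreover have "\<sigma> a \<noteq> \<sigma> b" using assms(1) that by (metis injD less_irrefl)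
    ultimately show ?thesis
      using that \<open>p < q\<close> by (auto simp: swap_locations_def Transposition.transpose_def)
  qed
  show "inversions n (swap_locations i \<sigma>) = insert (p, q) (inversions n \<sigma>)"
    using assms eq by (auto simp: inversions_def)
  show "(p, q) \<notin> inversions n \<sigma>"
    using assms by (simp add: inversions_def)
qed

text \<open>\<open>inv \<sigma> i\<close> is the particle at location \<open>i\<close>. The second
  case is the first one applied to the permutation after the exchange, since exchanging twice
  changes nothing.\<close>

lemma card_inversions_swap_locations:
  assumes "\<sigma> permutes {1..n}" "i \<in> {1..<n}"
  shows "inv \<sigma> i < inv \<sigma> (i + 1) \<Longrightarrow>
           card (inversions n (swap_locations i \<sigma>)) = Suc (card (inversions n \<sigma>))"
    and "inv \<sigma> (i + 1) < inv \<sigma> i \<Longrightarrow>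
           card (inversions n \<sigma>) = Suc (card (inversions n (swap_locations i \<sigma>)))"
    and "inv \<sigma> i \<noteq> inv \<sigma> (i + 1)"
proof -
  define p q where "p = inv \<sigma> i" and "q = inv \<sigma> (i + 1)"
  have pq: "\<sigma> p = i" "\<sigma> q = i + 1"
    using permutes_inverses[OF assms(1)] by (auto simp: p_def q_def)
  then show "p \<noteq> q" by auto
  have inj: "inj \<sigma>" using assms(1) by (rule permutes_inj)
  have "inv \<sigma> permutes {1..n}" using assms(1) by (rule permutes_inv)
  then have rng: "p \<in> {1..n}" "q \<in> {1..n}"
    using assms(2) permutes_in_image[of "inv \<sigma>" "{1..n}"] by (auto simp: p_def q_def)
  show "card (inversions n (swap_locations i \<sigma>)) = Suc (card (inversions n \<sigma>))" if "p < q"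
    using inversions_swap_locations_insert[OF inj pq _ that, of n] rng by auto
  have "swap_locations i \<sigma> q = i" "swap_locations i \<sigma> p = i + 1"
    using pq by (auto simp: swap_locations_def)
  moreover have "inj (swap_locations i \<sigma>)"
    using swap_locations_permutes[OF assms] by (rule permutes_inj)
  ultimately show "card (inversions n \<sigma>) = Suc (card (inversions n (swap_locations i \<sigma>)))" if "q < p"
    using inversions_swap_locations_insert[of "swap_locations i \<sigma>" q i p n] rng that by auto
qed

lemma card_inversions_swap_locations_le:
  assumes "\<sigma> permutes {1..n}" "i \<in> {1..<n}"
  shows "\<bar>real (card (inversions n (swap_locations i \<sigma>))) - real (card (inversions n \<sigma>))\<bar> \<le> 1"
  using card_inversions_swap_locations[OF assms] by fastforce

text \<open>This converts an error in the number of jumps into an error of the distance, path by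
  path.\<close>

lemma card_inversions_state_after_le:
  assumes "\<And>j. l j \<in> {1..<n}"
  shows "\<bar>real (card (inversions n (state_after l k))) - real (card (inversions n (state_after l m)))\<bar>
           \<le> \<bar>real k - real m\<bar>"
proof -
  have *: "\<bar>real (card (inversions n (state_after l (m + d)))) - real (card (inversions n (state_after l m)))\<bar>
          \<le> real d" for m d
  proof (induction d)
    case (Suc d)
    have "\<bar>real (card (inversions n (state_after l (m + Suc d))))
        - real (card (inversions n (state_after l (m + d))))\<bar> \<le> 1"
      using card_inversions_swap_locations_le[of "state_after l (m + d)" n "l (m + d)"]
        state_after_permutes[of "m + d" l n] assms by auto
    with Suc.IH show ?case by simp
  qed simp
  show ?thesis
    using *[of m "k - m"] *[of k "m - k"] by (cases "m \<le> k") auto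
qed

text \<open>An increasing \<open>\<pi>\<close> with values at least 1 satisfies
  \<open>i \<le> \<pi> i\<close>; both sides have the same sum over \<open>{1..n}\<close>, so
  equality holds everywhere.\<close>

lemma permutes_no_descent_eq_id:
  fixes n :: nat
  assumes "\<pi> permutes {1..n}" "\<And>i. i \<in> {1..<n} \<Longrightarrow> \<pi> i < \<pi> (i + 1)"
  shows "\<pi> = id"
proof -
  have lower: "i \<le> \<pi> i" if "i \<in> {1..n}" for i
    using that
  proof (induction i)
    case (Suc i)
    show ?case
    proof (cases "i = 0")
      case True
      then show ?thesis using permutes_in_image[OF assms(1), of "Suc i"] Suc.prems by auto
    next
      case False
      then show ?thesis using Suc assms(2)[of i] by auto
    qed
  qed auto
  have "\<pi> i = i" if "i \<in> {1..n}" for i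
  proof -
    have "sum \<pi> {1..n} = sum (\<lambda>i. i) {1..n}"
      using sum.permute[OF assms(1), of "\<lambda>i. i"] by (simp add: o_def)
    then have "sum (\<lambda>i. \<pi> i - i) {1..n} = 0"
      using lower by (subst sum_subtractf_nat) auto
    then have "\<pi> i - i = 0" using that by simp
    then show ?thesis using lower[OF that] by simp
  qed
  then show ?thesis using assms(1) by (metis eq_id_iff permutes_not_in)
qed

text \<open>Bubble sort: a permutation other than the identity has neighbouring locations in the
  wrong order, and exchanging them removes exactly one inversion. Conversely, one exchange creates
  at most one.\<close>

lemma adj_dist_eq_card_inversions:
  assumes "\<sigma> permutes {1..n}"
  shows "adj_dist n \<sigma> = card (inversions n \<sigma>)"
proof -
  have reach: "\<exists>l. (\<forall>j<k. l j \<in> {1..<n}) \<and> \<sigma> = state_after l k"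
    if "\<sigma> permutes {1..n}" "card (inversions n \<sigma>) = k" for \<sigma> k
    using that
  proof (induction k arbitrary: \<sigma>)
    case 0
    have "inv \<sigma> = id"
    proof (rule permutes_no_descent_eq_id)
      show "inv \<sigma> permutes {1..n}" using 0(1) by (rule permutes_inv)
      show "inv \<sigma> i < inv \<sigma> (i + 1)" if "i \<in> {1..<n}" for i
        using card_inversions_swap_locations(2,3)[OF 0(1) that] 0(2) by linarith
    qed
    then have "\<sigma> = id" using permutes_inv_inv[OF 0(1)] by simp
    then show ?case by simp
  next
    case (Suc k)
    have "\<exists>i\<in>{1..<n}. \<not> inv \<sigma> i < inv \<sigma> (i + 1)"
    proof (rule ccontr)
      assume "\<not> ?thesis"
      then have "inv \<sigma> = id"
        using permutes_no_descent_eq_id[OF permutes_inv[OF Suc.prems(1)]] by blast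
      then have "\<sigma> = id" using permutes_inv_inv[OF Suc.prems(1)] by simp
      then show False using Suc.prems(2) by simp
    qed
    then obtain i where i: "i \<in> {1..<n}" "inv \<sigma> (i + 1) < inv \<sigma> i"
      using card_inversions_swap_locations(3)[OF Suc.prems(1)] by (metis linorder_neqE_nat)
    then have "card (inversions n (swap_locations i \<sigma>)) = k"
      using card_inversions_swap_locations(2)[OF Suc.prems(1)] Suc.prems(2) by auto
    then obtain l where l: "\<forall>j<k. l j \<in> {1..<n}" "swap_locations i \<sigma> = state_after l k"
      using Suc.IH[OF swap_locations_permutes[OF Suc.prems(1) i(1)]] by auto
    \<comment> \<open>The first \<open>k\<close> exchanges do not read \<open>l k\<close>, so this
      entry is free for the exchange that leads back from the shorter permutation to
      \<open>\<sigma>\<close>.\<close>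
    have cong: "state_after (l(k := i)) m = state_after l m" if "m \<le> k" for m
      using that by (induction m) auto
    have "\<sigma> = state_after (l(k := i)) (Suc k)"
      using cong[of k] l(2)[symmetric] by simp
    moreover have "\<forall>j<Suc k. (l(k := i)) j \<in> {1..<n}"
      using l(1) i(1) by (auto simp: less_Suc_eq)
    ultimately show ?case by blast
  qed
  have lower: "card (inversions n (state_after l k)) \<le> k" if "\<forall>j<k. l j \<in> {1..<n}" for l k
    using that
  proof (induction k)
    case (Suc k)
    then show ?case
      using card_inversions_swap_locations_le[of "state_after l k" n "l k"]
        state_after_permutes[of k l n] by fastforce
  qed simp
  show ?thesis
    unfolding adj_dist_def
    by (rule Least_equality) (use reach[OF assms] lower in auto)
qed

section \<open>The action of one step on sums over pairs\<close>

text \<open>At the end of the interval a site is its own neighbour: a suppressed move, which is the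
  Neumann boundary condition.\<close>

definition site_above :: "nat \<Rightarrow> nat \<Rightarrow> nat" where
  "site_above n a = (if a < n then a + 1 else a)"

definition site_below :: "nat \<Rightarrow> nat" where
  "site_below a = (if 1 < a then a - 1 else a)"

text \<open>The weights sum to one, and they are nonnegative exactly when
  \<open>4 \<le> n - 1\<close>. This is where the later restriction to \<open>n \<ge> 5\<close>
  comes from.\<close>

definition pair_step :: "nat \<Rightarrow> (nat \<Rightarrow> nat \<Rightarrow> real) \<Rightarrow> nat \<Rightarrow> nat \<Rightarrow> real" where
  "pair_step n g a b = (1 - 4 / (real n - 1)) * g a b
     + (g (site_above n a) b + g (site_below a) b + g a (site_above n b) + g a (site_below b)) / (real n - 1)"

definition perm_step :: "nat \<Rightarrow> ((nat \<Rightarrow> nat) \<Rightarrow> real) \<Rightarrow> (nat \<Rightarrow> nat) \<Rightarrow> real" where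
  "perm_step n F \<sigma> = (\<Sum>i\<in>{1..<n}. F (swap_locations i \<sigma>)) / (real n - 1)"

definition pair_sum :: "nat \<Rightarrow> (nat \<Rightarrow> nat \<Rightarrow> real) \<Rightarrow> (nat \<Rightarrow> nat) \<Rightarrow> real" where
  "pair_sum n g \<sigma> = (\<Sum>p\<in>{1..n}. \<Sum>q\<in>{p<..n}. g (\<sigma> p) (\<sigma> q))"

definition antisymmetric :: "(nat \<Rightarrow> nat \<Rightarrow> real) \<Rightarrow> bool" where
  "antisymmetric g \<longleftrightarrow> (\<forall>a b. g b a = - g a b)"

lemma antisymmetricD: "antisymmetric g \<Longrightarrow> g b a = - g a b"
  unfolding antisymmetric_def by blast

lemma site_above_in [simp]: "a \<in> {1..n} \<Longrightarrow> site_above n a \<in> {1..n}"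
  and site_below_in [simp]: "a \<in> {1..n} \<Longrightarrow> site_below a \<in> {1..n}"
  by (auto simp: site_above_def site_below_def)

lemma site_above_mono: "a \<le> a' \<Longrightarrow> a' \<le> n \<Longrightarrow> site_above n a \<le> site_above n a'"
  and site_below_mono: "a \<le> a' \<Longrightarrow> 1 \<le> a \<Longrightarrow> site_below a \<le> site_below a'"
  by (auto simp: site_above_def site_below_def)

text \<open>Only the exchanges with \<open>i = a\<close> and \<open>i = a - 1\<close> move
  \<open>a\<close>. At an end of the interval one of them is missing, and its term vanishes because
  the neighbour is \<open>a\<close> itself.\<close>

lemma sum_transpose_diff:
  fixes h :: "nat \<Rightarrow> real"
  assumes "a \<in> {1..n}"
  shows "(\<Sum>i\<in>{1..<n}. h (Transposition.transpose i (i + 1) a) - h a)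
           = h (site_above n a) + h (site_below a) - 2 * h a"
proof -
  have "(\<Sum>i\<in>{1..<n}. h (Transposition.transpose i (i + 1) a) - h a)
      = (\<Sum>i\<in>{1..<n}. (if i = a then h (site_above n a) - h a else 0)
          + (if i = a - 1 then h (site_below a) - h a else 0))"
    using assms
    by (intro sum.cong refl) (auto simp: Transposition.transpose_def site_above_def site_below_def)
  also have "\<dots> = h (site_above n a) + h (site_below a) - 2 * h a"
    using assms unfolding sum.distrib by (auto simp: site_above_def site_below_def)
  finally show ?thesis .
qed

lemma sum_transpose_permute:
  fixes h :: "nat \<Rightarrow> real"
  assumes "i \<in> {1..<n}"
  shows "(\<Sum>a\<in>{1..n}. h (Transposition.transpose i (i + 1) a)) = (\<Sum>a\<in>{1..n}. h a)"
proof -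
  have "Transposition.transpose i (i + 1) permutes {1..n}"
    using assms by (intro permutes_swap_id) auto
  from sum.permute[OF this, of h] show ?thesis by (simp add: o_def)
qed

text \<open>Every transposition permutes the sites, hence the discrete Neumann Laplacian of any
  function sums to zero.\<close>

lemma sum_neighbours:
  fixes h :: "nat \<Rightarrow> real"
  shows "(\<Sum>a\<in>{1..n}. h (site_above n a)) + (\<Sum>a\<in>{1..n}. h (site_below a)) = 2 * (\<Sum>a\<in>{1..n}. h a)"
proof -
  have "(\<Sum>a\<in>{1..n}. h (site_above n a) + h (site_below a) - 2 * h a)
      = (\<Sum>a\<in>{1..n}. \<Sum>i\<in>{1..<n}. h (Transposition.transpose i (i + 1) a) - h a)"
    using sum_transpose_diff by (intro sum.cong refl) auto
  also have "\<dots> = (\<Sum>i\<in>{1..<n}. \<Sum>a\<in>{1..n}. h (Transposition.transpose i (i + 1) a) - h a)"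
    by (rule sum.swap)
  also have "\<dots> = 0"
    by (rule sum.neutral, intro ballI) (simp only: sum_subtractf sum_transpose_permute diff_self)
  finally show ?thesis
    by (simp add: sum_subtractf sum.distrib sum_distrib_left)
qed

text \<open>The summand with its single \<open>- g a b\<close> is the form to which a joint exchange
  of both coordinates reduces for antisymmetric \<open>g\<close>.\<close>

lemma pair_step_eq_transposes:
  assumes "a \<in> {1..n}" "b \<in> {1..n}" "n \<ge> 2"
  shows "pair_step n g a b = (\<Sum>i\<in>{1..<n}. g (Transposition.transpose i (i + 1) a) b
           + g a (Transposition.transpose i (i + 1) b) - g a b) / (real n - 1)"
proof -
  have "(\<Sum>i\<in>{1..<n}. g (Transposition.transpose i (i + 1) a) b
           + g a (Transposition.transpose i (i + 1) b) - g a b)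
      = (\<Sum>i\<in>{1..<n}. (g (Transposition.transpose i (i + 1) a) b - g a b)
           + (g a (Transposition.transpose i (i + 1) b) - g a b) + g a b)"
    by (intro sum.cong refl) simp
  also have "\<dots> = (\<Sum>i\<in>{1..<n}. g (Transposition.transpose i (i + 1) a) b - g a b)
         + (\<Sum>i\<in>{1..<n}. g a (Transposition.transpose i (i + 1) b) - g a b) + (real n - 1) * g a b"
    unfolding sum.distrib using assms(3) by (simp add: of_nat_diff)
  also have "\<dots> = g (site_above n a) b + g (site_below a) b - 2 * g a b
      + (g a (site_above n b) + g a (site_below b) - 2 * g a b) + (real n - 1) * g a b"
    using sum_transpose_diff[OF assms(1), of "\<lambda>x. g x b"] sum_transpose_diff[OF assms(2), of "g a"]
    by simp
  finally have *: "(\<Sum>i\<in>{1..<n}. g (Transposition.transpose i (i + 1) a) b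
           + g a (Transposition.transpose i (i + 1) b) - g a b)
      = g (site_above n a) b + g (site_below a) b - 2 * g a b
      + (g a (site_above n b) + g a (site_below b) - 2 * g a b) + (real n - 1) * g a b" .
  define m where "m = real n - 1"
  have "m \<noteq> 0" using assms(3) by (simp add: m_def)
  then show ?thesis
    unfolding * pair_step_def m_def[symmetric] by (simp add: field_simps)
qed

lemma antisymmetric_pair_step:
  assumes "antisymmetric g"
  shows "antisymmetric (pair_step n g)"
  unfolding antisymmetric_def
proof (intro allI)
  fix a b
  have "g b a = - g a b" "g (site_above n b) a = - g a (site_above n b)"
    "g (site_below b) a = - g a (site_below b)" "g b (site_above n a) = - g (site_above n a) b"
    "g b (site_below a) = - g (site_below a) b"
    using assms by (auto intro: antisymmetricD)
  then have "pair_step n g b a = (1 - 4 / (real n - 1)) * - g a b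
     + (- g a (site_above n b) + - g a (site_below b) + - g (site_above n a) b + - g (site_below a) b) / (real n - 1)"
    by (simp only: pair_step_def)
  also have "\<dots> = - pair_step n g a b"
    by (simp add: pair_step_def algebra_simps diff_divide_distrib add_divide_distrib)
  finally show "pair_step n g b a = - pair_step n g a b" .
qed

text \<open>The key point: on antisymmetric functions the interchange of two particles acts as if the
  particles moved independently, because the swap of two neighbouring particles is compensated by
  the two collisions \<open>g b b = g a a = 0\<close>.\<close>

lemma antisymmetric_transpose:
  assumes "antisymmetric g" "a \<noteq> b"
  shows "g (Transposition.transpose i j a) (Transposition.transpose i j b)
           = g (Transposition.transpose i j a) b + g a (Transposition.transpose i j b) - g a b"
proof -
  have "g x x = 0" for x using antisymmetricD[OF assms(1), of x x] by simp
  moreover have "g b a = - g a b" using assms(1) by (rule antisymmetricD)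
  ultimately show ?thesis
    using assms(2) by (auto simp: Transposition.transpose_def)
qed

text \<open>Closure of the antisymmetric pair sums under the chain: an expectation over permutations
  becomes an evolution of two coordinates. Distinct particles occupy distinct sites, which gives the
  condition \<open>a \<noteq> b\<close> for the exchange identity.\<close>

lemma perm_step_pair_sum:
  assumes "\<sigma> permutes {1..n}" "antisymmetric g" "n \<ge> 2"
  shows "perm_step n (pair_sum n g) \<sigma> = pair_sum n (pair_step n g) \<sigma>"
proof -
  have "(\<Sum>i\<in>{1..<n}. pair_sum n g (swap_locations i \<sigma>))
      = (\<Sum>i\<in>{1..<n}. \<Sum>p\<in>{1..n}. \<Sum>q\<in>{p<..n}.
          g (Transposition.transpose i (i + 1) (\<sigma> p)) (Transposition.transpose i (i + 1) (\<sigma> q)))"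
    by (simp add: pair_sum_def swap_locations_def)
  also have "\<dots> = (\<Sum>p\<in>{1..n}. \<Sum>q\<in>{p<..n}. \<Sum>i\<in>{1..<n}.
          g (Transposition.transpose i (i + 1) (\<sigma> p)) (Transposition.transpose i (i + 1) (\<sigma> q)))"
  proof -
    have "(\<Sum>p\<in>{1..n}. \<Sum>q\<in>{p<..n}. \<Sum>i\<in>{1..<n}. h i p q)
        = (\<Sum>i\<in>{1..<n}. \<Sum>p\<in>{1..n}. \<Sum>q\<in>{p<..n}. h i p q)" for h :: "nat \<Rightarrow> nat \<Rightarrow> nat \<Rightarrow> real"
    proof -
      have "(\<Sum>p\<in>{1..n}. \<Sum>q\<in>{p<..n}. \<Sum>i\<in>{1..<n}. h i p q)
          = (\<Sum>p\<in>{1..n}. \<Sum>i\<in>{1..<n}. \<Sum>q\<in>{p<..n}. h i p q)"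
        by (intro sum.cong refl sum.swap)
      also have "\<dots> = (\<Sum>i\<in>{1..<n}. \<Sum>p\<in>{1..n}. \<Sum>q\<in>{p<..n}. h i p q)"
        by (rule sum.swap)
      finally show ?thesis .
    qed
    then show ?thesis by (rule sym)
  qed
  also have "\<dots> = (\<Sum>p\<in>{1..n}. \<Sum>q\<in>{p<..n}. (real n - 1) * pair_step n g (\<sigma> p) (\<sigma> q))"
  proof (intro sum.cong refl)
    fix p q assume pq: "p \<in> {1..n}" "q \<in> {p<..n}"
    have "\<sigma> p \<noteq> \<sigma> q" using pq permutes_inj[OF assms(1)] by (auto dest: injD)
    moreover have "\<sigma> p \<in> {1..n}" "\<sigma> q \<in> {1..n}"
      using pq permutes_in_image[OF assms(1)] by auto
    ultimately show "(\<Sum>i\<in>{1..<n}.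
          g (Transposition.transpose i (i + 1) (\<sigma> p)) (Transposition.transpose i (i + 1) (\<sigma> q)))
        = (real n - 1) * pair_step n g (\<sigma> p) (\<sigma> q)"
      using assms by (simp add: pair_step_eq_transposes antisymmetric_transpose)
  qed
  finally show ?thesis
    using assms(3) by (simp add: perm_step_def pair_sum_def sum_distrib_left[symmetric])
qed

lemma antisymmetric_funpow_pair_step:
  "antisymmetric g \<Longrightarrow> antisymmetric ((pair_step n ^^ r) g)"
proof (induction r)
  case (Suc r)
  then show ?case using antisymmetric_pair_step[of "(pair_step n ^^ r) g" n] by simp
qed simp

lemma funpow_perm_step_pair_sum:
  assumes "antisymmetric g" "n \<ge> 2" "\<sigma> permutes {1..n}"
  shows "(perm_step n ^^ r) (pair_sum n g) \<sigma> = pair_sum n ((pair_step n ^^ r) g) \<sigma>"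
  using assms(3)
proof (induction r arbitrary: \<sigma>)
  case (Suc r)
  have "(perm_step n ^^ Suc r) (pair_sum n g) \<sigma> = perm_step n ((perm_step n ^^ r) (pair_sum n g)) \<sigma>"
    by simp
  also have "\<dots> = perm_step n (pair_sum n ((pair_step n ^^ r) g)) \<sigma>"
    unfolding perm_step_def[of n _ \<sigma>] using Suc.IH[OF swap_locations_permutes[OF Suc.prems]] by simp
  also have "\<dots> = pair_sum n (pair_step n ((pair_step n ^^ r) g)) \<sigma>"
    using assms Suc.prems by (intro perm_step_pair_sum antisymmetric_funpow_pair_step)
  finally show ?case by simp
qed simp

section \<open>Conservation of mass and the L1 contraction\<close>

lemma sum_pair_step:
  "(\<Sum>b\<in>{1..n}. pair_step n g a b) = (1 - 2 / (real n - 1)) * (\<Sum>b\<in>{1..n}. g a b)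
     + ((\<Sum>b\<in>{1..n}. g (site_above n a) b) + (\<Sum>b\<in>{1..n}. g (site_below a) b)) / (real n - 1)"
proof -
  have "(\<Sum>b\<in>{1..n}. pair_step n g a b) = (1 - 4 / (real n - 1)) * (\<Sum>b\<in>{1..n}. g a b)
     + ((\<Sum>b\<in>{1..n}. g (site_above n a) b) + (\<Sum>b\<in>{1..n}. g (site_below a) b)
       + ((\<Sum>b\<in>{1..n}. g a (site_above n b)) + (\<Sum>b\<in>{1..n}. g a (site_below b)))) / (real n - 1)"
    by (simp add: pair_step_def sum.distrib sum_distrib_left sum_divide_distrib add_divide_distrib)
  then show ?thesis
    unfolding sum_neighbours by (simp add: field_simps add_divide_distrib diff_divide_distrib)
qed

lemma sum_sum_pair_step:
  "(\<Sum>a\<in>{1..n}. \<Sum>b\<in>{1..n}. pair_step n g a b) = (\<Sum>a\<in>{1..n}. \<Sum>b\<in>{1..n}. g a b)"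
proof -
  have "(\<Sum>a\<in>{1..n}. \<Sum>b\<in>{1..n}. pair_step n g a b)
      = (1 - 2 / (real n - 1)) * (\<Sum>a\<in>{1..n}. \<Sum>b\<in>{1..n}. g a b)
        + ((\<Sum>a\<in>{1..n}. \<Sum>b\<in>{1..n}. g (site_above n a) b)
           + (\<Sum>a\<in>{1..n}. \<Sum>b\<in>{1..n}. g (site_below a) b)) / (real n - 1)"
    unfolding sum_pair_step
    by (simp add: sum.distrib sum_distrib_left sum_divide_distrib add_divide_distrib)
  then show ?thesis
    unfolding sum_neighbours[of "\<lambda>a. \<Sum>b\<in>{1..n}. g a b"]
    by (simp add: field_simps add_divide_distrib diff_divide_distrib)
qed

text \<open>For \<open>n \<ge> 5\<close> the step is a convex average, so the modulus of the average
  is at most the average of the moduli, whose total is conserved.\<close>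

lemma sum_abs_pair_step_le:
  assumes "n \<ge> 5"
  shows "(\<Sum>a\<in>{1..n}. \<Sum>b\<in>{1..n}. \<bar>pair_step n g a b\<bar>) \<le> (\<Sum>a\<in>{1..n}. \<Sum>b\<in>{1..n}. \<bar>g a b\<bar>)"
proof -
  have "(\<Sum>a\<in>{1..n}. \<Sum>b\<in>{1..n}. \<bar>pair_step n g a b\<bar>)
      \<le> (\<Sum>a\<in>{1..n}. \<Sum>b\<in>{1..n}. pair_step n (\<lambda>a b. \<bar>g a b\<bar>) a b)"
  proof (intro sum_mono)
    fix a b
    have c: "0 \<le> 1 - 4 / (real n - 1)" using assms by (simp add: field_simps)
    have "\<bar>pair_step n g a b\<bar> \<le> \<bar>(1 - 4 / (real n - 1)) * g a b\<bar>
      + \<bar>(g (site_above n a) b + g (site_below a) b + g a (site_above n b) + g a (site_below b)) / (real n - 1)\<bar>"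
      unfolding pair_step_def by (rule abs_triangle_ineq)
    also have "\<dots> = (1 - 4 / (real n - 1)) * \<bar>g a b\<bar>
      + \<bar>g (site_above n a) b + g (site_below a) b + g a (site_above n b) + g a (site_below b)\<bar> / (real n - 1)"
      using c assms by (simp add: abs_mult)
    also have "\<dots> \<le> pair_step n (\<lambda>a b. \<bar>g a b\<bar>) a b"
      unfolding pair_step_def using assms by (intro add_left_mono divide_right_mono) auto
    finally show "\<bar>pair_step n g a b\<bar> \<le> pair_step n (\<lambda>a b. \<bar>g a b\<bar>) a b" .
  qed
  then show ?thesis by (simp only: sum_sum_pair_step)
qed

lemma sum_abs_funpow_pair_step_le:
  assumes "n \<ge> 5"
  shows "(\<Sum>a\<in>{1..n}. \<Sum>b\<in>{1..n}. \<bar>(pair_step n ^^ r) g a b\<bar>) \<le> (\<Sum>a\<in>{1..n}. \<Sum>b\<in>{1..n}. \<bar>g a b\<bar>)"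
proof (induction r)
  case (Suc r)
  then show ?case using sum_abs_pair_step_le[OF assms, of "(pair_step n ^^ r) g"] by simp
qed simp

section \<open>Monotone kernels with bounded gradient of the row sums\<close>

definition regular_kernel :: "nat \<Rightarrow> (nat \<Rightarrow> nat \<Rightarrow> real) \<Rightarrow> bool" where
  "regular_kernel n g \<longleftrightarrow> antisymmetric g
     \<and> (\<forall>a\<in>{1..n}. \<forall>a'\<in>{1..n}. \<forall>b\<in>{1..n}. a \<le> a' \<longrightarrow> g a b \<le> g a' b)
     \<and> (\<forall>a\<in>{1..<n}. (\<Sum>b\<in>{1..n}. g (a + 1) b) - (\<Sum>b\<in>{1..n}. g a b) \<le> 2)"

text \<open>Moving to a neighbour preserves the order of sites, so averaging keeps monotonicity. Row
  sums evolve like a single reflecting walk, and their new gradient is an average of old gradients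
  and of zeros at the boundary.\<close>

lemma regular_kernel_pair_step:
  assumes "regular_kernel n g" "n \<ge> 5"
  shows "regular_kernel n (pair_step n g)"
  unfolding regular_kernel_def
proof (intro conjI ballI impI)
  show "antisymmetric (pair_step n g)"
    using assms(1) antisymmetric_pair_step unfolding regular_kernel_def by blast
next
  have mono: "g a b \<le> g a' b" if "a \<in> {1..n}" "a' \<in> {1..n}" "b \<in> {1..n}" "a \<le> a'" for a a' b
    using assms(1) that unfolding regular_kernel_def by blast
  fix a a' b assume *: "a \<in> {1..n}" "a' \<in> {1..n}" "b \<in> {1..n}" "a \<le> a'"
  show "pair_step n g a b \<le> pair_step n g a' b"
    unfolding pair_step_def using assms(2) *
    by (intro add_mono mult_left_mono divide_right_mono mono site_above_mono site_below_mono site_above_in site_below_in)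
       (auto simp: field_simps)
next
  fix a assume a: "a \<in> {1..<n}"
  define G where "G = (\<lambda>a. \<Sum>b\<in>{1..n}. g a b)"
  have G: "G (a + 1) - G a \<le> 2" if "a \<in> {1..<n}" for a
    using assms(1) that unfolding regular_kernel_def G_def by blast
  have step: "(\<Sum>b\<in>{1..n}. pair_step n g x b)
      = (1 - 2 / (real n - 1)) * G x + (G (site_above n x) + G (site_below x)) / (real n - 1)" for x
    by (simp only: sum_pair_step G_def)
  \<comment> \<open>For \<open>a + 1 = n\<close> both upper neighbours are \<open>n\<close> and the
    difference is 0; otherwise it is the gradient at \<open>a + 1\<close>.\<close>
  have "G (site_above n (a + 1)) - G (site_above n a) \<le> 2"
    using G[of "a + 1"] a by (auto simp: site_above_def)
  moreover have "G (site_below (a + 1)) - G (site_below a) \<le> 2"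
  proof (cases "a = 1")
    case False
    then have "a - 1 \<in> {1..<n}" "a - 1 + 1 = a" "a > 1" using a by auto
    then show ?thesis using G[of "a - 1"] a False by (simp add: site_below_def)
  qed (simp add: site_below_def)
  ultimately have "(1 - 2 / (real n - 1)) * (G (a + 1) - G a)
     + ((G (site_above n (a + 1)) - G (site_above n a)) + (G (site_below (a + 1)) - G (site_below a))) / (real n - 1)
     \<le> (1 - 2 / (real n - 1)) * 2 + (2 + 2) / (real n - 1)"
    using assms(2) G[OF a] by (intro add_mono mult_left_mono divide_right_mono) (auto simp: field_simps)
  also have "\<dots> = 2" by (simp add: algebra_simps)
  finally show "(\<Sum>b\<in>{1..n}. pair_step n g (a + 1) b) - (\<Sum>b\<in>{1..n}. pair_step n g a b) \<le> 2"
    unfolding step by (simp add: algebra_simps diff_divide_distrib add_divide_distrib)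
qed

lemma regular_kernel_funpow:
  assumes "regular_kernel n g" "n \<ge> 5"
  shows "regular_kernel n ((pair_step n ^^ r) g)"
  by (induction r) (auto simp: assms regular_kernel_pair_step)

definition sign_kernel :: "nat \<Rightarrow> nat \<Rightarrow> real" where
  "sign_kernel a b = sgn (real a - real b)"

text \<open>Between the rows \<open>a\<close> and \<open>a + 1\<close> the sign changes only in the
  columns \<open>a\<close> and \<open>a + 1\<close>, by one each; this is the constant 2.\<close>

lemma regular_kernel_sign: "regular_kernel n sign_kernel"
  unfolding regular_kernel_def
proof (intro conjI ballI impI)
  show "antisymmetric sign_kernel" by (auto simp: antisymmetric_def sign_kernel_def sgn_if)
  show "sign_kernel a b \<le> sign_kernel a' b" if "a \<le> a'" for a a' b
    using that by (auto simp: sign_kernel_def sgn_if)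
  fix a assume "a \<in> {1..<n}"
  have "(\<Sum>b\<in>{1..n}. sign_kernel (a + 1) b) - (\<Sum>b\<in>{1..n}. sign_kernel a b)
      = (\<Sum>b\<in>{1..n}. (if b = a then 1 else 0) + (if b = a + 1 then 1 else 0))"
    unfolding sum_subtractf[symmetric] by (intro sum.cong) (auto simp: sign_kernel_def sgn_if)
  also have "\<dots> \<le> 2" unfolding sum.distrib by auto
  finally show "(\<Sum>b\<in>{1..n}. sign_kernel (a + 1) b) - (\<Sum>b\<in>{1..n}. sign_kernel a b) \<le> 2" .
qed

text \<open>By monotonicity all entries of the difference of neighbouring rows have one sign, so its
  L1 norm is the difference of the row sums.\<close>

lemma regular_kernel_row_diff:
  assumes "regular_kernel n g" "i \<in> {1..<n}" "a \<in> {1..n}"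
  shows "(\<Sum>b\<in>{1..n}. \<bar>g (Transposition.transpose i (i + 1) a) b - g a b\<bar>)
           \<le> (if a = i \<or> a = i + 1 then 2 else 0)"
proof -
  have "\<bar>g (i + 1) b - g i b\<bar> = g (i + 1) b - g i b" if "b \<in> {1..n}" for b
    using assms that unfolding regular_kernel_def by (auto intro!: abs_of_nonneg)
  then have *: "(\<Sum>b\<in>{1..n}. \<bar>g (i + 1) b - g i b\<bar>) = (\<Sum>b\<in>{1..n}. g (i + 1) b) - (\<Sum>b\<in>{1..n}. g i b)"
    by (simp add: sum_subtractf)
  also have "\<dots> \<le> 2" using assms unfolding regular_kernel_def by blast
  finally have *: "(\<Sum>b\<in>{1..n}. \<bar>g (i + 1) b - g i b\<bar>) \<le> 2" .
  then have "(\<Sum>b\<in>{1..n}. \<bar>g i b - g (i + 1) b\<bar>) \<le> 2" by (simp add: abs_minus_commute)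
  with * show ?thesis by (auto simp: Transposition.transpose_def)
qed

text \<open>Moving the first argument affects the two rows \<open>i\<close> and
  \<open>i + 1\<close>, each by at most 2; by antisymmetry the second argument contributes as much,
  which gives 8. With absolute values the sum may be extended to all pairs and relabelled along
  \<open>\<sigma>\<close>.\<close>

lemma pair_sum_swap_locations_diff_le:
  assumes "regular_kernel n g" "i \<in> {1..<n}" "\<sigma> permutes {1..n}"
  shows "\<bar>pair_sum n g (swap_locations i \<sigma>) - pair_sum n g \<sigma>\<bar> \<le> 8"
proof -
  let ?\<tau> = "Transposition.transpose i (i + 1)"
  have anti: "antisymmetric g" using assms(1) unfolding regular_kernel_def by blast
  have row: "(\<Sum>a\<in>{1..n}. \<Sum>b\<in>{1..n}. \<bar>g (?\<tau> a) b - g a b\<bar>) \<le> 4"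
  proof -
    have "(\<Sum>a\<in>{1..n}. \<Sum>b\<in>{1..n}. \<bar>g (?\<tau> a) b - g a b\<bar>) \<le> (\<Sum>a\<in>{1..n}. if a = i \<or> a = i + 1 then 2 else 0)"
      using regular_kernel_row_diff[OF assms(1,2)] by (intro sum_mono) auto
    also have "\<dots> = (\<Sum>a\<in>{1..n}. (if a = i then 2 else 0) + (if a = i + 1 then 2 else 0))"
      by (intro sum.cong) auto
    also have "\<dots> \<le> 4" unfolding sum.distrib by auto
    finally show ?thesis .
  qed
  have diff: "pair_sum n g (swap_locations i \<sigma>) - pair_sum n g \<sigma>
      = (\<Sum>p\<in>{1..n}. \<Sum>q\<in>{p<..n}. (g (?\<tau> (\<sigma> p)) (\<sigma> q) - g (\<sigma> p) (\<sigma> q))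
           + (g (\<sigma> p) (?\<tau> (\<sigma> q)) - g (\<sigma> p) (\<sigma> q)))"
    unfolding pair_sum_def sum_subtractf[symmetric]
  proof (intro sum.cong refl)
    fix p q assume pq: "p \<in> {1..n}" "q \<in> {p<..n}"
    have "\<sigma> p \<noteq> \<sigma> q" using pq permutes_inj[OF assms(3)] by (auto dest: injD)
    then show "g (swap_locations i \<sigma> p) (swap_locations i \<sigma> q) - g (\<sigma> p) (\<sigma> q)
        = (g (?\<tau> (\<sigma> p)) (\<sigma> q) - g (\<sigma> p) (\<sigma> q)) + (g (\<sigma> p) (?\<tau> (\<sigma> q)) - g (\<sigma> p) (\<sigma> q))"
      using antisymmetric_transpose[OF anti] by (simp add: swap_locations_def)
  qed
  have "\<bar>pair_sum n g (swap_locations i \<sigma>) - pair_sum n g \<sigma>\<bar>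
      \<le> (\<Sum>p\<in>{1..n}. \<Sum>q\<in>{p<..n}. \<bar>g (?\<tau> (\<sigma> p)) (\<sigma> q) - g (\<sigma> p) (\<sigma> q)\<bar>
           + \<bar>g (\<sigma> p) (?\<tau> (\<sigma> q)) - g (\<sigma> p) (\<sigma> q)\<bar>)"
    unfolding diff by (intro order_trans[OF sum_abs] sum_mono abs_triangle_ineq)
  also have "\<dots> \<le> (\<Sum>p\<in>{1..n}. \<Sum>q\<in>{1..n}. \<bar>g (?\<tau> (\<sigma> p)) (\<sigma> q) - g (\<sigma> p) (\<sigma> q)\<bar>
           + \<bar>g (\<sigma> p) (?\<tau> (\<sigma> q)) - g (\<sigma> p) (\<sigma> q)\<bar>)"
    by (intro sum_mono sum_mono2) auto
  also have "\<dots> = (\<Sum>a\<in>{1..n}. \<Sum>b\<in>{1..n}. \<bar>g (?\<tau> a) b - g a b\<bar> + \<bar>g a (?\<tau> b) - g a b\<bar>)"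
    (is "_ = (\<Sum>a\<in>{1..n}. \<Sum>b\<in>{1..n}. ?h a b)")
    using sum.permute[OF assms(3), of "\<lambda>a. \<Sum>b\<in>{1..n}. ?h a b"]
      sum.permute[OF assms(3), of "?h (\<sigma> _)"] by (simp add: o_def)
  also have "\<dots> = (\<Sum>a\<in>{1..n}. \<Sum>b\<in>{1..n}. \<bar>g (?\<tau> a) b - g a b\<bar>)
      + (\<Sum>a\<in>{1..n}. \<Sum>b\<in>{1..n}. \<bar>g a (?\<tau> b) - g a b\<bar>)"
    by (simp add: sum.distrib)
  also have "(\<Sum>a\<in>{1..n}. \<Sum>b\<in>{1..n}. \<bar>g a (?\<tau> b) - g a b\<bar>)
      = (\<Sum>a\<in>{1..n}. \<Sum>b\<in>{1..n}. \<bar>g (?\<tau> b) a - g b a\<bar>)"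
  proof (intro sum.cong refl)
    fix a b
    show "\<bar>g a (?\<tau> b) - g a b\<bar> = \<bar>g (?\<tau> b) a - g b a\<bar>"
      using antisymmetricD[OF anti, of a "?\<tau> b"] antisymmetricD[OF anti, of a b] by linarith
  qed
  also have "\<dots> = (\<Sum>a\<in>{1..n}. \<Sum>b\<in>{1..n}. \<bar>g (?\<tau> a) b - g a b\<bar>)"
    by (rule sum.swap)
  finally show ?thesis using row by linarith
qed

section \<open>Variance along the chain\<close>

lemma perm_step_mono:
  assumes "\<And>i. i \<in> {1..<n} \<Longrightarrow> F (swap_locations i \<sigma>) \<le> G (swap_locations i \<sigma>)" "n \<ge> 2"
  shows "perm_step n F \<sigma> \<le> perm_step n G \<sigma>"
  unfolding perm_step_def using assms by (intro divide_right_mono sum_mono) auto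

text \<open>The variance after one step is at most the second moment about any point, here about the
  current value \<open>H \<sigma>\<close>, from which the step deviates by at most
  \<open>c\<close>.\<close>

lemma perm_step_variance_le:
  assumes "\<And>i. i \<in> {1..<n} \<Longrightarrow> \<bar>H (swap_locations i \<sigma>) - H \<sigma>\<bar> \<le> c" "n \<ge> 2"
  shows "perm_step n (\<lambda>\<sigma>. (H \<sigma>)\<^sup>2) \<sigma> \<le> (perm_step n H \<sigma>)\<^sup>2 + c\<^sup>2"
proof -
  define m where "m = real n - 1"
  have m: "m > 0" "(\<Sum>i\<in>{1..<n}. 1) = m" using assms(2) by (auto simp: m_def of_nat_diff)
  define x where "x = (\<lambda>i. H (swap_locations i \<sigma>))"
  have sq: "(x i - H \<sigma>)\<^sup>2 \<le> c\<^sup>2" if "i \<in> {1..<n}" for i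
    using assms(1)[OF that] by (simp add: x_def abs_le_square_iff[symmetric])
  have "(\<Sum>i\<in>{1..<n}. (x i - H \<sigma>)\<^sup>2) \<le> (\<Sum>i\<in>{1..<n}. c\<^sup>2)"
    by (intro sum_mono sq)
  also have "\<dots> = c\<^sup>2 * m" using m(2) by (simp add: sum_distrib_left[symmetric])
  finally have 1: "(\<Sum>i\<in>{1..<n}. (x i - H \<sigma>)\<^sup>2) \<le> c\<^sup>2 * m" .
  have "(\<Sum>i\<in>{1..<n}. (x i - H \<sigma>)\<^sup>2) = (\<Sum>i\<in>{1..<n}. (x i)\<^sup>2 - 2 * H \<sigma> * x i + (H \<sigma>)\<^sup>2 * 1)"
    by (intro sum.cong) (auto simp: power2_eq_square algebra_simps)
  also have "\<dots> = (\<Sum>i\<in>{1..<n}. (x i)\<^sup>2) - 2 * H \<sigma> * (\<Sum>i\<in>{1..<n}. x i) + (H \<sigma>)\<^sup>2 * m"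
    unfolding sum.distrib sum_subtractf sum_distrib_left[symmetric] m(2) by simp
  finally have 2: "(\<Sum>i\<in>{1..<n}. (x i)\<^sup>2) \<le> c\<^sup>2 * m + 2 * H \<sigma> * (\<Sum>i\<in>{1..<n}. x i) - (H \<sigma>)\<^sup>2 * m"
    using 1 by linarith
  define s where "s = (\<Sum>i\<in>{1..<n}. x i) / m"
  have "(\<Sum>i\<in>{1..<n}. (x i)\<^sup>2) / m \<le> (c\<^sup>2 * m + 2 * H \<sigma> * (s * m) - (H \<sigma>)\<^sup>2 * m) / m"
    using 2 m by (intro divide_right_mono) (auto simp: s_def)
  also have "\<dots> = c\<^sup>2 + 2 * H \<sigma> * s - (H \<sigma>)\<^sup>2" using m(1) by (simp add: field_simps)
  also have "\<dots> = s\<^sup>2 + c\<^sup>2 - (s - H \<sigma>)\<^sup>2" by (simp add: power2_eq_square algebra_simps)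
  also have "\<dots> \<le> s\<^sup>2 + c\<^sup>2" by simp
  finally show ?thesis by (simp add: perm_step_def m_def x_def s_def)
qed

text \<open>Orthogonality of martingale increments in backward form:
  \<open>(perm_step n ^^ r) F\<close> is the conditional mean with \<open>r\<close> steps to go, and
  each step adds at most \<open>c\<^sup>2\<close> to the variance.\<close>

lemma funpow_perm_step_variance_le:
  assumes "\<And>r i \<sigma>. i \<in> {1..<n} \<Longrightarrow> \<sigma> permutes {1..n} \<Longrightarrow>
      \<bar>(perm_step n ^^ r) F (swap_locations i \<sigma>) - (perm_step n ^^ r) F \<sigma>\<bar> \<le> c"
    and "n \<ge> 2" "\<sigma> permutes {1..n}"
  shows "(perm_step n ^^ k) (\<lambda>\<sigma>. (F \<sigma>)\<^sup>2) \<sigma> \<le> ((perm_step n ^^ k) F \<sigma>)\<^sup>2 + c\<^sup>2 * real k"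
  using assms(3)
proof (induction k arbitrary: \<sigma>)
  case (Suc k)
  have "(perm_step n ^^ Suc k) (\<lambda>\<sigma>. (F \<sigma>)\<^sup>2) \<sigma>
      \<le> perm_step n (\<lambda>\<sigma>. ((perm_step n ^^ k) F \<sigma>)\<^sup>2 + c\<^sup>2 * real k) \<sigma>"
    using assms(2) Suc.IH[OF swap_locations_permutes[OF Suc.prems]] by (auto intro: perm_step_mono)
  also have "\<dots> = perm_step n (\<lambda>\<sigma>. ((perm_step n ^^ k) F \<sigma>)\<^sup>2) \<sigma> + c\<^sup>2 * real k"
    using assms(2) by (simp add: perm_step_def sum.distrib add_divide_distrib of_nat_diff)
  also have "\<dots> \<le> (perm_step n ((perm_step n ^^ k) F) \<sigma>)\<^sup>2 + c\<^sup>2 + c\<^sup>2 * real k"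
    using perm_step_variance_le[of n "(perm_step n ^^ k) F" \<sigma> c] assms(1)[OF _ Suc.prems] assms(2) by simp
  finally show ?case by (simp add: algebra_simps)
qed simp

lemma pair_sum_sign_variance_le:
  assumes "n \<ge> 5" "\<sigma> permutes {1..n}"
  shows "(perm_step n ^^ k) (\<lambda>\<sigma>. (pair_sum n sign_kernel \<sigma>)\<^sup>2) \<sigma>
           \<le> (pair_sum n ((pair_step n ^^ k) sign_kernel) \<sigma>)\<^sup>2 + 64 * real k"
proof -
  have anti: "antisymmetric sign_kernel"
    using regular_kernel_sign unfolding regular_kernel_def by blast
  have "\<bar>(perm_step n ^^ r) (pair_sum n sign_kernel) (swap_locations i \<sigma>)
      - (perm_step n ^^ r) (pair_sum n sign_kernel) \<sigma>\<bar> \<le> 8"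
    if "i \<in> {1..<n}" "\<sigma> permutes {1..n}" for r i \<sigma>
    using pair_sum_swap_locations_diff_le[OF regular_kernel_funpow[OF regular_kernel_sign assms(1)] that]
      funpow_perm_step_pair_sum[OF anti] swap_locations_permutes[OF that(2,1)] that(2) assms(1) by simp
  from funpow_perm_step_variance_le[OF this _ assms(2), of k] show ?thesis
    using assms funpow_perm_step_pair_sum[OF anti _ assms(2)] by simp
qed

text \<open>The indicator of an inversion is \<open>(1 + sgn) / 2\<close> because there are no ties;
  the constant is half of the \<open>n * (n - 1) / 2\<close> pairs.\<close>

lemma card_inversions_eq_pair_sum:
  assumes "\<sigma> permutes {1..n}"
  shows "real (card (inversions n \<sigma>)) = pair_sum n sign_kernel \<sigma> / 2 + real n * (real n - 1) / 4"
proof -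
  have "real (card (inversions n \<sigma>)) = (\<Sum>p\<in>{1..n}. \<Sum>q\<in>{p<..n}. if \<sigma> q < \<sigma> p then 1 else 0)"
  proof -
    have "inversions n \<sigma> = (SIGMA p:{1..n}. {q\<in>{p<..n}. \<sigma> q < \<sigma> p})"
      by (auto simp: inversions_def)
    then have "card (inversions n \<sigma>) = (\<Sum>p\<in>{1..n}. card {q\<in>{p<..n}. \<sigma> q < \<sigma> p})" by simp
    then show ?thesis by (simp add: sum.If_cases Int_def)
  qed
  also have "\<dots> = (\<Sum>p\<in>{1..n}. \<Sum>q\<in>{p<..n}. sign_kernel (\<sigma> p) (\<sigma> q) / 2 + 1 / 2)"
  proof (intro sum.cong refl)
    fix p q assume pq: "p \<in> {1..n}" "q \<in> {p<..n}"
    have "\<sigma> p \<noteq> \<sigma> q" using pq permutes_inj[OF assms(1)] by (auto dest: injD)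
    then show "(if \<sigma> q < \<sigma> p then 1 else 0) = sign_kernel (\<sigma> p) (\<sigma> q) / 2 + 1 / 2"
      by (auto simp: sign_kernel_def sgn_if)
  qed
  also have "\<dots> = pair_sum n sign_kernel \<sigma> / 2 + (\<Sum>p\<in>{1..n}. real (n - p)) / 2"
    by (simp add: pair_sum_def sum.distrib sum_divide_distrib)
  also have "(\<Sum>p\<in>{1..n}. real (n - p)) = real n * (real n - 1) / 2"
  proof -
    have "(\<Sum>p\<in>{1..n}. real (n - p)) = (\<Sum>p\<in>{1..n}. real n - real p)"
      by (intro sum.cong) (auto simp: of_nat_diff)
    also have "\<dots> = real n * real n - (\<Sum>p\<in>{1..n}. real p)" by (simp add: sum_subtractf)
    also have "(\<Sum>p\<in>{1..n}. real p) = real n * (real n + 1) / 2"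
      by (induction n) (auto simp: field_simps)
    finally show ?thesis by (simp add: field_simps)
  qed
  finally show ?thesis by simp
qed

section \<open>Concentration\<close>

text \<open>Conditioning on the finitely many values of \<open>L\<close>. Independence is stated for
  real random variables, an indicator and \<open>G i (Y \<omega>)\<close>, so that the product rule
  for expectations applies to each summand.\<close>

lemma (in prob_space) finite_expectation_step:
  fixes L :: "'a \<Rightarrow> nat" and Y :: "'a \<Rightarrow> 'b" and G :: "nat \<Rightarrow> 'b \<Rightarrow> real"
  assumes [measurable]: "L \<in> measurable M (count_space UNIV)" "Y \<in> measurable M (count_space UNIV)"
    and ind: "\<And>i. indep_var borel (\<lambda>\<omega>. indicator {i} (L \<omega>)) borel (\<lambda>\<omega>. G i (Y \<omega>))"
    and fin: "finite I" and AE_L: "AE \<omega> in M. L \<omega> \<in> I"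
    and bound: "\<And>i y. \<bar>G i y\<bar> \<le> B"
  shows "expectation (\<lambda>\<omega>. G (L \<omega>) (Y \<omega>))
           = (\<Sum>i\<in>I. prob {\<omega>\<in>space M. L \<omega> = i} * expectation (\<lambda>\<omega>. G i (Y \<omega>)))"
proof -
  have rvG [measurable]: "random_variable borel (\<lambda>\<omega>. G i (Y \<omega>))" for i
    by (rule measurable_compose[where N = "count_space UNIV"]) auto
  have int1: "integrable M (\<lambda>\<omega>. indicator {i} (L \<omega>) :: real)" for i
    by (intro integrable_const_bound[where B = 1]) (auto simp: indicator_def)
  have int2: "integrable M (\<lambda>\<omega>. G i (Y \<omega>))" for i
    using bound by (intro integrable_const_bound[where B = B] rvG) auto
  have int: "integrable M (\<lambda>\<omega>. indicator {i} (L \<omega>) * G i (Y \<omega>))" for i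
    using ind int1 int2 by (rule indep_var_integrable)
  have "expectation (\<lambda>\<omega>. G (L \<omega>) (Y \<omega>)) = expectation (\<lambda>\<omega>. \<Sum>i\<in>I. indicator {i} (L \<omega>) * G i (Y \<omega>))"
  proof (rule integral_cong_AE)
    show "AE \<omega> in M. G (L \<omega>) (Y \<omega>) = (\<Sum>i\<in>I. indicator {i} (L \<omega>) * G i (Y \<omega>))"
      using AE_L by eventually_elim (simp add: indicator_def fin)
    show "random_variable borel (\<lambda>\<omega>. \<Sum>i\<in>I. indicator {i} (L \<omega>) * G i (Y \<omega>))"
      by (intro borel_measurable_sum borel_measurable_integrable int)
    show "random_variable borel (\<lambda>\<omega>. G (L \<omega>) (Y \<omega>))"
      by (rule measurable_compose_countable[where g = L]) auto
  qed
  also have "\<dots> = (\<Sum>i\<in>I. expectation (\<lambda>\<omega>. indicator {i} (L \<omega>) * G i (Y \<omega>)))"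
    using int by (rule Bochner_Integration.integral_sum)
  also have "\<dots> = (\<Sum>i\<in>I. prob {\<omega>\<in>space M. L \<omega> = i} * expectation (\<lambda>\<omega>. G i (Y \<omega>)))"
  proof (intro sum.cong refl)
    fix i
    have "expectation (\<lambda>\<omega>. indicator {i} (L \<omega>) * G i (Y \<omega>))
        = expectation (\<lambda>\<omega>. indicator {i} (L \<omega>)) * expectation (\<lambda>\<omega>. G i (Y \<omega>))"
      using ind int1 int2 by (rule indep_var_lebesgue_integral)
    also have "expectation (\<lambda>\<omega>. indicator {i} (L \<omega>)) = expectation (indicator {\<omega>\<in>space M. L \<omega> = i})"
      by (intro Bochner_Integration.integral_cong) (auto simp: indicator_def)
    also have "\<dots> = prob {\<omega>\<in>space M. L \<omega> = i}" by simp
    finally show "expectation (\<lambda>\<omega>. indicator {i} (L \<omega>) * G i (Y \<omega>))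
        = prob {\<omega>\<in>space M. L \<omega> = i} * expectation (\<lambda>\<omega>. G i (Y \<omega>))" .
  qed
  finally show ?thesis .
qed

lemma state_after_cong: "(\<And>j. j < k \<Longrightarrow> l j = l' j) \<Longrightarrow> state_after l k = state_after l' k"
  by (induction k) auto

text \<open>The states carry the discrete sigma-algebra although there are uncountably many
  functions; the location of each exchange has only countably many values, which can be fixed one at
  a time.\<close>

lemma measurable_state_after:
  assumes "\<And>j. j < k \<Longrightarrow> (\<lambda>x. f x j) \<in> measurable M (count_space UNIV)"
  shows "(\<lambda>x. state_after (f x) k) \<in> measurable M (count_space UNIV)"
  using assms
proof (induction k)
  case (Suc k)
  show ?case
    unfolding state_after.simps
  proof (rule measurable_compose_countable[where g = "\<lambda>x. f x k"])
    show "(\<lambda>x. swap_locations i (state_after (f x) k)) \<in> measurable M (count_space UNIV)" for i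
      by (rule measurable_compose[OF Suc.IH]) (use Suc.prems in auto)
  qed (use Suc.prems in auto)
qed simp

text \<open>The last exchange is independent of the earlier ones; averaging over it replaces
  \<open>F\<close> by \<open>perm_step n F\<close>, to which the induction hypothesis applies. Hence
  \<open>F\<close> varies in the induction.\<close>

lemma (in prob_space) expectation_state_after:
  assumes ind: "indep_vars (\<lambda>_. count_space UNIV) L UNIV"
    and AE_L: "\<And>k. AE \<omega> in M. L k \<omega> \<in> {1..<n}"
    and unif: "\<And>k i. i \<in> {1..<n} \<Longrightarrow> prob {\<omega>\<in>space M. L k \<omega> = i} = 1 / (real n - 1)"
    and "\<And>\<sigma>. \<bar>F \<sigma>\<bar> \<le> B" and n: "n \<ge> 2"
  shows "expectation (\<lambda>\<omega>. F (state_after (\<lambda>j. L j \<omega>) k)) = (perm_step n ^^ k) F id"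
  using assms(4)
proof (induction k arbitrary: F)
  case 0
  show ?case by (simp add: prob_space)
next
  case (Suc k)
  have "indep_var (PiM {k} (\<lambda>_. count_space UNIV)) (\<lambda>\<omega>. \<lambda>i\<in>{k}. L i \<omega>)
          (PiM {..<k} (\<lambda>_. count_space UNIV)) (\<lambda>\<omega>. \<lambda>i\<in>{..<k}. L i \<omega>)"
    by (rule indep_var_restrict[OF ind]) auto
  then have "indep_var borel ((\<lambda>l. indicator {i} (l k)) \<circ> (\<lambda>\<omega>. \<lambda>i\<in>{k}. L i \<omega>))
     borel ((\<lambda>l. F (swap_locations i (state_after l k))) \<circ> (\<lambda>\<omega>. \<lambda>i\<in>{..<k}. L i \<omega>))" for i
    by (rule indep_var_compose)
       (auto intro!: measurable_compose[OF measurable_state_after] measurable_compose[OF measurable_component_singleton])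
  then have ind': "indep_var borel (\<lambda>\<omega>. indicator {i} (L k \<omega>))
      borel (\<lambda>\<omega>. F (swap_locations i (state_after (\<lambda>j. L j \<omega>) k)))" for i
    using state_after_cong[of k "\<lambda>i\<in>{..<k}. L i _" "\<lambda>j. L j _"] by (simp add: o_def)
  have rvL: "random_variable (count_space UNIV) (L j)" for j
    using ind unfolding indep_vars_def by auto
  have rvS [measurable]: "(\<lambda>\<omega>. state_after (\<lambda>j. L j \<omega>) k) \<in> measurable M (count_space UNIV)"
    by (intro measurable_state_after rvL)
  have rvF: "random_variable borel (\<lambda>\<omega>. g (state_after (\<lambda>j. L j \<omega>) k))" for g :: "_ \<Rightarrow> real"
    by (rule measurable_compose[OF rvS]) simp
  have "expectation (\<lambda>\<omega>. F (swap_locations (L k \<omega>) (state_after (\<lambda>j. L j \<omega>) k)))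
      = (\<Sum>i\<in>{1..<n}. prob {\<omega>\<in>space M. L k \<omega> = i}
            * expectation (\<lambda>\<omega>. F (swap_locations i (state_after (\<lambda>j. L j \<omega>) k))))"
    using finite_expectation_step[where G = "\<lambda>i \<sigma>. F (swap_locations i \<sigma>)", OF rvL rvS ind' _ AE_L Suc.prems]
    by simp
  also have "\<dots> = (\<Sum>i\<in>{1..<n}. expectation (\<lambda>\<omega>. F (swap_locations i (state_after (\<lambda>j. L j \<omega>) k)))) / (real n - 1)"
    using unif by (simp add: sum_divide_distrib)
  also have "\<dots> = expectation (\<lambda>\<omega>. perm_step n F (state_after (\<lambda>j. L j \<omega>) k))"
  proof -
    have "integrable M (\<lambda>\<omega>. F (swap_locations i (state_after (\<lambda>j. L j \<omega>) k)))" for i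
      by (intro integrable_const_bound[where B = B] rvF) (simp add: Suc.prems)
    then show ?thesis
      by (simp add: perm_step_def)
  qed
  also have "\<dots> = (perm_step n ^^ k) (perm_step n F) id"
  proof (rule Suc.IH)
    fix \<sigma>
    have "\<bar>\<Sum>i\<in>{1..<n}. F (swap_locations i \<sigma>)\<bar> \<le> (\<Sum>i\<in>{1..<n}. B)"
      by (intro order_trans[OF sum_abs] sum_mono Suc.prems)
    then show "\<bar>perm_step n F \<sigma>\<bar> \<le> B"
      using n by (simp add: perm_step_def field_simps of_nat_diff)
  qed
  finally show ?case by (simp only: state_after.simps funpow_Suc_right o_apply)
qed

section \<open>Fluctuation of the number of jumps\<close>

lemma jump_count_bounds:
  assumes nonneg: "\<And>j. 0 \<le> h j" and "(\<Sum>j<m. h j) \<le> s" "s < (\<Sum>j<Suc m'. h j)"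
  shows "m \<le> jump_count h s" "jump_count h s \<le> m'"
proof -
  let ?K = "{k. (\<Sum>j\<le>k. h j) \<le> s}"
  have "?K \<subseteq> {..<m'}"
  proof
    fix k assume k: "k \<in> ?K"
    show "k \<in> {..<m'}"
    proof (rule ccontr)
      assume "k \<notin> {..<m'}"
      then have "(\<Sum>j<Suc m'. h j) \<le> (\<Sum>j\<le>k. h j)"
        using nonneg by (intro sum_mono2) auto
      then show False using k assms(3) by auto
    qed
  qed
  then show "jump_count h s \<le> m'"
    using card_mono[of "{..<m'}" ?K] by (simp add: jump_count_def)
  \<comment> \<open>The jump with index \<open>k\<close> happens after the \<open>k + 1\<close>
    holding times \<open>h 0\<close> to \<open>h k\<close>, so the first \<open>m\<close> holding
    times decide about the indices below \<open>m\<close>.\<close>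
  have "{..<m} \<subseteq> ?K"
  proof
    fix k assume "k \<in> {..<m}"
    then have "(\<Sum>j\<le>k. h j) \<le> (\<Sum>j<m. h j)"
      using nonneg by (intro sum_mono2) auto
    then show "k \<in> ?K" using assms(2) by auto
  qed
  \<comment> \<open>An infinite set would have cardinality 0 and break the lower bound.\<close>
  moreover have "finite ?K" using \<open>?K \<subseteq> {..<m'}\<close> finite_subset by blast
  ultimately show "m \<le> jump_count h s"
    using card_mono[of ?K "{..<m}"] by (simp add: jump_count_def)
qed

lemma (in prob_space) exponential_sum_deviation:
  assumes ind: "indep_vars (\<lambda>_. borel) H UNIV"
    and dist: "\<And>k::nat. distributed M lborel (H k) (exponential_density 1)" and "a > 0"
  shows "prob {\<omega>\<in>space M. a \<le> \<bar>(\<Sum>j<m. H j \<omega>) - real m\<bar>} \<le> real m / a\<^sup>2"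
proof (cases "m = 0")
  case True
  then show ?thesis using \<open>a > 0\<close> by simp
next
  case False
  \<comment> \<open>The shape index of \<open>erlang_density\<close> is 0 for a single exponential
    variable, hence \<open>m - 1\<close> here and the separate case \<open>m = 0\<close>. Mean and
    variance are both \<open>m\<close>.\<close>
  have D: "distributed M lborel (\<lambda>\<omega>. \<Sum>j<m. H j \<omega>) (erlang_density (m - 1) 1)"
    using exponential_distributed_sum[of "{..<m}" 1 H] dist indep_vars_subset[OF ind] False by auto
  have rv: "random_variable borel (\<lambda>\<omega>. \<Sum>j<m. H j \<omega>)"
    using distributed_measurable[OF D] by simp
  have "expectation (\<lambda>\<omega>. \<Sum>j<m. H j \<omega>) = real m"
    using erlang_ith_moment[OF _ D, of 1] False by (cases m) (auto simp del: sum.lessThan_Suc)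
  moreover have "variance (\<lambda>\<omega>. \<Sum>j<m. H j \<omega>) = real m"
    using erlang_distributed_variance[OF _ D] False by (simp add: of_nat_diff)
  ultimately show ?thesis
    using Chebyshev_inequality[OF rv erlang_ith_moment_integrable[OF _ D, of 2] \<open>a > 0\<close>] by simp
qed

text \<open>Too few jumps means that about \<open>s - \<delta>\<close> holding times last longer
  than \<open>s\<close>; too many means that more than \<open>s + \<delta>\<close> of them fit into
  \<open>s\<close>. The conclusion supplies a measurable exceptional set, as the number of jumps is
  controlled pointwise.\<close>

lemma (in prob_space) jump_count_deviation:
  assumes ind: "indep_vars (\<lambda>_. borel) H UNIV"
    and dist: "\<And>k::nat. distributed M lborel (H k) (exponential_density 1)"
    and "s \<ge> 0" "\<delta> > 1"
  shows "\<exists>A\<in>events. prob A \<le> 2 * (s + \<delta> + 1) / (\<delta> - 1)\<^sup>2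
           \<and> (\<forall>\<omega>\<in>space M - A. \<bar>real (jump_count (\<lambda>k. H k \<omega>) s) - s\<bar> \<le> \<delta>)"
proof -
  have rv [measurable]: "random_variable borel (H k)" for k
    using distributed_measurable[OF dist] by simp
  have "AE \<omega> in M. 0 \<le> H k \<omega>" for k
  proof -
    have "AE x in distr M lborel (H k). 0 \<le> x"
      unfolding distributed_distr_eq_density[OF dist]
      by (subst AE_density) (auto simp: erlang_density_def)
    then show ?thesis by (subst (asm) AE_distr_iff) auto
  qed
  then have "AE \<omega> in M. \<forall>k. 0 \<le> H k \<omega>" by (simp add: AE_all_countable)
  then obtain N where N: "N \<in> events" "prob N = 0" "{\<omega>\<in>space M. \<not> (\<forall>k. 0 \<le> H k \<omega>)} \<subseteq> N"
    by (auto elim!: AE_E simp: measure_def)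
  \<comment> \<open>Rounding up costs at most one, so a sum of \<open>m\<close> holding times above
    \<open>s\<close> deviates by more than \<open>\<delta> - 1\<close>. Since \<open>Suc m'\<close>
    exceeds \<open>s + \<delta>\<close>, a sum of \<open>Suc m'\<close> of them below
    \<open>s\<close> deviates by more than \<open>\<delta>\<close>.\<close>
  define m where "m = nat \<lceil>s - \<delta>\<rceil>"
  define m' where "m' = nat \<lfloor>s + \<delta>\<rfloor>"
  define A1 where "A1 = {\<omega>\<in>space M. \<delta> - 1 \<le> \<bar>(\<Sum>j<m. H j \<omega>) - real m\<bar>}"
  define A2 where "A2 = {\<omega>\<in>space M. \<delta> \<le> \<bar>(\<Sum>j<Suc m'. H j \<omega>) - real (Suc m')\<bar>}"
  have [measurable]: "A1 \<in> events" "A2 \<in> events" by (auto simp: A1_def A2_def)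
  have m_le: "real m \<le> s + 1" using assms(3,4) by (simp add: m_def) linarith
  have m'_le: "real m' \<le> s + \<delta>" "s + \<delta> < real (Suc m')" using assms(3,4) by (auto simp: m'_def) linarith
  have "prob A1 \<le> real m / (\<delta> - 1)\<^sup>2"
    unfolding A1_def using assms(4) by (intro exponential_sum_deviation[OF ind dist]) auto
  also have "\<dots> \<le> (s + \<delta> + 1) / (\<delta> - 1)\<^sup>2"
    using m_le assms(4) by (intro divide_right_mono) auto
  finally have p1: "prob A1 \<le> (s + \<delta> + 1) / (\<delta> - 1)\<^sup>2" .
  have "prob A2 \<le> real (Suc m') / \<delta>\<^sup>2"
    unfolding A2_def using assms(4) by (intro exponential_sum_deviation[OF ind dist]) auto
  also have "\<dots> \<le> (s + \<delta> + 1) / (\<delta> - 1)\<^sup>2"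
    using m'_le assms(3,4) by (intro frac_le power_mono) auto
  finally have p2: "prob A2 \<le> (s + \<delta> + 1) / (\<delta> - 1)\<^sup>2" .
  have "prob (N \<union> (A1 \<union> A2)) \<le> prob N + (prob A1 + prob A2)"
    by (intro order_trans[OF measure_Un_le] add_left_mono measure_Un_le) (auto simp: N)
  also have "\<dots> \<le> 2 * ((s + \<delta> + 1) / (\<delta> - 1)\<^sup>2)" using p1 p2 N(2) by linarith
  also have "\<dots> = 2 * (s + \<delta> + 1) / (\<delta> - 1)\<^sup>2" by simp
  finally have "prob (N \<union> (A1 \<union> A2)) \<le> 2 * (s + \<delta> + 1) / (\<delta> - 1)\<^sup>2" .
  moreover have "\<bar>real (jump_count (\<lambda>k. H k \<omega>) s) - s\<bar> \<le> \<delta>" if \<omega>: "\<omega> \<in> space M - (N \<union> (A1 \<union> A2))" for \<omega>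
  proof -
    have nonneg: "\<And>k. 0 \<le> H k \<omega>" using \<omega> N(3) by auto
    have "(\<Sum>j<m. H j \<omega>) \<le> s"
    \<comment> \<open>When \<open>s - \<delta>\<close> is negative, \<open>nat\<close> truncates and
      the estimate \<open>m < s - \<delta> + 1\<close> may fail; the empty sum is then at most
      \<open>s\<close> anyway.\<close>
    proof (cases "m = 0")
      case False
      then have "real m < s - \<delta> + 1" unfolding m_def by linarith
      then show ?thesis using \<omega> by (auto simp: A1_def)
    qed (use \<open>s \<ge> 0\<close> in simp)
    moreover have "s < (\<Sum>j<Suc m'. H j \<omega>)"
      using \<omega> m'_le(2) by (auto simp: A2_def)
    ultimately have "m \<le> jump_count (\<lambda>k. H k \<omega>) s" "jump_count (\<lambda>k. H k \<omega>) s \<le> m'"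
      using jump_count_bounds[of "\<lambda>k. H k \<omega>"] nonneg by blast+
    moreover have "s - \<delta> \<le> real m" unfolding m_def by linarith
    ultimately show ?thesis using m'_le(1) by linarith
  qed
  moreover have "N \<union> (A1 \<union> A2) \<in> events" using N by auto
  ultimately show ?thesis by blast
qed

section \<open>Concentration of the distance\<close>

lemma abs_pair_sum_sign_le: "\<bar>pair_sum n sign_kernel \<sigma>\<bar> \<le> real n ^ 2"
proof -
  have "\<bar>pair_sum n sign_kernel \<sigma>\<bar> \<le> (\<Sum>p\<in>{1..n}. \<Sum>q\<in>{p<..n}. 1)"
    unfolding pair_sum_def
    by (intro order_trans[OF sum_abs] sum_mono) (auto simp: sign_kernel_def sgn_if)
  also have "\<dots> \<le> (\<Sum>p\<in>{1..n}. real n)" by (intro sum_mono) auto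
  finally show ?thesis by (simp add: power2_eq_square)
qed

text \<open>Chebyshev's inequality. Both moments are expectations of bounded functions of the state,
  so the operator formula applies to the pair sum and to its square; 64 is the square of the
  increment bound 8.\<close>

lemma (in prob_space) pair_sum_state_after_deviation:
  assumes ind: "indep_vars (\<lambda>_. count_space UNIV) L UNIV"
    and AE_L: "\<And>k. AE \<omega> in M. L k \<omega> \<in> {1..<n}"
    and unif: "\<And>k i. i \<in> {1..<n} \<Longrightarrow> prob {\<omega>\<in>space M. L k \<omega> = i} = 1 / (real n - 1)"
    and n: "n \<ge> 5" and "a > 0"
  defines "Z \<equiv> \<lambda>k \<omega>. pair_sum n sign_kernel (state_after (\<lambda>j. L j \<omega>) k)"
    and "c \<equiv> \<lambda>k. pair_sum n ((pair_step n ^^ k) sign_kernel) id"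
  shows "{\<omega>\<in>space M. a \<le> \<bar>Z k \<omega> - c k\<bar>} \<in> events"
    and "prob {\<omega>\<in>space M. a \<le> \<bar>Z k \<omega> - c k\<bar>} \<le> 64 * real k / a\<^sup>2"
proof -
  have "random_variable (count_space UNIV) (L j)" for j
    using ind unfolding indep_vars_def by auto
  then have "(\<lambda>\<omega>. state_after (\<lambda>j. L j \<omega>) k) \<in> measurable M (count_space UNIV)"
    by (intro measurable_state_after) auto
  then have rv [measurable]: "random_variable borel (Z k)"
    unfolding Z_def by (rule measurable_compose) simp
  show "{\<omega>\<in>space M. a \<le> \<bar>Z k \<omega> - c k\<bar>} \<in> events" by measurable
  have sq: "\<bar>(pair_sum n sign_kernel \<sigma>)\<^sup>2\<bar> \<le> (real n ^ 2)\<^sup>2" for \<sigma>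
    using power_mono[OF abs_pair_sum_sign_le[of n \<sigma>], of 2] by simp
  have n2: "n \<ge> 2" using n by simp
  have anti: "antisymmetric sign_kernel"
    using regular_kernel_sign unfolding regular_kernel_def by blast
  have id: "id permutes {1..n}" by (simp add: permutes_def)
  have "expectation (Z k) = (perm_step n ^^ k) (pair_sum n sign_kernel) id"
    unfolding Z_def by (rule expectation_state_after[OF ind AE_L unif abs_pair_sum_sign_le n2])
  then have mean: "expectation (Z k) = c k"
    unfolding c_def using funpow_perm_step_pair_sum[OF anti n2 id] by simp
  have "expectation (\<lambda>\<omega>. (Z k \<omega>)\<^sup>2) = (perm_step n ^^ k) (\<lambda>\<sigma>. (pair_sum n sign_kernel \<sigma>)\<^sup>2) id"
    unfolding Z_def by (rule expectation_state_after[OF ind AE_L unif sq n2])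
  also have "\<dots> \<le> (c k)\<^sup>2 + 64 * real k"
    unfolding c_def by (rule pair_sum_sign_variance_le[OF n id])
  finally have m2: "expectation (\<lambda>\<omega>. (Z k \<omega>)\<^sup>2) \<le> (c k)\<^sup>2 + 64 * real k" .
  have int2: "integrable M (\<lambda>\<omega>. (Z k \<omega>)\<^sup>2)"
    using sq by (intro integrable_const_bound[where B = "(real n ^ 2)\<^sup>2"] borel_measurable_power rv) (auto simp: Z_def)
  have int1: "integrable M (Z k)"
    using abs_pair_sum_sign_le by (intro integrable_const_bound[where B = "real n ^ 2"] rv) (auto simp: Z_def)
  have "prob {\<omega>\<in>space M. a \<le> \<bar>Z k \<omega> - c k\<bar>} \<le> variance (Z k) / a\<^sup>2"
    using Chebyshev_inequality[OF rv int2 \<open>a > 0\<close>] mean by simp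
  also have "\<dots> \<le> 64 * real k / a\<^sup>2"
    using m2 mean variance_eq[OF int1 int2] by (intro divide_right_mono) auto
  finally show "prob {\<omega>\<in>space M. a \<le> \<bar>Z k \<omega> - c k\<bar>} \<le> 64 * real k / a\<^sup>2" .
qed

text \<open>Three errors add up: \<open>\<delta>\<close> from the number of jumps, 1 from replacing
  \<open>s\<close> by its integer part, and \<open>a / 2\<close> because the pair sum enters the
  distance with the factor 1/2.\<close>

lemma adj_dist_deviation:
  assumes walk: "adjacent_transposition_walk n M X" and n: "n \<ge> 5"
    and "s \<ge> 0" "\<delta> > 1" "a > 0"
  shows "\<exists>A\<in>sets M. measure M A \<le> 2 * (s + \<delta> + 1) / (\<delta> - 1)\<^sup>2 + 64 * s / a\<^sup>2
     \<and> (\<forall>\<omega>\<in>space M - A.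
          \<bar>real (adj_dist n (X s \<omega>))
             - (pair_sum n ((pair_step n ^^ nat \<lfloor>s\<rfloor>) sign_kernel) id / 2 + real n * (real n - 1) / 4)\<bar>
          \<le> \<delta> + 1 + a / 2)"
proof -
  interpret prob_space M using walk by (simp add: adjacent_transposition_walk_def)
  obtain H :: "nat \<Rightarrow> 'a \<Rightarrow> real" and L :: "nat \<Rightarrow> 'a \<Rightarrow> nat"
    where ind: "indep_vars (\<lambda>_. borel \<Otimes>\<^sub>M count_space UNIV) (\<lambda>k \<omega>. (H k \<omega>, L k \<omega>)) UNIV"
    and law: "\<And>k. distr M (borel \<Otimes>\<^sub>M count_space UNIV) (\<lambda>\<omega>. (H k \<omega>, L k \<omega>)) =
               density lborel (exponential_density 1) \<Otimes>\<^sub>M measure_pmf (pmf_of_set {1..<n})"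
    and X: "\<And>s \<omega>. s \<ge> 0 \<Longrightarrow> \<omega> \<in> space M \<Longrightarrow>
               X s \<omega> = state_after (\<lambda>k. L k \<omega>) (jump_count (\<lambda>k. H k \<omega>) s)"
    using walk unfolding adjacent_transposition_walk_def by blast
  have pair_rv: "(\<lambda>\<omega>. (H k \<omega>, L k \<omega>)) \<in> measurable M (borel \<Otimes>\<^sub>M count_space UNIV)" for k
    using ind unfolding indep_vars_def by auto
  have rvH [measurable]: "random_variable borel (H k)" for k
    using measurable_compose[OF pair_rv measurable_fst] by simp
  have rvL [measurable]: "random_variable (count_space UNIV) (L k)" for k
    using measurable_compose[OF pair_rv measurable_snd] by simp
  have indH: "indep_vars (\<lambda>_. borel) H UNIV"
    using indep_vars_compose2[OF ind, of "\<lambda>_. fst" "\<lambda>_. borel"] by simp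
  have indL: "indep_vars (\<lambda>_. count_space UNIV) L UNIV"
    using indep_vars_compose2[OF ind, of "\<lambda>_. snd" "\<lambda>_. count_space UNIV"] by simp
  interpret E: prob_space "density lborel (exponential_density 1)"
    by (rule prob_space_exponential_density) simp
  \<comment> \<open>Both marginals are read off from rectangles of the product law, the other factor
    having mass one.\<close>
  have distH: "distributed M lborel (H k) (exponential_density 1)" for k
  proof -
    have "distr M lborel (H k) = distr (distr M (borel \<Otimes>\<^sub>M count_space UNIV) (\<lambda>\<omega>. (H k \<omega>, L k \<omega>))) lborel fst"
      using pair_rv[of k] by (subst distr_distr) (auto simp: o_def)
    also have "\<dots> = density lborel (exponential_density 1)"
    proof (rule measure_eqI)
      fix B assume "B \<in> sets (distr (distr M (borel \<Otimes>\<^sub>M count_space UNIV) (\<lambda>\<omega>. (H k \<omega>, L k \<omega>))) lborel fst)"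
      then have B: "B \<in> sets borel" by simp
      have "emeasure (distr (distr M (borel \<Otimes>\<^sub>M count_space UNIV) (\<lambda>\<omega>. (H k \<omega>, L k \<omega>))) lborel fst) B
          = emeasure (density lborel (exponential_density 1) \<Otimes>\<^sub>M measure_pmf (pmf_of_set {1..<n})) (B \<times> UNIV)"
        unfolding law using B
        by (subst emeasure_distr) (auto intro!: arg_cong2[where f = emeasure] simp: space_pair_measure)
      also have "\<dots> = emeasure (density lborel (exponential_density 1)) B"
        using B by (subst measure_pmf.emeasure_pair_measure_Times) (auto simp: measure_pmf.emeasure_space_1[simplified])
      finally show "emeasure (distr (distr M (borel \<Otimes>\<^sub>M count_space UNIV) (\<lambda>\<omega>. (H k \<omega>, L k \<omega>))) lborel fst) B
          = emeasure (density lborel (exponential_density 1)) B" .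
    qed simp
    finally show ?thesis by (simp add: distributed_def)
  qed
  have probL: "emeasure M {\<omega>\<in>space M. L k \<omega> \<in> C} = emeasure (measure_pmf (pmf_of_set {1..<n})) C" for k C
  proof -
    have "emeasure M {\<omega>\<in>space M. L k \<omega> \<in> C}
        = emeasure (distr M (borel \<Otimes>\<^sub>M count_space UNIV) (\<lambda>\<omega>. (H k \<omega>, L k \<omega>))) (UNIV \<times> C)"
      using pair_rv[of k] by (subst emeasure_distr) (auto intro!: arg_cong2[where f = emeasure])
    also have "\<dots> = emeasure (measure_pmf (pmf_of_set {1..<n})) C"
      unfolding law by (subst measure_pmf.emeasure_pair_measure_Times) (use E.emeasure_space_1 in auto)
    finally show ?thesis .
  qed
  have ne: "{1..<n} \<noteq> {}" using n by auto
  have unif: "prob {\<omega>\<in>space M. L k \<omega> = i} = 1 / (real n - 1)" if "i \<in> {1..<n}" for k i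
    using probL[of k "{i}"] that ne n by (simp add: measure_def emeasure_pmf_single of_nat_diff)
  have AE_L: "AE \<omega> in M. L k \<omega> \<in> {1..<n}" for k
  proof -
    have "emeasure M {\<omega>\<in>space M. L k \<omega> \<in> - {1..<n}} = 0"
      unfolding probL using ne by (subst emeasure_pmf_of_set) auto
    then show ?thesis by (intro AE_I[where N = "{\<omega>\<in>space M. L k \<omega> \<in> - {1..<n}}"]) auto
  qed
  have "AE \<omega> in M. \<forall>k. L k \<omega> \<in> {1..<n}" by (subst AE_all_countable) (use AE_L in blast) 
  then obtain N where N: "N \<in> events" "prob N = 0" "{\<omega>\<in>space M. \<not> (\<forall>k. L k \<omega> \<in> {1..<n})} \<subseteq> N"
    by (auto elim!: AE_E simp: measure_def)
  obtain A1 where A1: "A1 \<in> events" "prob A1 \<le> 2 * (s + \<delta> + 1) / (\<delta> - 1)\<^sup>2"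
    "\<And>\<omega>. \<omega> \<in> space M - A1 \<Longrightarrow> \<bar>real (jump_count (\<lambda>k. H k \<omega>) s) - s\<bar> \<le> \<delta>"
    using jump_count_deviation[OF indH distH \<open>s \<ge> 0\<close> \<open>\<delta> > 1\<close>] by blast
  define k where "k = nat \<lfloor>s\<rfloor>"
  define c where "c = pair_sum n ((pair_step n ^^ k) sign_kernel) id"
  define A2 where "A2 = {\<omega>\<in>space M. a \<le> \<bar>pair_sum n sign_kernel (state_after (\<lambda>j. L j \<omega>) k) - c\<bar>}"
  have k: "real k \<le> s" "s \<le> real k + 1" using \<open>s \<ge> 0\<close> unfolding k_def by linarith+
  have A2: "A2 \<in> events" "prob A2 \<le> 64 * real k / a\<^sup>2"
    using pair_sum_state_after_deviation[OF indL AE_L unif n \<open>a > 0\<close>, of k] unfolding A2_def c_def by auto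
  have "64 * real k / a\<^sup>2 \<le> 64 * s / a\<^sup>2" using k by (intro divide_right_mono) auto
  moreover have "prob (N \<union> (A1 \<union> A2)) \<le> prob N + (prob A1 + prob A2)"
    by (intro order_trans[OF measure_Un_le] add_left_mono measure_Un_le) (auto simp: N A1 A2)
  ultimately have "prob (N \<union> (A1 \<union> A2)) \<le> 2 * (s + \<delta> + 1) / (\<delta> - 1)\<^sup>2 + 64 * s / a\<^sup>2"
    using A1 A2 N by linarith
  moreover have "\<bar>real (adj_dist n (X s \<omega>)) - (c / 2 + real n * (real n - 1) / 4)\<bar> \<le> \<delta> + 1 + a / 2"
    if \<omega>: "\<omega> \<in> space M - (N \<union> (A1 \<union> A2))" for \<omega>
  proof -
    define l where "l = (\<lambda>k. L k \<omega>)"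
    define J where "J = jump_count (\<lambda>k. H k \<omega>) s"
    have l: "l j \<in> {1..<n}" for j using \<omega> N(3) by (auto simp: l_def)
    have perm: "state_after l m permutes {1..n}" for m using l by (rule state_after_permutes)
    have "real (adj_dist n (X s \<omega>)) = real (card (inversions n (state_after l J)))"
      using X[OF \<open>s \<ge> 0\<close>, of \<omega>] \<omega> adj_dist_eq_card_inversions[OF perm] by (simp add: l_def J_def)
    moreover have "\<bar>real J - s\<bar> \<le> \<delta>" using A1(3) \<omega> by (auto simp: J_def)
    then have "\<bar>real (card (inversions n (state_after l J))) - real (card (inversions n (state_after l k)))\<bar> \<le> \<delta> + 1"
      using card_inversions_state_after_le[of l n J k] l k by fastforce
    moreover have "\<bar>pair_sum n sign_kernel (state_after l k) - c\<bar> < a"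
      using \<omega> by (auto simp: A2_def l_def)
    then have "\<bar>real (card (inversions n (state_after l k))) - (c / 2 + real n * (real n - 1) / 4)\<bar> \<le> a / 2"
      using card_inversions_eq_pair_sum[OF perm, of k] by linarith
    ultimately show ?thesis by linarith
  qed
  moreover have "N \<union> (A1 \<union> A2) \<in> events" using N A1 A2 by auto
  ultimately show ?thesis unfolding c_def k_def by blast
qed

section \<open>Eigenfunctions and Riemann sums\<close>

lemma pair_step_cong:
  assumes "\<And>a b. a \<in> {1..n} \<Longrightarrow> b \<in> {1..n} \<Longrightarrow> g a b = h a b" "a \<in> {1..n}" "b \<in> {1..n}"
  shows "pair_step n g a b = pair_step n h a b"
  unfolding pair_step_def using assms by (simp only: site_above_in site_below_in)

lemma funpow_pair_step_scale: "(pair_step n ^^ k) (\<lambda>a b. c * g a b) = (\<lambda>a b. c * (pair_step n ^^ k) g a b)"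
  by (induction k) (auto simp: pair_step_def fun_eq_iff field_simps)

lemma funpow_pair_step_add:
  "(pair_step n ^^ k) (\<lambda>a b. g a b + h a b) = (\<lambda>a b. (pair_step n ^^ k) g a b + (pair_step n ^^ k) h a b)"
proof (induction k)
  case (Suc k)
  have "pair_step n (\<lambda>a b. f a b + f' a b) = (\<lambda>a b. pair_step n f a b + pair_step n f' a b)" for f f'
    by (simp add: pair_step_def fun_eq_iff algebra_simps add_divide_distrib)
  with Suc show ?case by simp
qed simp

lemma funpow_pair_step_diff:
  "(pair_step n ^^ k) (\<lambda>a b. g a b - h a b) = (\<lambda>a b. (pair_step n ^^ k) g a b - (pair_step n ^^ k) h a b)"
  using funpow_pair_step_add[where n = n and k = k and g = g and h = "\<lambda>a b. -1 * h a b"]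
    funpow_pair_step_scale[where n = n and k = k and c = "-1" and g = h]
  by simp

lemma abs_pair_sum_id_le: "\<bar>pair_sum n g id\<bar> \<le> (\<Sum>a\<in>{1..n}. \<Sum>b\<in>{1..n}. \<bar>g a b\<bar>)"
proof -
  have "\<bar>pair_sum n g id\<bar> \<le> (\<Sum>a\<in>{1..n}. \<Sum>b\<in>{a<..n}. \<bar>g a b\<bar>)"
    unfolding pair_sum_def id_apply by (intro order_trans[OF sum_abs] sum_mono) auto
  also have "\<dots> \<le> (\<Sum>a\<in>{1..n}. \<Sum>b\<in>{1..n}. \<bar>g a b\<bar>)"
    by (intro sum_mono sum_mono2) auto
  finally show ?thesis .
qed

section \<open>Cosines as exact eigenfunctions on the grid\<close>

definition gridpt :: "nat \<Rightarrow> nat \<Rightarrow> real" where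
  "gridpt n a = (real a - 1 / 2) / real n"

lemma gridpt_in: "a \<in> {1..n} \<Longrightarrow> gridpt n a \<in> {0..1}"
  by (auto simp: gridpt_def field_simps)

abbreviation cosine :: "nat \<Rightarrow> real \<Rightarrow> real" where
  "cosine m x \<equiv> cos (pi * real m * x)"

text \<open>The half-step shift of the grid makes the cosines exact eigenfunctions of the discrete
  Neumann Laplacian, boundary sites included.\<close>

lemma cosine_gridpt_neighbours:
  assumes "a \<in> {1..n}"
  shows "cosine m (gridpt n (site_above n a)) + cosine m (gridpt n (site_below a))
           = 2 * cos (pi * real m / real n) * cosine m (gridpt n a)"
proof -
  have n: "real n > 0" using assms by auto
  let ?\<theta> = "pi * real m * gridpt n a" and ?\<delta> = "pi * real m / real n"
  have "cosine m (gridpt n (site_above n a)) = cos (?\<theta> + ?\<delta>)"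
  proof (cases "a < n")
    case True
    then have "pi * real m * gridpt n (site_above n a) = ?\<theta> + ?\<delta>"
      using n by (simp add: site_above_def gridpt_def field_simps)
    then show ?thesis by simp
  next
    case False
    \<comment> \<open>The missing site \<open>n + 1\<close> is the mirror image of \<open>n\<close>
      in the end point 1, and the cosine is symmetric about 1.\<close>
    then have "a = n" using assms by auto
    then have 1: "?\<theta> + ?\<delta> = 2 * pi * real m - ?\<theta>" and 2: "site_above n a = a"
      using n by (simp_all add: gridpt_def field_simps site_above_def)
    have "cos (2 * pi * real m - ?\<theta>) = cos ?\<theta>"
      using cos_int_2pin[of "int m"] sin_int_2pin[of "int m"]
      by (subst cos_diff) (simp add: mult.commute mult.left_commute)
    then show ?thesis unfolding 1 2 by simp
  qed
  moreover have "cosine m (gridpt n (site_below a)) = cos (?\<theta> - ?\<delta>)"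
  proof (cases "1 < a")
    case True
    then have "pi * real m * gridpt n (site_below a) = ?\<theta> - ?\<delta>"
      using n by (simp add: site_below_def gridpt_def field_simps of_nat_diff)
    then show ?thesis by simp
  next
    case False
    \<comment> \<open>In the same way the missing site 0 is the mirror image of 1 in the end point
      0.\<close>
    then have "a = 1" using assms by auto
    then have 1: "?\<theta> - ?\<delta> = - ?\<theta>" and 2: "site_below a = a"
      using n by (simp_all add: gridpt_def field_simps site_below_def)
    show ?thesis unfolding 1 2 by simp
  qed
  ultimately show ?thesis by (simp add: cos_add cos_diff)
qed

definition eigenvalue :: "nat \<Rightarrow> nat \<Rightarrow> nat \<Rightarrow> real" where
  "eigenvalue n m m' = 1 - 4 / (real n - 1)
     + (2 * cos (pi * real m / real n) + 2 * cos (pi * real m' / real n)) / (real n - 1)"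

text \<open>The eigenvalue equation holds at the sites \<open>{1..n}\<close> only, so the induction
  relies on a step from such sites never leaving them.\<close>

lemma funpow_pair_step_cosine:
  assumes "a \<in> {1..n}" "b \<in> {1..n}"
  shows "(pair_step n ^^ k) (\<lambda>a b. cosine m (gridpt n a) * cosine m' (gridpt n b)) a b
           = eigenvalue n m m' ^ k * (cosine m (gridpt n a) * cosine m' (gridpt n b))"
  using assms
proof (induction k arbitrary: a b)
  case (Suc k)
  let ?e = "\<lambda>a b. cosine m (gridpt n a) * cosine m' (gridpt n b)"
  have "(pair_step n ^^ Suc k) ?e a b = pair_step n (\<lambda>a b. eigenvalue n m m' ^ k * ?e a b) a b"
    using pair_step_cong[OF Suc.IH Suc.prems] by simp
  also have "\<dots> = eigenvalue n m m' ^ k * pair_step n ?e a b"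
    using funpow_pair_step_scale[where n = n and k = 1 and c = "eigenvalue n m m' ^ k" and g = ?e] by simp
  also have "pair_step n ?e a b = (1 - 4 / (real n - 1)) * ?e a b
      + ((cosine m (gridpt n (site_above n a)) + cosine m (gridpt n (site_below a))) * cosine m' (gridpt n b)
         + cosine m (gridpt n a) * (cosine m' (gridpt n (site_above n b)) + cosine m' (gridpt n (site_below b))))
        / (real n - 1)"
    by (simp only: pair_step_def distrib_left distrib_right add.assoc)
  also have "\<dots> = eigenvalue n m m' * ?e a b"
    unfolding cosine_gridpt_neighbours[OF Suc.prems(1)] cosine_gridpt_neighbours[OF Suc.prems(2)]
    by (simp add: eigenvalue_def algebra_simps add_divide_distrib)
  finally show ?case by simp
qed simp

section \<open>Scaling limit of the eigenvalues\<close>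

lemma floor_div_cube_tendsto:
  assumes "t > 0"
  shows "(\<lambda>n. real (nat \<lfloor>real n ^ 3 * t\<rfloor>) / real n ^ 3) \<longlonglongrightarrow> t"
proof (rule tendsto_sandwich)
  have b: "real n ^ 3 * t - 1 \<le> real (nat \<lfloor>real n ^ 3 * t\<rfloor>)" "real (nat \<lfloor>real n ^ 3 * t\<rfloor>) \<le> real n ^ 3 * t" for n
  proof -
    have "0 \<le> real n ^ 3 * t" using assms by simp
    then show "real n ^ 3 * t - 1 \<le> real (nat \<lfloor>real n ^ 3 * t\<rfloor>)" "real (nat \<lfloor>real n ^ 3 * t\<rfloor>) \<le> real n ^ 3 * t"
      by linarith+
  qed
  show "\<forall>\<^sub>F n in sequentially. (real n ^ 3 * t - 1) / real n ^ 3 \<le> real (nat \<lfloor>real n ^ 3 * t\<rfloor>) / real n ^ 3"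
    using b(1) by (intro always_eventually allI divide_right_mono) auto
  show "\<forall>\<^sub>F n in sequentially. real (nat \<lfloor>real n ^ 3 * t\<rfloor>) / real n ^ 3 \<le> real n ^ 3 * t / real n ^ 3"
    using b(2) by (intro always_eventually allI divide_right_mono) auto
  show "(\<lambda>n. (real n ^ 3 * t - 1) / real n ^ 3) \<longlonglongrightarrow> t" by real_asymp
  show "(\<lambda>n. real n ^ 3 * t / real n ^ 3) \<longlonglongrightarrow> t" by real_asymp
qed

text \<open>With \<open>\<alpha> = pi * m\<close> the expansion \<open>2 * cos (\<alpha> / n) - 2 =
  - \<alpha>\<^sup>2 / n\<^sup>2 + ...\<close>, divided by \<open>n - 1\<close>, shows that the
  eigenvalue differs from 1 by about
  \<open>- (\<alpha>\<^sup>2 + \<beta>\<^sup>2) / n ^ 3\<close>.\<close>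

lemma ln_eigenvalue_tendsto:
  "(\<lambda>n. real n ^ 3 * ln (eigenvalue n m m')) \<longlonglongrightarrow> - (pi\<^sup>2 * (real m ^ 2 + real m' ^ 2))"
proof -
  have *: "(\<lambda>n::nat. real n ^ 3 * ln (1 - 4 / (real n - 1) + (2 * cos (\<alpha> / real n) + 2 * cos (\<beta> / real n)) / (real n - 1)))
      \<longlonglongrightarrow> - (\<alpha>\<^sup>2 + \<beta>\<^sup>2)" if ab: "\<alpha> > 0 \<or> \<alpha> = 0" "\<beta> > 0 \<or> \<beta> = 0" for \<alpha> \<beta> :: real
  proof -
    \<comment> \<open>A vanishing frequency turns its cosine into a constant and changes the shape
      of the expansion.\<close>
    consider "\<alpha> > 0" "\<beta> > 0" | "\<alpha> > 0" "\<beta> = 0" | "\<alpha> = 0" "\<beta> > 0" | "\<alpha> = 0" "\<beta> = 0"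
      using ab by blast
    then show ?thesis
    proof cases
      case 1
      then show ?thesis by (real_asymp simp: power2_eq_square)
    next
      case 2
      then show ?thesis by simp (real_asymp simp: power2_eq_square)
    next
      case 3
      then show ?thesis by simp (real_asymp simp: power2_eq_square)
    next
      case 4
      then show ?thesis by simp
    qed
  qed
  have "pi * real m > 0 \<or> pi * real m = 0" "pi * real m' > 0 \<or> pi * real m' = 0" by auto
  from *[OF this] show ?thesis by (simp add: eigenvalue_def power_mult_distrib distrib_left)
qed

text \<open>The exponent is split into (steps / \<open>n ^ 3\<close>) times (\<open>n ^ 3\<close>
  times the logarithm); the logarithm makes sense for large \<open>n\<close> because the eigenvalue
  tends to 1.\<close>

lemma eigenvalue_power_tendsto:
  assumes "t > 0"
  shows "(\<lambda>n. eigenvalue n m m' ^ nat \<lfloor>real n ^ 3 * t\<rfloor>) \<longlonglongrightarrow> exp (- (pi\<^sup>2 * (real m ^ 2 + real m' ^ 2) * t))"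
proof -
  have "(\<lambda>n. eigenvalue n m m') \<longlonglongrightarrow> 1"
    unfolding eigenvalue_def by real_asymp
  then have pos: "\<forall>\<^sub>F n in sequentially. eigenvalue n m m' > 0"
    by (rule order_tendstoD) simp
  have "(\<lambda>n. exp ((real (nat \<lfloor>real n ^ 3 * t\<rfloor>) / real n ^ 3) * (real n ^ 3 * ln (eigenvalue n m m'))))
      \<longlonglongrightarrow> exp (t * - (pi\<^sup>2 * (real m ^ 2 + real m' ^ 2)))"
    by (intro tendsto_exp tendsto_mult floor_div_cube_tendsto ln_eigenvalue_tendsto assms)
  moreover have "\<forall>\<^sub>F n in sequentially.
      exp ((real (nat \<lfloor>real n ^ 3 * t\<rfloor>) / real n ^ 3) * (real n ^ 3 * ln (eigenvalue n m m')))
        = eigenvalue n m m' ^ nat \<lfloor>real n ^ 3 * t\<rfloor>"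
    using pos eventually_gt_at_top[of 0]
  proof eventually_elim
    case (elim n)
    then show ?case by (simp add: exp_of_nat_mult)
  qed
  ultimately show ?thesis by (simp add: mult.commute tendsto_cong)
qed

section \<open>Riemann sums over the triangle\<close>

lemma abs_cos_diff_le: "\<bar>cos x - cos y\<bar> \<le> \<bar>x - y\<bar>" for x y :: real
proof -
  have "\<bar>cos x - cos y\<bar> = 2 * (\<bar>sin ((x + y) / 2)\<bar> * \<bar>sin ((y - x) / 2)\<bar>)"
    by (simp add: cos_diff_cos abs_mult)
  also have "\<dots> \<le> 2 * (1 * \<bar>(y - x) / 2\<bar>)"
    by (intro mult_left_mono mult_mono abs_sin_x_le_abs_x) auto
  finally show ?thesis by (simp add: abs_minus_commute)
qed

lemma abs_cosine_diff_le: "\<bar>cosine m x - cosine m y\<bar> \<le> pi * real m * \<bar>x - y\<bar>"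
proof -
  have "\<bar>pi * real m * x - pi * real m * y\<bar> = pi * real m * \<bar>x - y\<bar>"
    by (simp add: right_diff_distrib[symmetric] abs_mult)
  then show ?thesis using abs_cos_diff_le[of "pi * real m * x" "pi * real m * y"] by simp
qed

text \<open>The mean value theorem represents the increment of \<open>F\<close> over a cell by a
  value of \<open>f\<close> in the same cell, at distance at most \<open>1 / n\<close> from the
  midpoint. Partial sums are covered because the inner sum over the triangle stops early.\<close>

lemma midpoint_sum_error:
  fixes f F :: "real \<Rightarrow> real"
  assumes F: "\<And>x. x \<in> {0..1} \<Longrightarrow> (F has_real_derivative f x) (at x within {0..1})"
    and lip: "\<And>x y. x \<in> {0..1} \<Longrightarrow> y \<in> {0..1} \<Longrightarrow> \<bar>f x - f y\<bar> \<le> K * \<bar>x - y\<bar>"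
    and "K \<ge> 0" "0 < n" "a \<le> n"
  shows "\<bar>(\<Sum>j\<in>{1..a}. f (gridpt n j)) / real n - (F (real a / real n) - F 0)\<bar> \<le> K / real n * (real a / real n)"
  using \<open>a \<le> n\<close>
proof (induction a)
  case (Suc a)
  have n: "real n > 0" using \<open>0 < n\<close> by simp
  let ?x = "real a / real n" and ?y = "real (Suc a) / real n"
  have xy: "?x < ?y" "?y - ?x = 1 / real n" "{?x..?y} \<subseteq> {0..1}"
    using n Suc.prems by (auto simp: field_simps intro: order_trans)
  have "\<exists>z\<in>{?x<..<?y}. F ?y - F ?x = f z * (?y - ?x)"
  proof (rule mvt_simple[OF xy(1)])
    fix z assume "?x \<le> z" "z \<le> ?y"
    then have "z \<in> {?x..?y}" by simp
    then have "(F has_real_derivative f z) (at z within {?x..?y})"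
      using F xy(3) by (meson DERIV_subset subsetD)
    then show "(F has_derivative (\<lambda>h. f z * h)) (at z within {?x..?y})"
      by (simp add: has_field_derivative_def)
  qed
  then obtain z where z: "?x < z" "z < ?y" "F ?y - F ?x = f z / real n"
    using xy(2) by auto
  have g: "gridpt n (Suc a) \<in> {?x..?y}" using n by (auto simp: gridpt_def field_simps)
  have "\<bar>f (gridpt n (Suc a)) - f z\<bar> \<le> K * \<bar>gridpt n (Suc a) - z\<bar>"
  proof (rule lip)
    show "gridpt n (Suc a) \<in> {0..1}" using g xy(3) by blast
    have "z \<in> {?x..?y}" using z by simp
    then show "z \<in> {0..1}" using xy(3) by blast
  qed
  also have "\<dots> \<le> K * (1 / real n)"
    using g z xy(2) \<open>K \<ge> 0\<close> by (intro mult_left_mono) auto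
  finally have "\<bar>f (gridpt n (Suc a)) - f z\<bar> / real n \<le> K * (1 / real n) / real n"
    using n by (intro divide_right_mono) auto
  then have "\<bar>f (gridpt n (Suc a)) / real n - (F ?y - F ?x)\<bar> \<le> K / real n * (1 / real n)"
    unfolding z(3) using n by (simp add: diff_divide_distrib[symmetric])
  moreover have "K / real n * (real (Suc a) / real n) = K / real n * (real a / real n) + K / real n * (1 / real n)"
    by (simp add: add_divide_distrib distrib_left)
  moreover have "\<bar>(\<Sum>j\<in>{1..a}. f (gridpt n j)) / real n - (F ?x - F 0)\<bar> \<le> K / real n * (real a / real n)"
    using Suc by simp
  ultimately show ?case by (simp add: add_divide_distrib)
qed simp

definition cosine_primitive :: "nat \<Rightarrow> real \<Rightarrow> real" where
  "cosine_primitive m x = (if m = 0 then x else sin (pi * real m * x) / (pi * real m))"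

lemma cosine_primitive_deriv: "(cosine_primitive m has_real_derivative cosine m x) (at x within A)"
  unfolding cosine_primitive_def
  by (cases "m = 0") (auto intro!: derivative_eq_intros)

lemma abs_cosine_primitive_diff_le: "\<bar>cosine_primitive m x - cosine_primitive m y\<bar> \<le> \<bar>x - y\<bar>"
proof (cases "m = 0")
  case False
  have "\<bar>sin (pi * real m * x) - sin (pi * real m * y)\<bar> \<le> pi * real m * \<bar>x - y\<bar>"
  proof -
    have "\<bar>sin (pi * real m * x) - sin (pi * real m * y)\<bar> = \<bar>cos (pi / 2 - pi * real m * x) - cos (pi / 2 - pi * real m * y)\<bar>"
      by (simp add: cos_diff)
    also have "\<dots> \<le> \<bar>(pi / 2 - pi * real m * x) - (pi / 2 - pi * real m * y)\<bar>"
      by (rule abs_cos_diff_le)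
    also have "\<dots> = \<bar>pi * real m * (y - x)\<bar>" by (simp add: algebra_simps)
    finally show ?thesis by (simp add: abs_mult abs_minus_commute)
  qed
  then show ?thesis using False
    by (simp add: cosine_primitive_def diff_divide_distrib[symmetric] abs_mult field_simps)
qed (simp add: cosine_primitive_def)

lemma cosine_primitive_0 [simp]: "cosine_primitive m 0 = 0"
  by (simp add: cosine_primitive_def)

text \<open>The integral of \<open>cosine m u * cosine m' v\<close> over
  \<open>0 \<le> u \<le> v \<le> 1\<close>, with the integration in \<open>u\<close> already carried
  out.\<close>

definition cosine_triangle :: "nat \<Rightarrow> nat \<Rightarrow> real" where
  "cosine_triangle m m' = integral {0..1} (\<lambda>v. cosine m' v * cosine_primitive m v)"

lemma continuous_cosine_primitive: "continuous_on A (cosine_primitive m)"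
  by (rule DERIV_continuous_on) (rule cosine_primitive_deriv)

text \<open>Exchanging the sums puts the smaller index inside, where its Riemann sum becomes a
  primitive vanishing at 0. The error constants are \<open>K0\<close> for the inner sum, 1 for
  shifting its end point to the midpoint, and \<open>K\<close> for the outer sum.\<close>

lemma pair_sum_cosine_tendsto:
  "(\<lambda>n. pair_sum n (\<lambda>a b. cosine m (gridpt n a) * cosine m' (gridpt n b)) id / real n ^ 2)
     \<longlonglongrightarrow> cosine_triangle m m'"
proof -
  define f where "f = (\<lambda>v. cosine m' v * cosine_primitive m v)"
  \<comment> \<open>Lipschitz constant of a product: \<open>pi * m'\<close> for the cosine times the
    bound 1 of the primitive on the unit interval, plus 1 for the primitive.\<close>
  define K where "K = pi * real m' + 1"
  define K0 where "K0 = pi * real m"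
  have K: "K \<ge> 0" "K0 \<ge> 0" by (simp_all add: K_def K0_def)
  have lip: "\<bar>f x - f y\<bar> \<le> K * \<bar>x - y\<bar>" if "x \<in> {0..1}" "y \<in> {0..1}" for x y
  proof -
    have "f x - f y = (cosine m' x - cosine m' y) * cosine_primitive m x
        + cosine m' y * (cosine_primitive m x - cosine_primitive m y)"
      by (simp add: f_def algebra_simps)
    also have "\<bar>\<dots>\<bar> \<le> \<bar>cosine m' x - cosine m' y\<bar> * \<bar>cosine_primitive m x\<bar>
        + \<bar>cosine m' y\<bar> * \<bar>cosine_primitive m x - cosine_primitive m y\<bar>"
      unfolding abs_mult[symmetric] by (rule abs_triangle_ineq)
    also have "\<dots> \<le> (pi * real m' * \<bar>x - y\<bar>) * 1 + 1 * \<bar>x - y\<bar>"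
      using that abs_cosine_primitive_diff_le[of m x 0]
      by (intro add_mono mult_mono abs_cosine_diff_le abs_cosine_primitive_diff_le) auto
    finally show ?thesis by (simp add: K_def algebra_simps)
  qed
  have cont: "continuous_on {0..1} f"
    unfolding f_def by (intro continuous_intros continuous_cosine_primitive)
  define G where "G = (\<lambda>x. integral {0..x} f)"
  have G: "(G has_real_derivative f x) (at x within {0..1})" if "x \<in> {0..1}" for x
    unfolding G_def by (rule integral_has_real_derivative[OF cont that])
  have G01: "G 1 - G 0 = cosine_triangle m m'"
    by (simp add: G_def cosine_triangle_def f_def)
  have bound: "\<bar>pair_sum n (\<lambda>a b. cosine m (gridpt n a) * cosine m' (gridpt n b)) id / real n ^ 2 - cosine_triangle m m'\<bar>
      \<le> (K0 + 1 + K) / real n" if n: "n > 0" for n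
  proof -
    have n': "real n > 0" using n by simp
    have "pair_sum n (\<lambda>a b. cosine m (gridpt n a) * cosine m' (gridpt n b)) id
        = (\<Sum>p\<in>{1..n}. \<Sum>q\<in>{1..n}. if p < q then cosine m (gridpt n p) * cosine m' (gridpt n q) else 0)"
      unfolding pair_sum_def id_apply
      by (intro sum.cong refl sum.mono_neutral_cong_left) auto
    also have "\<dots> = (\<Sum>q\<in>{1..n}. \<Sum>p\<in>{1..n}. if p < q then cosine m (gridpt n p) * cosine m' (gridpt n q) else 0)"
      by (rule sum.swap)
    also have "\<dots> = (\<Sum>q\<in>{1..n}. cosine m' (gridpt n q) * (\<Sum>p\<in>{1..q - 1}. cosine m (gridpt n p)))"
    proof (intro sum.cong refl)
      fix q assume q: "q \<in> {1..n}"
      have "(\<Sum>p\<in>{1..n}. if p < q then cosine m (gridpt n p) * cosine m' (gridpt n q) else 0)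
          = (\<Sum>p\<in>{1..q - 1}. cosine m (gridpt n p) * cosine m' (gridpt n q))"
        using q by (intro sum.mono_neutral_cong_right) auto
      then show "(\<Sum>p\<in>{1..n}. if p < q then cosine m (gridpt n p) * cosine m' (gridpt n q) else 0)
          = cosine m' (gridpt n q) * (\<Sum>p\<in>{1..q - 1}. cosine m (gridpt n p))"
        by (simp add: sum_distrib_left mult.commute)
    qed
    finally have eq: "pair_sum n (\<lambda>a b. cosine m (gridpt n a) * cosine m' (gridpt n b)) id / real n ^ 2
        = (\<Sum>q\<in>{1..n}. cosine m' (gridpt n q) * ((\<Sum>p\<in>{1..q - 1}. cosine m (gridpt n p)) / real n)) / real n"
      by (simp add: power2_eq_square sum_divide_distrib[symmetric])
    have inner: "\<bar>(\<Sum>p\<in>{1..q - 1}. cosine m (gridpt n p)) / real n - cosine_primitive m (gridpt n q)\<bar> \<le> (K0 + 1) / real n"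
      if q: "q \<in> {1..n}" for q
    proof -
      have "\<bar>(\<Sum>p\<in>{1..q - 1}. cosine m (gridpt n p)) / real n
          - (cosine_primitive m (real (q - 1) / real n) - cosine_primitive m 0)\<bar> \<le> K0 / real n * (real (q - 1) / real n)"
        using q n K(2)
        by (intro midpoint_sum_error cosine_primitive_deriv) (auto simp: K0_def intro: abs_cosine_diff_le)
      also have "\<dots> \<le> K0 / real n * 1"
        using q n K(2) by (intro mult_left_mono) (auto simp: field_simps)
      finally have "\<bar>(\<Sum>p\<in>{1..q - 1}. cosine m (gridpt n p)) / real n
          - cosine_primitive m (real (q - 1) / real n)\<bar> \<le> K0 / real n" by simp
      moreover have "\<bar>cosine_primitive m (real (q - 1) / real n) - cosine_primitive m (gridpt n q)\<bar> \<le> 1 / real n"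
        using q n' by (intro order_trans[OF abs_cosine_primitive_diff_le])
          (auto simp: gridpt_def diff_divide_distrib[symmetric] of_nat_diff intro!: frac_le)
      ultimately show ?thesis by (simp add: add_divide_distrib) 
    qed
    have "\<bar>(\<Sum>q\<in>{1..n}. cosine m' (gridpt n q) * ((\<Sum>p\<in>{1..q - 1}. cosine m (gridpt n p)) / real n))
        - (\<Sum>q\<in>{1..n}. f (gridpt n q))\<bar> \<le> (\<Sum>q\<in>{1..n}. 1 * ((K0 + 1) / real n))"
      unfolding sum_subtractf[symmetric] f_def right_diff_distrib[symmetric]
    proof (intro order_trans[OF sum_abs] sum_mono)
      fix q assume q: "q \<in> {1..n}"
      show "\<bar>cosine m' (gridpt n q) * ((\<Sum>p\<in>{1..q - 1}. cosine m (gridpt n p)) / real n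
          - cosine_primitive m (gridpt n q))\<bar> \<le> 1 * ((K0 + 1) / real n)"
        unfolding abs_mult using inner[OF q] by (intro mult_mono) auto
    qed
    also have "\<dots> = K0 + 1" using n' by simp
    finally have "\<bar>(\<Sum>q\<in>{1..n}. cosine m' (gridpt n q) * ((\<Sum>p\<in>{1..q - 1}. cosine m (gridpt n p)) / real n))
        - (\<Sum>q\<in>{1..n}. f (gridpt n q))\<bar> / real n \<le> (K0 + 1) / real n"
      using n' by (intro divide_right_mono) auto
    then have "\<bar>(\<Sum>q\<in>{1..n}. cosine m' (gridpt n q) * ((\<Sum>p\<in>{1..q - 1}. cosine m (gridpt n p)) / real n)) / real n
        - (\<Sum>q\<in>{1..n}. f (gridpt n q)) / real n\<bar> \<le> (K0 + 1) / real n"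
      by (simp add: diff_divide_distrib[symmetric])
    moreover have "\<bar>(\<Sum>q\<in>{1..n}. f (gridpt n q)) / real n - cosine_triangle m m'\<bar> \<le> K / real n"
      using midpoint_sum_error[of G f K n n, OF G lip K(1) n] G01 n by simp
    ultimately show ?thesis unfolding eq by (simp add: add_divide_distrib)
  qed
  show ?thesis
  proof (rule LIM_zero_cancel, rule Lim_null_comparison)
    show "(\<lambda>n. (K0 + 1 + K) / real n) \<longlonglongrightarrow> 0" by real_asymp
    show "\<forall>\<^sub>F n in sequentially. norm (pair_sum n (\<lambda>a b. cosine m (gridpt n a) * cosine m' (gridpt n b)) id / real n ^ 2
        - cosine_triangle m m') \<le> (K0 + 1 + K) / real n"
      unfolding real_norm_def using eventually_gt_at_top[of 0] by eventually_elim (rule bound)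
  qed
qed

section \<open>Approximation of the sign by cosine polynomials\<close>

text \<open>The linear span of the joint eigenfunctions, as an inductive predicate so that limits
  extend from eigenfunctions by induction.\<close>

inductive trig_poly :: "(real \<times> real \<Rightarrow> real) \<Rightarrow> bool" where
  basis: "trig_poly (\<lambda>z. cosine m (fst z) * cosine m' (snd z))"
| scale: "trig_poly q \<Longrightarrow> trig_poly (\<lambda>z. c * q z)"
| add: "trig_poly q \<Longrightarrow> trig_poly r \<Longrightarrow> trig_poly (\<lambda>z. q z + r z)"

lemma trig_poly_continuous: "trig_poly q \<Longrightarrow> continuous_on A q"
  by (induction rule: trig_poly.induct) (auto intro!: continuous_intros)

lemma trig_poly_bounded: "trig_poly q \<Longrightarrow> \<exists>B. \<forall>z. \<bar>q z\<bar> \<le> B"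
proof (induction rule: trig_poly.induct)
  case (basis m m')
  have "\<bar>cosine m x * cosine m' y\<bar> \<le> 1 * 1" for x y
    unfolding abs_mult by (intro mult_mono) auto
  then show ?case by (intro exI[of _ 1]) simp
next
  case (scale q c)
  then obtain B where "\<And>z. \<bar>q z\<bar> \<le> B" by blast
  then have "\<bar>c * q z\<bar> \<le> \<bar>c\<bar> * B" for z unfolding abs_mult by (intro mult_left_mono) auto
  then show ?case by blast
next
  case (add q r)
  then obtain B C where "\<And>z. \<bar>q z\<bar> \<le> B" "\<And>z. \<bar>r z\<bar> \<le> C" by blast
  then have "\<bar>q z + r z\<bar> \<le> B + C" for z by (intro order_trans[OF abs_triangle_ineq] add_mono)
  then show ?case by blast
qed

lemma trig_poly_const: "trig_poly (\<lambda>_. c)"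
  using trig_poly.scale[OF trig_poly.basis[of 0 0], of c] by simp

text \<open>In natural numbers \<open>(m - k) + (k - m)\<close> is the absolute difference; the
  cosine being even, it serves as the difference frequency.\<close>

lemma cosine_mult: "cosine m x * cosine k x = (cosine (m + k) x + cosine ((m - k) + (k - m)) x) / 2"
proof -
  have "cosine ((m - k) + (k - m)) x = cos (pi * real m * x - pi * real k * x)"
  proof (cases "k \<le> m")
    case True
    then show ?thesis by (simp add: of_nat_diff algebra_simps)
  next
    case False
    then have "pi * real ((m - k) + (k - m)) * x = - (pi * real m * x - pi * real k * x)"
      by (simp add: of_nat_diff algebra_simps)
    then show ?thesis by (simp only: cos_minus)
  qed
  moreover have "cosine (m + k) x = cos (pi * real m * x + pi * real k * x)"
    by (simp add: algebra_simps)
  ultimately show ?thesis by (simp add: cos_add cos_diff)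
qed

lemma trig_poly_mult:
  assumes "trig_poly q" "trig_poly r"
  shows "trig_poly (\<lambda>z. q z * r z)"
  using assms(1)
proof (induction rule: trig_poly.induct)
  case (basis m m')
  show ?case using assms(2)
  proof (induction rule: trig_poly.induct)
    case (basis k k')
    have expand: "(a + b) / 2 * ((c + d) / 2) = (1 / 4) * ((a * c + a * d) + (b * c + b * d))" for a b c d :: real
      by (simp add: field_simps)
    let ?d = "(m - k) + (k - m)" and ?d' = "(m' - k') + (k' - m')"
    have "(\<lambda>z. cosine m (fst z) * cosine m' (snd z) * (cosine k (fst z) * cosine k' (snd z)))
        = (\<lambda>z. (1/4) * ((cosine (m + k) (fst z) * cosine (m' + k') (snd z)
             + cosine (m + k) (fst z) * cosine ?d' (snd z))
             + (cosine ?d (fst z) * cosine (m' + k') (snd z) + cosine ?d (fst z) * cosine ?d' (snd z))))"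
    proof
      fix z :: "real \<times> real"
      have "cosine m (fst z) * cosine m' (snd z) * (cosine k (fst z) * cosine k' (snd z))
          = (cosine m (fst z) * cosine k (fst z)) * (cosine m' (snd z) * cosine k' (snd z))"
        by (simp only: mult.assoc mult.left_commute)
      also have "\<dots> = (1/4) * ((cosine (m + k) (fst z) * cosine (m' + k') (snd z)
             + cosine (m + k) (fst z) * cosine ?d' (snd z))
             + (cosine ?d (fst z) * cosine (m' + k') (snd z) + cosine ?d (fst z) * cosine ?d' (snd z)))"
        unfolding cosine_mult by (rule expand)
      finally show "cosine m (fst z) * cosine m' (snd z) * (cosine k (fst z) * cosine k' (snd z)) = \<dots>" .
    qed
    then show ?case by (simp only:) (intro trig_poly.intros)
  next
    case (scale r c)
    then show ?case using trig_poly.scale[OF scale.IH, of c] by (simp add: mult.left_commute)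
  next
    case (add r r')
    then show ?case using trig_poly.add[OF add.IH] by (simp add: distrib_left)
  qed
next
  case (scale q c)
  then show ?case using trig_poly.scale[OF scale.IH, of c] by (simp add: mult.assoc)
next
  case (add q q')
  then show ?case using trig_poly.add[OF add.IH] by (simp add: distrib_right)
qed

text \<open>Stone-Weierstrass: the span is closed under products, contains the constants, and
  separates points because \<open>u \<mapsto> cos (pi * u)\<close> is injective on the unit
  interval.\<close>

lemma trig_poly_dense:
  fixes f :: "real \<times> real \<Rightarrow> real"
  assumes "continuous_on ({0..1} \<times> {0..1}) f" "e > 0"
  shows "\<exists>q. trig_poly q \<and> (\<forall>z\<in>{0..1} \<times> {0..1}. \<bar>f z - q z\<bar> < e)"
proof -
  interpret function_ring_on "{q. trig_poly q}" "{0..1} \<times> {0..1} :: (real \<times> real) set"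
  proof
    show "compact ({0..1} \<times> {0..1} :: (real \<times> real) set)" by (intro compact_Times compact_Icc)
    fix x y :: "real \<times> real"
    assume xy: "x \<in> {0..1} \<times> {0..1}" "y \<in> {0..1} \<times> {0..1}" "x \<noteq> y"
    have inj: "u = v" if "cos (pi * u) = cos (pi * v)" "u \<in> {0..1}" "v \<in> {0..1}" for u v :: real
    proof -
      have "pi * u = pi * v"
        by (rule cos_inj_pi[OF _ _ _ _ that(1)]) (use that(2,3) in \<open>simp_all add: mult_left_le\<close>)
      then show ?thesis by simp
    qed
    show "\<exists>q\<in>{q. trig_poly q}. q x \<noteq> q y"
    proof (cases "fst x = fst y")
      case True
      then have "snd x \<noteq> snd y" using xy(3) by (simp add: prod_eq_iff)
      then have "cos (pi * snd x) \<noteq> cos (pi * snd y)" using inj xy by (auto simp: mem_Times_iff)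
      then show ?thesis using trig_poly.basis[of 0 1] by (intro bexI[of _ "\<lambda>z. cosine 0 (fst z) * cosine 1 (snd z)"]) auto
    next
      case False
      then have "cos (pi * fst x) \<noteq> cos (pi * fst y)" using inj xy by (auto simp: mem_Times_iff)
      then show ?thesis using trig_poly.basis[of 1 0] by (intro bexI[of _ "\<lambda>z. cosine 1 (fst z) * cosine 0 (snd z)"]) auto
    qed
  qed (auto intro: trig_poly_continuous trig_poly_const trig_poly_mult trig_poly.add)
  from Stone_Weierstrass_basic[OF assms] show ?thesis by auto
qed

section \<open>Limit of the mean by approximation of the sign\<close>

lemma pair_sum_id_cong:
  "(\<And>a b. a \<in> {1..n} \<Longrightarrow> b \<in> {1..n} \<Longrightarrow> g a b = h a b) \<Longrightarrow> pair_sum n g id = pair_sum n h id"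
  unfolding pair_sum_def id_apply by (intro sum.cong refl) auto

lemma pair_sum_scale: "pair_sum n (\<lambda>a b. c * g a b) \<sigma> = c * pair_sum n g \<sigma>"
  by (simp add: pair_sum_def sum_distrib_left)

lemma pair_sum_add: "pair_sum n (\<lambda>a b. g a b + h a b) \<sigma> = pair_sum n g \<sigma> + pair_sum n h \<sigma>"
  by (simp add: pair_sum_def sum.distrib)

lemma pair_sum_diff: "pair_sum n (\<lambda>a b. g a b - h a b) \<sigma> = pair_sum n g \<sigma> - pair_sum n h \<sigma>"
  by (simp add: pair_sum_def sum_subtractf)

lemma card_nat_near: 
  assumes "r > 0"
  shows "real (card {b\<in>{1..n}. \<bar>real a - real b\<bar> < r}) \<le> 2 * r + 1"
proof -
  have "card {b\<in>{1..n}. \<bar>real a - real b\<bar> < r} = card (int ` {b\<in>{1..n}. \<bar>real a - real b\<bar> < r})"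
    by (simp add: card_image)
  also have "\<dots> \<le> card {\<lceil>real a - r\<rceil>..\<lfloor>real a + r\<rfloor>}"
  proof (intro card_mono image_subsetI)
    fix b assume "b \<in> {b\<in>{1..n}. \<bar>real a - real b\<bar> < r}"
    then have "real a - r \<le> of_int (int b)" "of_int (int b) \<le> real a + r" by auto
    then show "int b \<in> {\<lceil>real a - r\<rceil>..\<lfloor>real a + r\<rfloor>}"
      unfolding atLeastAtMost_iff ceiling_le_iff le_floor_iff by blast
  qed simp
  also have "real \<dots> \<le> 2 * r + 1"
    using assms by simp linarith
  finally show ?thesis by simp
qed

text \<open>A continuous ramp of slope \<open>K\<close> in place of the sign; the two differ only
  within distance \<open>1 / K\<close> of the diagonal, and there by at most 1.\<close>

definition clamped_diff :: "real \<Rightarrow> real \<times> real \<Rightarrow> real" where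
  "clamped_diff K z = max (-1) (min 1 (K * (fst z - snd z)))"

lemma continuous_clamped_diff: "continuous_on A (clamped_diff K)"
  unfolding clamped_diff_def by (intro continuous_intros)

lemma sgn_clamped_diff:
  assumes "K > 0"
  shows "\<bar>sgn (fst z - snd z) - clamped_diff K z\<bar> \<le> (if \<bar>fst z - snd z\<bar> < 1 / K then 1 else 0)"
proof -
  have bound: "\<bar>sgn y - max (-1) (min 1 y)\<bar> \<le> (if \<bar>y\<bar> < 1 then 1 else 0)" for y :: real
    by (auto simp: sgn_if min_def max_def abs_if)
  have sgn: "sgn (K * (fst z - snd z)) = sgn (fst z - snd z)"
    using assms by (simp add: sgn_mult)
  have less: "\<bar>K * (fst z - snd z)\<bar> < 1 \<longleftrightarrow> \<bar>fst z - snd z\<bar> < 1 / K"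
    using assms unfolding abs_mult by (simp add: field_simps)
  show ?thesis
    using bound[of "K * (fst z - snd z)"] unfolding sgn less clamped_diff_def .
qed

text \<open>\<open>\<rho>\<close> stands for the law of the pair of reflecting motions at time
  \<open>t\<close>. Its cosine moments carry all the information required, and their factor 2 is the
  density of the uniform law on the triangle.\<close>

context
  fixes \<rho> :: "(real \<times> real) measure" and t :: real
  assumes prob: "prob_space \<rho>" and sets_\<rho> [measurable_cong]: "sets \<rho> = sets borel"
    and t: "t > 0"
    and cosines: "\<And>m m'. (\<integral>z. cosine m (fst z) * cosine m' (snd z) \<partial>\<rho>)
       = 2 * exp (- (pi\<^sup>2 * (real m ^ 2 + real m' ^ 2) * t)) * cosine_triangle m m'"
begin

interpretation prob_space \<rho> by (rule prob)

lemma integrable_trig_poly: "trig_poly q \<Longrightarrow> integrable \<rho> q"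
proof -
  assume q: "trig_poly q"
  then obtain B where "\<And>z. \<bar>q z\<bar> \<le> B" using trig_poly_bounded by blast
  moreover have "q \<in> borel_measurable \<rho>"
    using borel_measurable_continuous_onI[OF trig_poly_continuous[OF q]] sets_\<rho> by (simp cong: measurable_cong_sets)
  ultimately show ?thesis by (intro integrable_const_bound[where B = B]) auto
qed

text \<open>On a product of cosines the evolution is multiplication by a power of the eigenvalue;
  the rest is linearity. The division by 2 undoes the density 2 of the starting law.\<close>

lemma pair_sum_trig_poly_tendsto:
  assumes "trig_poly q"
  shows "(\<lambda>n. pair_sum n ((pair_step n ^^ nat \<lfloor>real n ^ 3 * t\<rfloor>) (\<lambda>a b. q (gridpt n a, gridpt n b))) id / real n ^ 2)
     \<longlonglongrightarrow> (\<integral>z. q z \<partial>\<rho>) / 2"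
  using assms
proof (induction rule: trig_poly.induct)
  case (basis m m')
  let ?e = "\<lambda>n a b. cosine m (gridpt n a) * cosine m' (gridpt n b)"
  have "(\<lambda>n. eigenvalue n m m' ^ nat \<lfloor>real n ^ 3 * t\<rfloor> * (pair_sum n (?e n) id / real n ^ 2))
     \<longlonglongrightarrow> exp (- (pi\<^sup>2 * (real m ^ 2 + real m' ^ 2) * t)) * cosine_triangle m m'"
    by (intro tendsto_mult eigenvalue_power_tendsto pair_sum_cosine_tendsto t)
  moreover have eq: "pair_sum n ((pair_step n ^^ k) (?e n)) id / real n ^ 2
      = eigenvalue n m m' ^ k * (pair_sum n (?e n) id / real n ^ 2)" for n k
  proof -
    have "pair_sum n ((pair_step n ^^ k) (?e n)) id = pair_sum n (\<lambda>a b. eigenvalue n m m' ^ k * ?e n a b) id"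
      by (intro pair_sum_id_cong funpow_pair_step_cosine)
    then show ?thesis by (simp only: pair_sum_scale times_divide_eq_right)
  qed
  moreover have int: "(\<integral>z. cosine m (fst z) * cosine m' (snd z) \<partial>\<rho>) / 2
      = exp (- (pi\<^sup>2 * (real m ^ 2 + real m' ^ 2) * t)) * cosine_triangle m m'"
    unfolding cosines by simp
  ultimately show ?case unfolding int fst_conv snd_conv eq by blast
next
  case (scale q c)
  have "(\<lambda>n. c * (pair_sum n ((pair_step n ^^ nat \<lfloor>real n ^ 3 * t\<rfloor>) (\<lambda>a b. q (gridpt n a, gridpt n b))) id / real n ^ 2))
     \<longlonglongrightarrow> c * ((\<integral>z. q z \<partial>\<rho>) / 2)"
    by (intro tendsto_mult tendsto_const scale.IH)
  then show ?case
    by (simp only: funpow_pair_step_scale pair_sum_scale times_divide_eq_right integral_mult_right_zero)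
next
  case (add q r)
  then have "(\<integral>z. q z + r z \<partial>\<rho>) = (\<integral>z. q z \<partial>\<rho>) + (\<integral>z. r z \<partial>\<rho>)"
    by (intro Bochner_Integration.integral_add integrable_trig_poly)
  with tendsto_add[OF add.IH] show ?case
    by (simp only: funpow_pair_step_add pair_sum_add add_divide_distrib)
qed

text \<open>The approximation error is estimated before the evolution, as the L1 contraction carries
  it through any number of steps without loss.\<close>

lemma pair_sum_sign_tendsto:
  assumes supp: "AE z in \<rho>. z \<in> {0..1} \<times> {0..1}" and ties: "AE z in \<rho>. fst z \<noteq> snd z"
  shows "(\<lambda>n. pair_sum n ((pair_step n ^^ nat \<lfloor>real n ^ 3 * t\<rfloor>) sign_kernel) id / real n ^ 2)
     \<longlonglongrightarrow> (\<integral>z. sgn (fst z - snd z) \<partial>\<rho>) / 2"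
proof (rule LIMSEQ_I)
  fix e :: real assume "e > 0"
  \<comment> \<open>The final estimate collects \<open>3 * \<epsilon>\<close> on the grid,
    \<open>\<epsilon>\<close> for the polynomial and \<open>\<epsilon>\<close> in the limit, which
    stays below \<open>8 * \<epsilon>\<close>.\<close>
  define \<epsilon> where "\<epsilon> = e / 8"
  have \<epsilon>: "\<epsilon> > 0" using \<open>e > 0\<close> by (simp add: \<epsilon>_def)
  define S :: "real \<times> real \<Rightarrow> real" where "S = (\<lambda>z. sgn (fst z - snd z))"
  have [measurable]: "S \<in> borel_measurable borel" "clamped_diff K \<in> borel_measurable borel" for K
    unfolding S_def using borel_measurable_continuous_onI[OF continuous_clamped_diff] by (auto simp: borel_prod[symmetric])
  have mS [measurable]: "S \<in> borel_measurable \<rho>" and mC [measurable]: "clamped_diff K \<in> borel_measurable \<rho>" for K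
    using sets_\<rho> by (auto cong: measurable_cong_sets)
  \<comment> \<open>Off the diagonal the ramp equals the sign once \<open>1 / Suc j\<close> is below
    the distance of the coordinates, and the diagonal is a null set of
    \<open>\<rho>\<close>.\<close>
  have "(\<lambda>j. \<integral>z. \<bar>S z - clamped_diff (real (Suc j)) z\<bar> \<partial>\<rho>) \<longlonglongrightarrow> (\<integral>z. 0 \<partial>\<rho>)"
  proof (rule integral_dominated_convergence[where w = "\<lambda>_. 1"])
    show "AE z in \<rho>. (\<lambda>j. \<bar>S z - clamped_diff (real (Suc j)) z\<bar>) \<longlonglongrightarrow> 0"
      using ties
    proof eventually_elim
      fix z :: "real \<times> real" assume z: "fst z \<noteq> snd z"
      have "(\<lambda>j. 1 / real (Suc j)) \<longlonglongrightarrow> 0" by real_asymp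
      then have "\<forall>\<^sub>F j in sequentially. 1 / real (Suc j) < \<bar>fst z - snd z\<bar>"
        by (rule order_tendstoD) (use z in simp)
      then have "\<forall>\<^sub>F j in sequentially. \<bar>S z - clamped_diff (real (Suc j)) z\<bar> = 0"
      proof eventually_elim
        case (elim j)
        then show ?case using sgn_clamped_diff[of "real (Suc j)" z] unfolding S_def by auto
      qed
      then show "(\<lambda>j. \<bar>S z - clamped_diff (real (Suc j)) z\<bar>) \<longlonglongrightarrow> 0"
        by (rule tendsto_eventually)
    qed
    show "AE z in \<rho>. norm \<bar>S z - clamped_diff (real (Suc j)) z\<bar> \<le> 1" for j
    proof (intro always_eventually allI)
      fix z :: "real \<times> real"
      show "norm \<bar>S z - clamped_diff (real (Suc j)) z\<bar> \<le> 1"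
        using sgn_clamped_diff[of "real (Suc j)" z] by (simp add: S_def split: if_splits)
    qed
  qed auto
  then have "\<forall>\<^sub>F j in sequentially. (\<integral>z. \<bar>S z - clamped_diff (real (Suc j)) z\<bar> \<partial>\<rho>) < \<epsilon>"
    by (intro order_tendstoD(2)) (use \<epsilon> in auto)
  moreover have "\<forall>\<^sub>F j in sequentially. 2 / real (Suc j) < \<epsilon>"
  proof (rule order_tendstoD(2))
    show "(\<lambda>j. 2 / real (Suc j)) \<longlonglongrightarrow> 0" by real_asymp
  qed (use \<epsilon> in auto)
  ultimately have "\<forall>\<^sub>F j in sequentially. (\<integral>z. \<bar>S z - clamped_diff (real (Suc j)) z\<bar> \<partial>\<rho>) < \<epsilon> \<and> 2 / real (Suc j) < \<epsilon>"
    by eventually_elim blast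
  then obtain j where j: "(\<integral>z. \<bar>S z - clamped_diff (real (Suc j)) z\<bar> \<partial>\<rho>) < \<epsilon>" "2 / real (Suc j) < \<epsilon>"
    by (auto simp: eventually_sequentially)
  define K where "K = real (Suc j)"
  have K: "K > 0" "2 / K < \<epsilon>" using j by (auto simp: K_def)
  obtain q where q: "trig_poly q" "\<And>z. z \<in> {0..1} \<times> {0..1} \<Longrightarrow> \<bar>clamped_diff K z - q z\<bar> < \<epsilon>"
    using trig_poly_dense[OF continuous_clamped_diff \<epsilon>] by blast
  have intS: "integrable \<rho> S"
    by (intro integrable_const_bound[where B = 1]) (use mS in \<open>simp_all add: S_def abs_sgn_eq\<close>)
  have intC: "integrable \<rho> (clamped_diff K)"
    by (intro integrable_const_bound[where B = 1]) (auto simp: clamped_diff_def)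
  note intq = integrable_trig_poly[OF q(1)]
  have "\<bar>(\<integral>z. S z \<partial>\<rho>) - (\<integral>z. q z \<partial>\<rho>)\<bar> = \<bar>\<integral>z. S z - q z \<partial>\<rho>\<bar>"
    using intS intq by simp
  also have "\<dots> \<le> (\<integral>z. \<bar>S z - q z\<bar> \<partial>\<rho>)"
    by (rule integral_abs_bound)
  also have "\<dots> \<le> (\<integral>z. \<bar>S z - clamped_diff K z\<bar> + \<epsilon> \<partial>\<rho>)"
  proof (rule integral_mono_AE)
    show "AE z in \<rho>. \<bar>S z - q z\<bar> \<le> \<bar>S z - clamped_diff K z\<bar> + \<epsilon>"
      using supp
    proof eventually_elim
      case (elim z)
      then show ?case using q(2)[OF elim] by linarith
    qed
  qed (use intS intq intC in auto)
  also have "\<dots> = (\<integral>z. \<bar>S z - clamped_diff K z\<bar> \<partial>\<rho>) + \<epsilon>"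
    using intS intC by (simp add: prob_space)
  also have "\<dots> < 2 * \<epsilon>" using j by (simp add: K_def)
  finally have cont_err: "\<bar>(\<integral>z. S z \<partial>\<rho>) - (\<integral>z. q z \<partial>\<rho>)\<bar> < 2 * \<epsilon>" .
  define k where "k = (\<lambda>n::nat. nat \<lfloor>real n ^ 3 * t\<rfloor>)"
  define E where "E = (\<lambda>n. pair_sum n ((pair_step n ^^ k n) (\<lambda>a b. q (gridpt n a, gridpt n b))) id / real n ^ 2)"
  define D where "D = (\<lambda>n. pair_sum n ((pair_step n ^^ k n) sign_kernel) id / real n ^ 2)"
  have disc_err: "\<bar>D n - E n\<bar> \<le> \<epsilon> + 2 / K + 1 / real n" if n: "n \<ge> 5" for n
  proof -
    have n': "real n > 0" using n by simp
    let ?q = "\<lambda>a b. q (gridpt n a, gridpt n b)"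
    have "D n - E n = pair_sum n ((pair_step n ^^ k n) (\<lambda>a b. sign_kernel a b - ?q a b)) id / real n ^ 2"
      by (simp add: D_def E_def funpow_pair_step_diff pair_sum_diff diff_divide_distrib)
    then have "\<bar>D n - E n\<bar> = \<bar>pair_sum n ((pair_step n ^^ k n) (\<lambda>a b. sign_kernel a b - ?q a b)) id\<bar> / real n ^ 2"
      by simp
    also have "\<dots> \<le> (\<Sum>a\<in>{1..n}. \<Sum>b\<in>{1..n}. \<bar>sign_kernel a b - ?q a b\<bar>) / real n ^ 2"
      by (intro divide_right_mono order_trans[OF abs_pair_sum_id_le] sum_abs_funpow_pair_step_le n) simp
    \<comment> \<open>In each row at most \<open>2 * n / K + 1\<close> columns lie in the strip
      around the diagonal, where the ramp is off by at most 1; everywhere the polynomial is within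
      \<open>\<epsilon>\<close> of the ramp.\<close>
    also have "\<dots> \<le> (\<Sum>a\<in>{1..n}. 2 * (real n / K) + 1 + real n * \<epsilon>) / real n ^ 2"
    proof (intro divide_right_mono sum_mono)
      fix a assume a: "a \<in> {1..n}"
      have "(\<Sum>b\<in>{1..n}. \<bar>sign_kernel a b - ?q a b\<bar>)
          \<le> (\<Sum>b\<in>{1..n}. (if \<bar>real a - real b\<bar> < real n / K then 1 else 0) + \<epsilon>)"
      proof (rule sum_mono)
        fix b assume b: "b \<in> {1..n}"
        let ?z = "(gridpt n a, gridpt n b)"
        have diff: "fst ?z - snd ?z = (real a - real b) / real n"
          by (simp add: gridpt_def diff_divide_distrib)
        have "sgn (fst ?z - snd ?z) = sign_kernel a b"
          unfolding diff using n' by (simp add: sign_kernel_def sgn_if field_simps)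
        moreover have "\<bar>fst ?z - snd ?z\<bar> < 1 / K \<longleftrightarrow> \<bar>real a - real b\<bar> < real n / K"
          unfolding diff using n' K(1) by (simp add: field_simps)
        moreover have "\<bar>clamped_diff K ?z - q ?z\<bar> < \<epsilon>"
          using gridpt_in[OF a] gridpt_in[OF b] by (intro q(2)) auto
        ultimately show "\<bar>sign_kernel a b - ?q a b\<bar> \<le> (if \<bar>real a - real b\<bar> < real n / K then 1 else 0) + \<epsilon>"
          using sgn_clamped_diff[OF K(1), of ?z] by (simp split: if_splits)
      qed
      also have "\<dots> = real (card {b\<in>{1..n}. \<bar>real a - real b\<bar> < real n / K}) + real n * \<epsilon>"
        by (simp add: sum.distrib sum.If_cases Int_def)
      also have "\<dots> \<le> 2 * (real n / K) + 1 + real n * \<epsilon>"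
        using n' K(1) by (intro add_right_mono card_nat_near) simp
      finally show "(\<Sum>b\<in>{1..n}. \<bar>sign_kernel a b - ?q a b\<bar>) \<le> 2 * (real n / K) + 1 + real n * \<epsilon>" .
    qed simp
    also have "\<dots> = \<epsilon> + 2 / K + 1 / real n"
      using n' K(1) by (simp add: field_simps power2_eq_square)
    finally show ?thesis .
  qed
  have "E \<longlonglongrightarrow> (\<integral>z. q z \<partial>\<rho>) / 2"
    unfolding E_def k_def by (rule pair_sum_trig_poly_tendsto[OF q(1)])
  then have "\<forall>\<^sub>F n in sequentially. \<bar>E n - (\<integral>z. q z \<partial>\<rho>) / 2\<bar> < \<epsilon>"
    using \<epsilon> by (auto simp: tendsto_iff dist_real_def)
  moreover have "\<forall>\<^sub>F n in sequentially. 1 / real n < \<epsilon>"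
  proof (rule order_tendstoD(2))
    show "(\<lambda>n. 1 / real n) \<longlonglongrightarrow> 0" by real_asymp
  qed (use \<epsilon> in auto)
  ultimately have "\<forall>\<^sub>F n in sequentially. norm (D n - (\<integral>z. S z \<partial>\<rho>) / 2) < e"
    using eventually_ge_at_top[of 5]
  proof eventually_elim
    case (elim n)
    have "\<bar>D n - E n\<bar> \<le> 3 * \<epsilon>" using disc_err[OF elim(3)] elim(2) K(2) by linarith
    moreover have "\<bar>(\<integral>z. q z \<partial>\<rho>) / 2 - (\<integral>z. S z \<partial>\<rho>) / 2\<bar> < \<epsilon>" using cont_err by linarith
    ultimately have "\<bar>D n - (\<integral>z. S z \<partial>\<rho>) / 2\<bar> < 5 * \<epsilon>" using elim(1) by linarith
    then show ?case using \<open>e > 0\<close> by (simp add: \<epsilon>_def)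
  qed
  then show "\<exists>N. \<forall>n\<ge>N. norm (pair_sum n ((pair_step n ^^ nat \<lfloor>real n ^ 3 * t\<rfloor>) sign_kernel) id / real n ^ 2
      - (\<integral>z. sgn (fst z - snd z) \<partial>\<rho>) / 2) < e"
    unfolding D_def k_def S_def eventually_sequentially by blast
qed

end

section \<open>Reflecting Brownian motion\<close>

lemma borel_measurable_fold01 [measurable]: "fold01 \<in> borel_measurable borel"
proof -
  have "fold01 = (\<lambda>y. \<bar>y - 2 * of_int \<lfloor>y / 2 + 1 / 2\<rfloor>\<bar>)"
    by (simp add: fold01_def fun_eq_iff round_def)
  also have "\<dots> \<in> borel_measurable borel" by measurable
  finally show ?thesis .
qed

text \<open>This makes ties negligible: a shifted Gaussian avoids the preimage of any single folded
  value.\<close>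

lemma countable_fold01_fibre: "countable {y. fold01 y = c}"
proof -
  have "{y. fold01 y = c} \<subseteq> range (\<lambda>k::int. 2 * of_int k + c) \<union> range (\<lambda>k::int. 2 * of_int k - c)"
  proof
    fix y assume "y \<in> {y. fold01 y = c}"
    then have "y = 2 * of_int (round (y / 2)) + c \<or> y = 2 * of_int (round (y / 2)) - c"
      unfolding fold01_def by auto
    then show "y \<in> range (\<lambda>k::int. 2 * of_int k + c) \<union> range (\<lambda>k::int. 2 * of_int k - c)"
      by blast
  qed
  then show ?thesis by (rule countable_subset) auto
qed

text \<open>These cosines are even and 2-periodic, the symmetries by which folding identifies
  points. Their means under reflection are therefore means of a free Gaussian.\<close>

lemma cos_fold01: "cos (pi * real m * fold01 y) = cos (pi * real m * y)"
proof -
  define k where "k = int m * round (y / 2)"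
  have "cos (pi * real m * fold01 y) = cos (pi * real m * (y - 2 * of_int (round (y / 2))))"
    by (simp add: fold01_def abs_if right_diff_distrib) (simp add: cos_diff)
  also have "pi * real m * (y - 2 * of_int (round (y / 2))) = pi * real m * y - 2 * pi * of_int k"
    by (simp add: k_def algebra_simps)
  also have "cos \<dots> = cos (pi * real m * y)"
    using cos_int_2pin[of k] sin_int_2pin[of k] by (simp add: cos_diff)
  finally show ?thesis .
qed

section \<open>Gaussian averages and the transition density\<close>

definition gauss :: "real \<Rightarrow> real measure" where
  "gauss t = density lborel (normal_density 0 (sqrt (2 * t)))"

lemma sets_gauss [measurable_cong, simp]: "sets (gauss t) = sets borel"
  and space_gauss [simp]: "space (gauss t) = UNIV"
  by (simp_all add: gauss_def)

lemma prob_space_gauss: "t > 0 \<Longrightarrow> prob_space (gauss t)"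
  unfolding gauss_def by (rule prob_space_normal_density) simp

lemma AE_gauss_fold01: "AE w in gauss t. fold01 (v + w) \<noteq> c"
proof -
  have "countable ((\<lambda>y. y - v) ` {y. fold01 y = c})"
    by (intro countable_image countable_fold01_fibre)
  also have "(\<lambda>y. y - v) ` {y. fold01 y = c} = {w. fold01 (v + w) = c}"
    by (auto simp: image_iff) (metis add_diff_cancel_left')
  finally have "AE w in lborel. w \<notin> {w. fold01 (v + w) = c}"
    by (intro AE_not_in countable_imp_null_set_lborel)
  then show ?thesis
    unfolding gauss_def by (subst AE_density) auto
qed

text \<open>The real part of the standard normal characteristic function at
  \<open>a * sqrt (2 * t)\<close> gives the decay, and its vanishing imaginary part removes the sine
  term of the addition formula.\<close>

lemma cos_gauss:
  assumes "t > 0"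
  shows "(\<integral>w. cos (a * (u + w)) \<partial>gauss t) = exp (- (a\<^sup>2 * t)) * cos (a * u)"
proof -
  interpret S: prob_space std_normal_distribution by (rule prob_space_normal_density) simp
  define s where "s = a * sqrt (2 * t)"
  have "distributed std_normal_distribution lborel (\<lambda>x. x) std_normal_density"
    by (auto simp: distributed_def distr_id2)
  from S.normal_density_affine[OF this, of "sqrt (2 * t)" 0] assms
  have "distributed std_normal_distribution lborel (\<lambda>x. sqrt (2 * t) * x) (normal_density 0 (sqrt (2 * t)))"
    by simp
  then have gauss: "gauss t = distr std_normal_distribution lborel (\<lambda>x. sqrt (2 * t) * x)"
    by (simp add: distributed_def gauss_def)
  have int: "integrable std_normal_distribution (\<lambda>x. iexp (s * x))"
    by (intro S.integrable_const_bound[where B = 1]) auto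
  have char: "(CLINT x|std_normal_distribution. iexp (s * x)) = of_real (exp (- (s\<^sup>2) / 2))"
    using char_std_normal_distribution by (simp add: char_def fun_eq_iff)
  have "(\<integral>x. cos (s * x) \<partial>std_normal_distribution) = Re (CLINT x|std_normal_distribution. iexp (s * x))"
    using integral_Re[OF int] by (simp add: Re_exp)
  then have c: "(\<integral>x. cos (s * x) \<partial>std_normal_distribution) = exp (- (s\<^sup>2) / 2)"
    unfolding char by simp
  have "(\<integral>x. sin (s * x) \<partial>std_normal_distribution) = Im (CLINT x|std_normal_distribution. iexp (s * x))"
    using integral_Im[OF int] by (simp add: Im_exp)
  then have d: "(\<integral>x. sin (s * x) \<partial>std_normal_distribution) = 0"
    unfolding char by simp
  have "(\<integral>w. cos (a * (u + w)) \<partial>gauss t) = (\<integral>x. cos (a * (u + sqrt (2 * t) * x)) \<partial>std_normal_distribution)"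
    unfolding gauss by (subst integral_distr) auto
  also have "\<dots> = (\<integral>x. cos (a * u) * cos (s * x) - sin (a * u) * sin (s * x) \<partial>std_normal_distribution)"
    by (simp add: s_def cos_add[symmetric] algebra_simps)
  also have "\<dots> = cos (a * u) * (\<integral>x. cos (s * x) \<partial>std_normal_distribution)
      - sin (a * u) * (\<integral>x. sin (s * x) \<partial>std_normal_distribution)"
    by (subst Bochner_Integration.integral_diff)
       (auto intro!: S.integrable_const_bound[where B = 1] simp: abs_mult)
  also have "\<dots> = exp (- (s\<^sup>2) / 2) * cos (a * u)" unfolding c d by simp
  also have "- (s\<^sup>2) / 2 = - (a\<^sup>2 * t)" using assms by (simp add: s_def power_mult_distrib)
  finally show ?thesis .
qed

lemma distr_brownian_motion:
  assumes "standard_brownian_motion M W" "t > 0"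
  shows "distr M borel (W (2 * t)) = gauss t" and "W (2 * t) \<in> borel_measurable M"
proof -
  have m [measurable]: "W 0 \<in> borel_measurable M" "W (2 * t) \<in> borel_measurable M"
    using assms unfolding standard_brownian_motion_def by auto
  show "W (2 * t) \<in> borel_measurable M" by measurable
  have "distributed M lborel (\<lambda>\<omega>. W (2 * t) \<omega> - W 0 \<omega>) (normal_density 0 (sqrt (2 * t - 0)))"
    using assms unfolding standard_brownian_motion_def by (metis mult_pos_pos order_refl zero_less_numeral)
  then have "distr M lborel (\<lambda>\<omega>. W (2 * t) \<omega> - W 0 \<omega>) = gauss t"
    by (simp add: distributed_def gauss_def)
  moreover have "AE \<omega> in M. W 0 \<omega> = 0"
    using assms unfolding standard_brownian_motion_def by blast
  then have "distr M lborel (\<lambda>\<omega>. W (2 * t) \<omega> - W 0 \<omega>) = distr M borel (W (2 * t))"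
    by (intro distr_cong_AE) auto
  ultimately show "distr M borel (W (2 * t)) = gauss t" by simp
qed

text \<open>Integrals against \<open>p\<close> depend on the law alone, so the density is traded for
  an explicit Gaussian average of the folded path.\<close>

lemma integral_transition_density:
  fixes h :: "real \<Rightarrow> real"
  assumes W: "standard_brownian_motion N W" and p: "transition_density N (reflecting_bm W) p"
    and "t > 0" "u \<in> {0..1}" and [measurable]: "h \<in> borel_measurable borel"
  shows "(LINT x:{0..1}|lborel. p t u x * h x) = (\<integral>w. h (fold01 (u + w)) \<partial>gauss t)"
proof -
  note [measurable] = distr_brownian_motion(2)[OF W \<open>t > 0\<close>]
  have nonneg: "\<forall>x\<in>{0..1}. 0 \<le> p t u x"
    and D: "distributed N (restrict_space lborel {0..1}) (reflecting_bm W u t) (\<lambda>v. ennreal (p t u v))"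
    using p assms(3,4) unfolding transition_density_def by auto
  have "(\<integral>x. p t u x * h x \<partial>restrict_space lborel {0..1}) = (\<integral>\<omega>. h (reflecting_bm W u t \<omega>) \<partial>N)"
    by (rule distributed_integral[OF D]) (auto simp: nonneg intro: measurable_restrict_space1)
  moreover have "(\<integral>x. p t u x * h x \<partial>restrict_space lborel {0..1}) = (LINT x:{0..1}|lborel. p t u x * h x)"
    unfolding set_lebesgue_integral_def by (rule integral_restrict_space) simp
  moreover have "(\<integral>\<omega>. h (reflecting_bm W u t \<omega>) \<partial>N) = (\<integral>w. h (fold01 (u + w)) \<partial>gauss t)"
    unfolding distr_brownian_motion(1)[OF W \<open>t > 0\<close>, symmetric]
    by (subst integral_distr) (auto simp: reflecting_bm_def)
  ultimately show ?thesis by simp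
qed

section \<open>Semigroup of two independent reflecting Brownian motions\<close>

definition folded_mean :: "real \<Rightarrow> (real \<times> real \<Rightarrow> real) \<Rightarrow> real \<times> real \<Rightarrow> real" where
  "folded_mean t G z = (\<integral>w. G (fold01 (fst z + fst w), fold01 (snd z + snd w)) \<partial>(gauss t \<Otimes>\<^sub>M gauss t))"

context
  fixes t :: real
  assumes t: "t > 0"
begin

interpretation G: prob_space "gauss t" by (rule prob_space_gauss[OF t])
interpretation GG: pair_prob_space "gauss t" "gauss t" ..

lemma borel_measurable_folded_mean [measurable]:
  assumes [measurable]: "G \<in> borel_measurable borel"
  shows "folded_mean t G \<in> borel_measurable borel"
proof -
  have [measurable]: "G \<in> borel_measurable (borel \<Otimes>\<^sub>M borel)" unfolding borel_prod by measurable
  have "folded_mean t G \<in> borel_measurable (borel \<Otimes>\<^sub>M borel)"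
    unfolding folded_mean_def by measurable
  then show ?thesis by (simp add: borel_prod)
qed

lemma abs_folded_mean_le:
  assumes [measurable]: "G \<in> borel_measurable borel" and "\<And>z. \<bar>G z\<bar> \<le> C"
  shows "\<bar>folded_mean t G z\<bar> \<le> C"
proof -
  have [measurable]: "G \<in> borel_measurable (borel \<Otimes>\<^sub>M borel)" unfolding borel_prod by measurable
  show ?thesis
    unfolding folded_mean_def using assms(2)
    by (intro order_trans[OF integral_abs_bound] GG.P.integral_le_const GG.P.integrable_const_bound[where B = C]) auto
qed

lemma folded_mean_iterated:
  assumes [measurable]: "G \<in> borel_measurable borel" and "\<And>z. \<bar>G z\<bar> \<le> C"
  shows "folded_mean t G (u, v) = (\<integral>w. \<integral>w'. G (fold01 (u + w), fold01 (v + w')) \<partial>gauss t \<partial>gauss t)"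
proof -
  have [measurable]: "G \<in> borel_measurable (borel \<Otimes>\<^sub>M borel)" unfolding borel_prod by measurable
  have "integrable (gauss t \<Otimes>\<^sub>M gauss t) (\<lambda>w. G (fold01 (u + fst w), fold01 (v + snd w)))"
    using assms(2) by (intro GG.P.integrable_const_bound[where B = C]) auto
  from GG.integral_fst'[OF this] show ?thesis
    by (simp add: folded_mean_def)
qed

text \<open>The innermost integral is the distribution function of the motion started at
  \<open>v\<close>, evaluated at the position \<open>x\<close> of the other one. Its range
  \<open>{0..x}\<close> is closed, hence the weak inequality in the event.\<close>

lemma crossing_integral_eq:
  assumes W: "standard_brownian_motion N W" and p: "transition_density N (reflecting_bm W) p"
  shows "crossing_integral p t
    = (LINT u:{0..1}|lborel. LINT v:{u..1}|lborel. folded_mean t (\<lambda>z. of_bool (snd z \<le> fst z)) (u, v))"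
  unfolding crossing_integral_def
proof (intro set_lebesgue_integral_cong allI impI)
  fix u v :: real assume u: "u \<in> {0..1}" and v: "v \<in> {u..1}"
  then have v01: "v \<in> {0..1}" by auto
  define F where "F = (\<lambda>x. \<integral>w'. of_bool (fold01 (v + w') \<le> x) \<partial>gauss t :: real)"
  have [measurable]: "F \<in> borel_measurable borel" unfolding F_def by measurable
  have "(LINT y:{0..x}|lborel. p t v y) = F x" if "x \<in> {0..1}" for x
  proof -
    \<comment> \<open>The varying range becomes a factor of the integrand, so that the density
      formula over the whole unit interval applies.\<close>
    have "(LINT y:{0..x}|lborel. p t v y) = (LINT y:{0..1}|lborel. p t v y * of_bool (y \<le> x))"
      unfolding set_lebesgue_integral_def
      using that by (intro Bochner_Integration.integral_cong refl) (auto simp: indicator_def)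
    also have "\<dots> = F x"
      unfolding F_def by (rule integral_transition_density[OF W p t v01]) measurable
    finally show ?thesis .
  qed
  then have "(LINT x:{0..1}|lborel. p t u x * (LINT y:{0..x}|lborel. p t v y)) = (LINT x:{0..1}|lborel. p t u x * F x)"
    by (intro set_lebesgue_integral_cong) auto
  also have "\<dots> = (\<integral>w. F (fold01 (u + w)) \<partial>gauss t)"
    by (rule integral_transition_density[OF W p t u]) measurable
  also have "\<dots> = folded_mean t (\<lambda>z. of_bool (snd z \<le> fst z)) (u, v)"
    by (subst folded_mean_iterated[where C = 1]) (auto simp: F_def borel_prod[symmetric])
  finally show "(LINT x:{0..1}|lborel. p t u x * (LINT y:{0..x}|lborel. p t v y))
    = folded_mean t (\<lambda>z. of_bool (snd z \<le> fst z)) (u, v)" .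
qed auto

lemma folded_mean_ties: "folded_mean t (\<lambda>z. of_bool (fst z = snd z)) (u, v) = 0"
proof -
  have "folded_mean t (\<lambda>z. of_bool (fst z = snd z)) (u, v)
      = (\<integral>w. \<integral>w'. of_bool (fold01 (u + w) = fold01 (v + w')) \<partial>gauss t \<partial>gauss t)"
    by (subst folded_mean_iterated[where C = 1]) (auto simp: borel_prod[symmetric])
  also have "(\<lambda>w. \<integral>w'. of_bool (fold01 (u + w) = fold01 (v + w')) \<partial>gauss t) = (\<lambda>w. 0 :: real)"
  proof
    fix w
    have "AE w' in gauss t. of_bool (fold01 (u + w) = fold01 (v + w')) = (0::real)"
      using AE_gauss_fold01[of v "fold01 (u + w)"] by eventually_elim auto
    then show "(\<integral>w'. of_bool (fold01 (u + w) = fold01 (v + w')) \<partial>gauss t) = (0::real)"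
      by (rule integral_eq_zero_AE)
  qed
  finally show ?thesis by simp
qed

text \<open>The continuous counterpart of the lattice eigenvalue equation, with the limit of the
  powers of \<open>eigenvalue\<close> as its factor.\<close>

lemma folded_mean_cos:
  "folded_mean t (\<lambda>z. cos (pi * real m * fst z) * cos (pi * real m' * snd z)) (u, v)
     = exp (- (pi\<^sup>2 * (real m ^ 2 + real m' ^ 2) * t)) * (cos (pi * real m * u) * cos (pi * real m' * v))"
proof -
  have "folded_mean t (\<lambda>z. cos (pi * real m * fst z) * cos (pi * real m' * snd z)) (u, v)
      = (\<integral>w. \<integral>w'. cos (pi * real m * (u + w)) * cos (pi * real m' * (v + w')) \<partial>gauss t \<partial>gauss t)"
    by (subst folded_mean_iterated[where C = 1])
       (auto simp: borel_prod[symmetric] cos_fold01 abs_mult intro!: mult_le_one)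
  also have "\<dots> = (\<integral>w. cos (pi * real m * (u + w)) \<partial>gauss t) * (\<integral>w'. cos (pi * real m' * (v + w')) \<partial>gauss t)"
    by simp
  also have "\<dots> = exp (- ((pi * real m)\<^sup>2 * t)) * cos (pi * real m * u)
      * (exp (- ((pi * real m')\<^sup>2 * t)) * cos (pi * real m' * v))"
    unfolding cos_gauss[OF t] ..
  also have "\<dots> = (exp (- ((pi * real m)\<^sup>2 * t)) * exp (- ((pi * real m')\<^sup>2 * t)))
      * (cos (pi * real m * u) * cos (pi * real m' * v))"
    by (simp only: mult.assoc mult.left_commute)
  also have "exp (- ((pi * real m)\<^sup>2 * t)) * exp (- ((pi * real m')\<^sup>2 * t))
      = exp (- (pi\<^sup>2 * (real m ^ 2 + real m' ^ 2) * t))"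
    by (simp add: exp_add[symmetric] power_mult_distrib algebra_simps)
  finally show ?thesis .
qed

end

section \<open>The pair of reflecting Brownian motions\<close>

definition unit_triangle :: "(real \<times> real) set" where
  "unit_triangle = {(u, v). 0 \<le> u \<and> u < v \<and> v \<le> 1}"

lemma sets_unit_triangle [measurable]: "unit_triangle \<in> sets borel"
proof -
  have "unit_triangle = {z. 0 \<le> fst z} \<inter> {z. fst z < snd z} \<inter> {z. snd z \<le> 1}"
    by (auto simp: unit_triangle_def)
  also have "\<dots> \<in> sets borel"
    by (intro sets.Int borel_closed borel_open closed_Collect_le open_Collect_less continuous_intros)
  finally show ?thesis .
qed

lemma emeasure_unit_triangle: "emeasure lborel unit_triangle = ennreal (1 / 2)"
proof -
  have "emeasure lborel unit_triangle = (\<integral>\<^sup>+u. emeasure lborel (Pair u -` unit_triangle) \<partial>lborel)"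
    unfolding lborel_prod[symmetric]
    by (rule lborel.emeasure_pair_measure_alt) (unfold lborel_prod, simp)
  also have "\<dots> = (\<integral>\<^sup>+u. ennreal (1 - u) * indicator {0..1} u \<partial>lborel)"
  proof (intro nn_integral_cong)
    fix u :: real
    have "Pair u -` unit_triangle = (if 0 \<le> u then {u<..1} else {})"
      by (auto simp: unit_triangle_def)
    then show "emeasure lborel (Pair u -` unit_triangle) = ennreal (1 - u) * indicator {0..1} u"
      by (auto simp: indicator_def)
  qed
  also have "\<dots> = ennreal ((1 - 1\<^sup>2 / 2) - (0 - 0\<^sup>2 / 2))"
    by (rule nn_integral_FTC_Icc[where F = "\<lambda>u. u - u\<^sup>2 / 2"]) (auto intro!: derivative_eq_intros)
  finally show ?thesis by simp
qed

lemma prob_space_unit_triangle: "prob_space (uniform_measure lborel unit_triangle)"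
  by (rule prob_space_uniform_measure) (simp_all add: emeasure_unit_triangle)

text \<open>Two orders of integration: the first is that of \<open>crossing_integral\<close>, the
  second integrates the smaller variable first, as \<open>cosine_triangle\<close> does. The factor 2
  is the reciprocal of the area.\<close>

lemma integral_unit_triangle:
  fixes K :: "real \<times> real \<Rightarrow> real"
  assumes [measurable]: "K \<in> borel_measurable borel" and bound: "\<And>z. \<bar>K z\<bar> \<le> C"
  shows "(\<integral>z. K z \<partial>uniform_measure lborel unit_triangle)
           = 2 * (LINT u:{0..1}|lborel. LINT v:{u..1}|lborel. K (u, v))" (is ?fst)
    and "(\<integral>z. K z \<partial>uniform_measure lborel unit_triangle)
           = 2 * (LINT v:{0..1}|lborel. LINT u:{0..v}|lborel. K (u, v))" (is ?snd)
proof -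
  have half: "1 / ennreal (1 / 2) = ennreal 2"
    using divide_ennreal[of 1 "1 / 2"] by simp
  have "uniform_measure lborel unit_triangle = density lborel (\<lambda>z. ennreal (2 * indicator unit_triangle z))"
    unfolding uniform_measure_def emeasure_unit_triangle
    using half by (intro density_cong) (auto simp: indicator_def)
  then have "(\<integral>z. K z \<partial>uniform_measure lborel unit_triangle) = (\<integral>z. 2 * indicator unit_triangle z * K z \<partial>lborel)"
    by (simp add: integral_density)
  then have eq: "(\<integral>z. K z \<partial>uniform_measure lborel unit_triangle)
      = 2 * (\<integral>z. indicator unit_triangle z * K z \<partial>(lborel \<Otimes>\<^sub>M lborel))"
    by (simp add: mult.assoc lborel_prod)
  have "integrable lborel (\<lambda>z. indicator unit_triangle z * K z)"
  proof (rule Bochner_Integration.integrable_bound)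
    show "integrable lborel (\<lambda>z. C * indicator unit_triangle z)"
      by (intro integrable_mult_right integrable_real_indicator) (simp, simp only: emeasure_unit_triangle infinity_ennreal_def ennreal_less_top)
    show "AE z in lborel. norm (indicator unit_triangle z * K z) \<le> norm (C * indicator unit_triangle z)"
      using order_trans[OF bound abs_ge_self] by (intro always_eventually) (auto simp: indicator_def)
  qed measurable
  then have int: "integrable (lborel \<Otimes>\<^sub>M lborel) (\<lambda>z. indicator unit_triangle z * K z)"
    by (simp add: lborel_prod)
  have Kp [measurable]: "K \<in> borel_measurable (borel \<Otimes>\<^sub>M borel)" by (simp add: borel_prod)
  have Tp [measurable]: "unit_triangle \<in> sets (borel \<Otimes>\<^sub>M borel)"
    using sets_unit_triangle by (simp only: borel_prod)
  have "(\<integral>z. indicator unit_triangle z * K z \<partial>(lborel \<Otimes>\<^sub>M lborel))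
      = (\<integral>u. \<integral>v. indicator unit_triangle (u, v) * K (u, v) \<partial>lborel \<partial>lborel)"
    by (rule lborel_pair.integral_fst'[OF int, symmetric])
  also have "\<dots> = (LINT u:{0..1}|lborel. LINT v:{u..1}|lborel. K (u, v))"
    unfolding set_lebesgue_integral_def
  proof (intro Bochner_Integration.integral_cong refl)
    fix u :: real
    have "(\<integral>v. indicator unit_triangle (u, v) * K (u, v) \<partial>lborel)
        = (\<integral>v. indicator {0..1} u * (indicator {u..1} v * K (u, v)) \<partial>lborel)"
    proof (rule integral_cong_AE)
      \<comment> \<open>The triangle excludes \<open>v = u\<close> while \<open>{u..1}\<close>
        contains it; a single point is a null set.\<close>
      show "AE v in lborel. indicator unit_triangle (u, v) * K (u, v) = indicator {0..1} u * (indicator {u..1} v * K (u, v))"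
        using AE_lborel_singleton[of u]
        by eventually_elim (auto simp: indicator_def unit_triangle_def)
    qed measurable
    then show "(\<integral>v. indicator unit_triangle (u, v) * K (u, v) \<partial>lborel)
        = indicator {0..1} u *\<^sub>R (\<integral>v. indicator {u..1} v *\<^sub>R K (u, v) \<partial>lborel)"
      by simp
  qed
  finally show ?fst unfolding eq by simp
  have "(\<integral>z. indicator unit_triangle z * K z \<partial>(lborel \<Otimes>\<^sub>M lborel))
      = (\<integral>v. \<integral>u. indicator unit_triangle (u, v) * K (u, v) \<partial>lborel \<partial>lborel)"
    using lborel_pair.integral_snd[of "\<lambda>u v. indicator unit_triangle (u, v) * K (u, v)"] int
    by (simp add: case_prod_beta')
  also have "\<dots> = (LINT v:{0..1}|lborel. LINT u:{0..v}|lborel. K (u, v))"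
    unfolding set_lebesgue_integral_def
  proof (intro Bochner_Integration.integral_cong refl)
    fix v :: real
    have "(\<integral>u. indicator unit_triangle (u, v) * K (u, v) \<partial>lborel)
        = (\<integral>u. indicator {0..1} v * (indicator {0..v} u * K (u, v)) \<partial>lborel)"
    proof (rule integral_cong_AE)
      show "AE u in lborel. indicator unit_triangle (u, v) * K (u, v) = indicator {0..1} v * (indicator {0..v} u * K (u, v))"
        using AE_lborel_singleton[of v]
        by eventually_elim (auto simp: indicator_def unit_triangle_def)
    qed measurable
    then show "(\<integral>u. indicator unit_triangle (u, v) * K (u, v) \<partial>lborel)
        = indicator {0..1} v *\<^sub>R (\<integral>u. indicator {0..v} u *\<^sub>R K (u, v) \<partial>lborel)"
      by simp
  qed
  finally show ?snd unfolding eq by simp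
qed

text \<open>A product law is determined by rectangles. The last two variables are paired first; the
  pair is measurable for the sigma-algebra generated by \<open>E 1\<close> and \<open>E 2\<close>,
  which is independent of \<open>E 0\<close>.\<close>

lemma (in prob_space) distr_triple_of_indep_sets:
  assumes [measurable]: "Z \<in> measurable M S" "V1 \<in> measurable M S1" "V2 \<in> measurable M S2"
    and ind: "indep_sets E {..<3}" and alg: "\<And>i. i < 3 \<Longrightarrow> sigma_algebra (space M) (E i)"
    and Z: "\<And>A. A \<in> sets S \<Longrightarrow> Z -` A \<inter> space M \<in> E 0"
    and V1: "\<And>A. A \<in> sets S1 \<Longrightarrow> V1 -` A \<inter> space M \<in> E (Suc 0)"
    and V2: "\<And>A. A \<in> sets S2 \<Longrightarrow> V2 -` A \<inter> space M \<in> E 2"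
  shows "distr M (S \<Otimes>\<^sub>M (S1 \<Otimes>\<^sub>M S2)) (\<lambda>\<omega>. (Z \<omega>, V1 \<omega>, V2 \<omega>)) = distr M S Z \<Otimes>\<^sub>M (distr M S1 V1 \<Otimes>\<^sub>M distr M S2 V2)"
proof -
  interpret Z: prob_space "distr M S Z" by (rule prob_space_distr) simp
  interpret V1: prob_space "distr M S1 V1" by (rule prob_space_distr) simp
  interpret V2: prob_space "distr M S2 V2" by (rule prob_space_distr) simp
  interpret V: pair_prob_space "distr M S1 V1" "distr M S2 V2" ..
  \<comment> \<open>Index 0 stands alone, indices 1 and 2 form the second block.\<close>
  define I :: "nat \<Rightarrow> nat set" where "I = (\<lambda>j. if j = 0 then {0} else {1, 2})"
  have E_sub: "E i \<subseteq> Pow (space M)" if "i < 3" for i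
    using alg[OF that] by (simp add: sigma_algebra_iff2)
  have "indep_sets E (\<Union>j\<in>{0, 1}. I j)"
  proof -
    have "(\<Union>j\<in>{0, 1}. I j) = {..<3}" by (auto simp: I_def)
    then show ?thesis using ind by simp
  qed
  then have ind2: "indep_sets (\<lambda>j. sigma_sets (space M) (\<Union>i\<in>I j. E i)) {0, 1}"
  proof (rule indep_sets_collect_sigma)
    fix i j assume "j \<in> {0, 1::nat}" "i \<in> I j"
    then have "i < 3" by (auto simp: I_def split: if_splits)
    then interpret sigma_algebra "space M" "E i" by (rule alg)
    show "Int_stable (E i)" by (auto simp: Int_stable_def)
  qed (auto simp: disjoint_family_on_def I_def)
  have V_law: "distr M S1 V1 \<Otimes>\<^sub>M distr M S2 V2 = distr M (S1 \<Otimes>\<^sub>M S2) (\<lambda>\<omega>. (V1 \<omega>, V2 \<omega>))"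
  proof (rule pair_measure_eqI)
    fix A B assume "A \<in> sets (distr M S1 V1)" "B \<in> sets (distr M S2 V2)"
    then have A [measurable]: "A \<in> sets S1" and B [measurable]: "B \<in> sets S2" by auto
    define F where "F = (\<lambda>i::nat. if i = 1 then V1 -` A \<inter> space M else V2 -` B \<inter> space M)"
    have "prob (\<Inter>i\<in>{1, 2}. F i) = (\<Prod>i\<in>{1, 2}. prob (F i))"
      using ind V1[OF A] V2[OF B] by (intro indep_setsD) (auto simp: F_def)
    then have "prob ((V1 -` A \<inter> space M) \<inter> (V2 -` B \<inter> space M)) = prob (V1 -` A \<inter> space M) * prob (V2 -` B \<inter> space M)"
      by (simp add: F_def Int_commute)
    moreover have "(\<lambda>\<omega>. (V1 \<omega>, V2 \<omega>)) -` (A \<times> B) \<inter> space M = (V1 -` A \<inter> space M) \<inter> (V2 -` B \<inter> space M)"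
      by auto
    ultimately show "emeasure (distr M S1 V1) A * emeasure (distr M S2 V2) B
        = emeasure (distr M (S1 \<Otimes>\<^sub>M S2) (\<lambda>\<omega>. (V1 \<omega>, V2 \<omega>))) (A \<times> B)"
      by (simp add: emeasure_distr emeasure_eq_measure ennreal_mult)
  qed (auto simp: V1.sigma_finite_measure_axioms V2.sigma_finite_measure_axioms)
  have V_meas: "(\<lambda>\<omega>. (V1 \<omega>, V2 \<omega>)) \<in> measurable (sigma (space M) (E 1 \<union> E 2)) (S1 \<Otimes>\<^sub>M S2)"
  proof (rule measurable_Pair)
    have sub: "E 1 \<union> E 2 \<subseteq> Pow (space M)" using E_sub[of 1] E_sub[of 2] by auto
    show "V1 \<in> measurable (sigma (space M) (E 1 \<union> E 2)) S1"
      using V1 measurable_space[OF assms(2)] sub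
      by (intro measurableI) (auto simp: space_measure_of sets_measure_of intro!: sigma_sets.Basic)
    show "V2 \<in> measurable (sigma (space M) (E 1 \<union> E 2)) S2"
      using V2 measurable_space[OF assms(3)] sub
      by (intro measurableI) (auto simp: space_measure_of sets_measure_of intro!: sigma_sets.Basic)
  qed
  have "distr M S Z \<Otimes>\<^sub>M (distr M S1 V1 \<Otimes>\<^sub>M distr M S2 V2)
      = distr M (S \<Otimes>\<^sub>M (S1 \<Otimes>\<^sub>M S2)) (\<lambda>\<omega>. (Z \<omega>, V1 \<omega>, V2 \<omega>))"
  proof (rule pair_measure_eqI)
    fix A B assume "A \<in> sets (distr M S Z)" "B \<in> sets (distr M S1 V1 \<Otimes>\<^sub>M distr M S2 V2)"
    then have A [measurable]: "A \<in> sets S" and B [measurable]: "B \<in> sets (S1 \<Otimes>\<^sub>M S2)" by auto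
    have sub: "E 1 \<union> E 2 \<subseteq> Pow (space M)" using E_sub[of 1] E_sub[of 2] by auto
    have VB: "(\<lambda>\<omega>. (V1 \<omega>, V2 \<omega>)) -` B \<inter> space M \<in> sigma_sets (space M) (E 1 \<union> E 2)"
      using measurable_sets[OF V_meas B] sub by (simp add: space_measure_of sets_measure_of)
    define F where "F = (\<lambda>j::nat. if j = 0 then Z -` A \<inter> space M else (\<lambda>\<omega>. (V1 \<omega>, V2 \<omega>)) -` B \<inter> space M)"
    have "prob (\<Inter>j\<in>{0, 1}. F j) = (\<Prod>j\<in>{0, 1}. prob (F j))"
      using VB Z[OF A] by (intro indep_setsD[OF ind2]) (auto simp: F_def I_def intro: sigma_sets.Basic)
    then have "prob ((Z -` A \<inter> space M) \<inter> ((\<lambda>\<omega>. (V1 \<omega>, V2 \<omega>)) -` B \<inter> space M))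
        = prob (Z -` A \<inter> space M) * prob ((\<lambda>\<omega>. (V1 \<omega>, V2 \<omega>)) -` B \<inter> space M)"
      by (simp add: F_def Int_commute)
    moreover have "(\<lambda>\<omega>. (Z \<omega>, V1 \<omega>, V2 \<omega>)) -` (A \<times> B) \<inter> space M
        = (Z -` A \<inter> space M) \<inter> ((\<lambda>\<omega>. (V1 \<omega>, V2 \<omega>)) -` B \<inter> space M)"
      by auto
    ultimately show "emeasure (distr M S Z) A * emeasure (distr M S1 V1 \<Otimes>\<^sub>M distr M S2 V2) B
        = emeasure (distr M (S \<Otimes>\<^sub>M (S1 \<Otimes>\<^sub>M S2)) (\<lambda>\<omega>. (Z \<omega>, V1 \<omega>, V2 \<omega>))) (A \<times> B)"
      unfolding V_law by (simp add: emeasure_distr emeasure_eq_measure ennreal_mult)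
  qed (auto simp: Z.sigma_finite_measure_axioms V.sigma_finite_measure_axioms)
  then show ?thesis by (rule sym)
qed

text \<open>The time \<open>t\<close> positions depend on the starting points and on the values of
  the driving paths at \<open>2 * t\<close>. Each such value is a coordinate of its path, so the
  independence of the path sigma-algebras gives a product law, and Fubini's theorem leaves the
  starting law outside.\<close>

lemma ordered_pair_expectation:
  fixes G :: "real \<times> real \<Rightarrow> real"
  assumes pair: "ordered_reflecting_bm_pair Q B1 B2" and t: "t > 0"
    and G [measurable]: "G \<in> borel_measurable borel" and bound: "\<And>z. \<bar>G z\<bar> \<le> C"
  shows "(\<integral>\<omega>. G (B1 t \<omega>, B2 t \<omega>) \<partial>Q) = (\<integral>z. folded_mean t G z \<partial>uniform_measure lborel unit_triangle)"
    and "(\<lambda>\<omega>. (B1 t \<omega>, B2 t \<omega>)) \<in> borel_measurable Q"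
    and "\<And>\<omega>. \<omega> \<in> space Q \<Longrightarrow> (B1 t \<omega>, B2 t \<omega>) \<in> {0..1} \<times> {0..1}"
proof -
  interpret prob_space Q using pair unfolding ordered_reflecting_bm_pair_def by blast
  obtain U1 U2 :: "'a \<Rightarrow> real" and W1 W2 where
    U [measurable]: "U1 \<in> borel_measurable Q" "U2 \<in> borel_measurable Q"
    and lawU: "distr Q borel (\<lambda>\<omega>. (U1 \<omega>, U2 \<omega>)) = uniform_measure lborel {(u, v). 0 \<le> u \<and> u < v \<and> v \<le> 1}"
    and W: "standard_brownian_motion Q W1" "standard_brownian_motion Q W2"
    and ind: "indep_sets
          (\<lambda>i. [sets (vimage_algebra (space Q) (\<lambda>\<omega>. (U1 \<omega>, U2 \<omega>)) borel),
                sets (vimage_algebra (space Q) (\<lambda>\<omega>. \<lambda>s\<in>{0..}. W1 s \<omega>) (PiM {0..} (\<lambda>_. borel))),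
                sets (vimage_algebra (space Q) (\<lambda>\<omega>. \<lambda>s\<in>{0..}. W2 s \<omega>) (PiM {0..} (\<lambda>_. borel)))] ! i)
          {..<3}" (is "indep_sets ?E _")
    and B: "\<And>s \<omega>. s \<ge> 0 \<Longrightarrow> \<omega> \<in> space Q \<Longrightarrow>
           B1 s \<omega> = reflecting_bm W1 (U1 \<omega>) s \<omega> \<and> B2 s \<omega> = reflecting_bm W2 (U2 \<omega>) s \<omega>"
    using pair unfolding ordered_reflecting_bm_pair_def by blast
  note [measurable] = distr_brownian_motion(2)[OF W(1) t] distr_brownian_motion(2)[OF W(2) t]
  have path: "(\<lambda>\<omega>. W (2 * t) \<omega>) -` A \<inter> space Q
      \<in> sets (vimage_algebra (space Q) (\<lambda>\<omega>. \<lambda>s\<in>{0..}. W s \<omega>) (PiM {0..} (\<lambda>_. borel)))"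
    if A: "A \<in> sets borel" for A and W :: "real \<Rightarrow> 'a \<Rightarrow> real"
  proof -
    have "(\<lambda>f. f (2 * t)) -` A \<inter> space (PiM {0..} (\<lambda>_. borel)) \<in> sets (PiM {0..} (\<lambda>_. borel :: real measure))"
      using t A by (intro measurable_sets[OF measurable_component_singleton]) auto
    from in_vimage_algebra[OF this, of "\<lambda>\<omega>. \<lambda>s\<in>{0..}. W s \<omega>" "space Q"]
    have "(\<lambda>\<omega>. \<lambda>s\<in>{0..}. W s \<omega>) -` ((\<lambda>f. f (2 * t)) -` A \<inter> space (PiM {0..} (\<lambda>_. borel))) \<inter> space Q
      \<in> sets (vimage_algebra (space Q) (\<lambda>\<omega>. \<lambda>s\<in>{0..}. W s \<omega>) (PiM {0..} (\<lambda>_. borel)))" .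
    also have "(\<lambda>\<omega>. \<lambda>s\<in>{0..}. W s \<omega>) -` ((\<lambda>f. f (2 * t)) -` A \<inter> space (PiM {0..} (\<lambda>_. borel))) \<inter> space Q
        = (\<lambda>\<omega>. W (2 * t) \<omega>) -` A \<inter> space Q"
      using t by (auto simp: space_PiM)
    finally show ?thesis .
  qed
  have law: "distr Q (borel \<Otimes>\<^sub>M (borel \<Otimes>\<^sub>M borel)) (\<lambda>\<omega>. ((U1 \<omega>, U2 \<omega>), W1 (2 * t) \<omega>, W2 (2 * t) \<omega>))
      = uniform_measure lborel unit_triangle \<Otimes>\<^sub>M (gauss t \<Otimes>\<^sub>M gauss t)"
    unfolding distr_brownian_motion(1)[OF W(1) t, symmetric]
  \<comment> \<open>The two Gaussian factors are the same measure; the first is to be read as the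
    law of \<open>W1 (2 * t)\<close>, the second as that of \<open>W2 (2 * t)\<close>.\<close>
  proof (subst (2) distr_brownian_motion(1)[OF W(1) t], 
      subst distr_brownian_motion(1)[OF W(2) t, symmetric], unfold unit_triangle_def lawU[symmetric],
      rule distr_triple_of_indep_sets[OF _ _ _ ind])
    fix i :: nat assume "i < 3"
    then consider "i = 0" | "i = 1" | "i = 2" by linarith
    then show "sigma_algebra (space Q) (?E i)"
      by cases (auto simp: numeral_2_eq_2 intro!: sets.sigma_algebra_axioms[of "vimage_algebra _ _ _", simplified])
  next
    fix A :: "(real \<times> real) set" assume "A \<in> sets borel"
    then show "(\<lambda>\<omega>. (U1 \<omega>, U2 \<omega>)) -` A \<inter> space Q \<in> ?E 0"
      using in_vimage_algebra[of A borel "\<lambda>\<omega>. (U1 \<omega>, U2 \<omega>)" "space Q"] by simp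
  next
    fix A :: "real set" assume "A \<in> sets borel"
    then show "W1 (2 * t) -` A \<inter> space Q \<in> ?E (Suc 0)" using path[of A W1] by simp
  next
    fix A :: "real set" assume "A \<in> sets borel"
    then show "W2 (2 * t) -` A \<inter> space Q \<in> ?E 2" using path[of A W2] by simp
  qed (auto simp: borel_prod[symmetric])
  have Beq: "(B1 t \<omega>, B2 t \<omega>) = (fold01 (U1 \<omega> + W1 (2 * t) \<omega>), fold01 (U2 \<omega> + W2 (2 * t) \<omega>))"
    if "\<omega> \<in> space Q" for \<omega>
    using B[of t \<omega>] t that by (simp add: reflecting_bm_def)
  have "(\<lambda>\<omega>. (fold01 (U1 \<omega> + W1 (2 * t) \<omega>), fold01 (U2 \<omega> + W2 (2 * t) \<omega>))) \<in> borel_measurable Q"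
    unfolding borel_prod[symmetric] by measurable
  then show "(\<lambda>\<omega>. (B1 t \<omega>, B2 t \<omega>)) \<in> borel_measurable Q"
    using Beq by (simp cong: measurable_cong)
  show "(B1 t \<omega>, B2 t \<omega>) \<in> {0..1} \<times> {0..1}" if "\<omega> \<in> space Q" for \<omega>
    using Beq[OF that] fold01_range by auto
  have [measurable]: "G \<in> borel_measurable (borel \<Otimes>\<^sub>M borel)" by (simp add: borel_prod)
  interpret G: prob_space "gauss t" by (rule prob_space_gauss[OF t])
  interpret GG: pair_prob_space "gauss t" "gauss t" ..
  interpret T: prob_space "uniform_measure lborel unit_triangle" by (rule prob_space_unit_triangle)
  interpret TGG: pair_prob_space "uniform_measure lborel unit_triangle" "gauss t \<Otimes>\<^sub>M gauss t" ..
  let ?g = "\<lambda>(z, w). G (fold01 (fst z + fst w), fold01 (snd z + snd w))"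
  have g0: "?g \<in> borel_measurable ((borel \<Otimes>\<^sub>M borel) \<Otimes>\<^sub>M (borel \<Otimes>\<^sub>M borel))"
    by measurable
  then have g [measurable]: "?g \<in> borel_measurable (borel \<Otimes>\<^sub>M (borel \<Otimes>\<^sub>M borel))"
    by (simp add: borel_prod)
  have "(\<integral>\<omega>. G (B1 t \<omega>, B2 t \<omega>) \<partial>Q) = (\<integral>\<omega>. ?g ((U1 \<omega>, U2 \<omega>), W1 (2 * t) \<omega>, W2 (2 * t) \<omega>) \<partial>Q)"
    using Beq by (intro Bochner_Integration.integral_cong) auto
  also have "\<dots> = (\<integral>x. ?g x \<partial>distr Q (borel \<Otimes>\<^sub>M (borel \<Otimes>\<^sub>M borel)) (\<lambda>\<omega>. ((U1 \<omega>, U2 \<omega>), W1 (2 * t) \<omega>, W2 (2 * t) \<omega>)))"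
    by (rule integral_distr[symmetric]) (auto simp: borel_prod[symmetric] g0)
  also have "\<dots> = (\<integral>z. \<integral>w. ?g (z, w) \<partial>(gauss t \<Otimes>\<^sub>M gauss t) \<partial>uniform_measure lborel unit_triangle)"
    unfolding law
  proof (rule TGG.integral_fst'[symmetric], rule TGG.P.integrable_const_bound[where B = C])
    show "AE x in uniform_measure lborel unit_triangle \<Otimes>\<^sub>M (gauss t \<Otimes>\<^sub>M gauss t). norm (?g x) \<le> C"
      using bound by (intro always_eventually) auto
    have "sets (uniform_measure lborel unit_triangle \<Otimes>\<^sub>M (gauss t \<Otimes>\<^sub>M gauss t)) = sets (borel \<Otimes>\<^sub>M (borel \<Otimes>\<^sub>M borel))"
      by (intro sets_pair_measure_cong) auto
    with g show "?g \<in> borel_measurable (uniform_measure lborel unit_triangle \<Otimes>\<^sub>M (gauss t \<Otimes>\<^sub>M gauss t))"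
      by (simp cong: measurable_cong_sets)
  qed
  also have "\<dots> = (\<integral>z. folded_mean t G z \<partial>uniform_measure lborel unit_triangle)"
    by (simp add: folded_mean_def)
  finally show "(\<integral>\<omega>. G (B1 t \<omega>, B2 t \<omega>) \<partial>Q) = (\<integral>z. folded_mean t G z \<partial>uniform_measure lborel unit_triangle)" .
qed

section \<open>Identification of the limit\<close>

lemma lebesgue_cosine_triangle:
  "(LINT v:{0..1}|lborel. LINT u:{0..v}|lborel. cosine m u * cosine m' v) = cosine_triangle m m'"
proof -
  have inner: "(LINT u:{0..v}|lborel. cosine m u * cosine m' v) = cosine m' v * cosine_primitive m v" if "v \<in> {0..1}" for v
  proof -
    have "(LINT u:{0..v}|lborel. cosine m u * cosine m' v) = (LINT u:{0..v}|lborel. cosine m u) * cosine m' v"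
      by (rule set_integral_mult_left)
    also have "(LINT u:{0..v}|lborel. cosine m u) = (\<integral>u. cosine m u * indicator {0..v} u \<partial>lborel)"
      by (simp add: set_lebesgue_integral_def mult.commute)
    also have "\<dots> = cosine_primitive m v - cosine_primitive m 0"
      using that cosine_primitive_deriv by (intro integral_FTC_Icc_real) (auto intro!: continuous_intros)
    finally show ?thesis by simp
  qed
  have "continuous_on {0..1} (\<lambda>v. cosine m' v * cosine_primitive m v)"
    by (intro continuous_intros continuous_cosine_primitive)
  then have "set_integrable lborel {0..1} (\<lambda>v. cosine m' v * cosine_primitive m v)"
    by (rule borel_integrable_atLeastAtMost')
  then have "(LINT v:{0..1}|lborel. cosine m' v * cosine_primitive m v) = cosine_triangle m m'"
    unfolding cosine_triangle_def by (rule set_borel_integral_eq_integral(2))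
  moreover have "(LINT v:{0..1}|lborel. LINT u:{0..v}|lborel. cosine m u * cosine m' v)
      = (LINT v:{0..1}|lborel. cosine m' v * cosine_primitive m v)"
    using inner by (intro set_lebesgue_integral_cong) auto
  ultimately show ?thesis by simp
qed

text \<open>Both claims meet in the law of \<open>(B1 t, B2 t)\<close>: its sign mean gives the
  limit of the distance, and the probability of its order gives the crossing integral. The factor
  1/2 is the area of the triangle of starting points.\<close>

theorem theorem3:
  fixes M :: "nat \<Rightarrow> 'a measure"
    and X :: "nat \<Rightarrow> real \<Rightarrow> 'a \<Rightarrow> nat \<Rightarrow> nat"
    and N :: "'b measure" and W :: "real \<Rightarrow> 'b \<Rightarrow> real"
    and p :: "real \<Rightarrow> real \<Rightarrow> real \<Rightarrow> real"
    and Q :: "'c measure" and B1 B2 :: "real \<Rightarrow> 'c \<Rightarrow> real"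
    and t :: real
  assumes "\<And>n. n \<ge> 2 \<Longrightarrow> adjacent_transposition_walk n (M n) (X n)"
    and "standard_brownian_motion N W"
    and "transition_density N (reflecting_bm W) p"
    and "ordered_reflecting_bm_pair Q B1 B2"
    and "t > 0"
  shows "tends_in_probability M
           (\<lambda>n \<omega>. real (adj_dist n (X n (real n ^ 3 * t) \<omega>)) / real n ^ 2)
           (crossing_integral p t)
         \<and> crossing_integral p t = 1 / 2 * measure Q {\<omega> \<in> space Q. B1 t \<omega> > B2 t \<omega>}"
proof -
  note walk = assms(1) and t = \<open>t > 0\<close>
  note pair = assms(4)
  interpret Q: prob_space Q using pair unfolding ordered_reflecting_bm_pair_def by blast
  note expectation = ordered_pair_expectation(1)[OF pair t]
  have B_meas [measurable]: "(\<lambda>\<omega>. (B1 t \<omega>, B2 t \<omega>)) \<in> borel_measurable Q"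
    by (rule ordered_pair_expectation(2)[OF pair t, of "\<lambda>_. 0" 0]) auto
  have B_unit: "(B1 t \<omega>, B2 t \<omega>) \<in> {0..1} \<times> {0..1}" if "\<omega> \<in> space Q" for \<omega>
    by (rule ordered_pair_expectation(3)[OF pair t, of "\<lambda>_. 0" 0]) (use that in auto)
  define \<rho> where "\<rho> = distr Q borel (\<lambda>\<omega>. (B1 t \<omega>, B2 t \<omega>))"
  interpret \<rho>: prob_space \<rho> unfolding \<rho>_def by (rule Q.prob_space_distr) (rule B_meas)
  have sets_\<rho> [measurable_cong, simp]: "sets \<rho> = sets borel" and space_\<rho> [simp]: "space \<rho> = UNIV"
    by (simp_all add: \<rho>_def)
  have pred: "Measurable.pred (borel :: (real \<times> real) measure) (\<lambda>z. fst z = snd z)"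
      "Measurable.pred (borel :: (real \<times> real) measure) (\<lambda>z. snd z \<le> fst z)"
      "Measurable.pred (borel :: (real \<times> real) measure) (\<lambda>z. snd z < fst z)"
    by (simp_all add: borel_prod[symmetric])
  note [measurable] = pred
  have expectation': "(\<integral>z. G z \<partial>\<rho>) = (\<integral>z. folded_mean t G z \<partial>uniform_measure lborel unit_triangle)"
    if "G \<in> borel_measurable borel" "\<And>z. \<bar>G z\<bar> \<le> 1" for G
    unfolding expectation[OF that, symmetric] \<rho>_def by (rule integral_distr) (use that B_meas in auto)
  have prob_eq: "\<rho>.prob {z. R z} = (\<integral>z. of_bool (R z) \<partial>\<rho>)" for R :: "real \<times> real \<Rightarrow> bool"
  proof -
    have eq: "(\<lambda>z. of_bool (R z)) = (indicator {z. R z} :: _ \<Rightarrow> real)" by (auto simp: indicator_def)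
    show ?thesis unfolding eq by simp
  qed
  have "\<rho>.prob {z. fst z = snd z} = (\<integral>z. of_bool (fst z = snd z) \<partial>\<rho>)"
    by (rule prob_eq)
  also have "\<dots> = (\<integral>z. folded_mean t (\<lambda>z. of_bool (fst z = snd z)) z \<partial>uniform_measure lborel unit_triangle)"
    by (rule expectation') auto
  also have "folded_mean t (\<lambda>z. of_bool (fst z = snd z)) = (\<lambda>z. 0)"
    using folded_mean_ties[OF t] by (auto simp: fun_eq_iff)
  finally have ties0: "\<rho>.prob {z. fst z = snd z} = 0" by simp
  then have ties: "AE z in \<rho>. fst z \<noteq> snd z"
    by (subst (asm) \<rho>.prob_eq_0) auto
  have supp: "AE z in \<rho>. z \<in> {0..1} \<times> {0..1}"
    unfolding \<rho>_def
    by (subst AE_distr_iff) (use B_meas B_unit in \<open>auto intro!: borel_closed closed_Times simp: Collect_mem_eq\<close>)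
  define P where "P = measure Q {\<omega> \<in> space Q. B1 t \<omega> > B2 t \<omega>}"
  have P: "P = (\<integral>z. of_bool (snd z < fst z) \<partial>\<rho>)"
  proof -
    have "P = \<rho>.prob {z. snd z < fst z}"
      unfolding P_def \<rho>_def
      by (subst measure_distr) (auto intro!: arg_cong2[where f = measure])
    also have "\<dots> = (\<integral>z. of_bool (snd z < fst z) \<partial>\<rho>)"
      by (rule prob_eq)
    finally show ?thesis .
  qed
  have crossing: "crossing_integral p t = P / 2"
  proof -
    let ?G = "\<lambda>z::real \<times> real. of_bool (snd z \<le> fst z) :: real"
    have "(\<integral>z. ?G z \<partial>\<rho>) = (\<integral>z. folded_mean t ?G z \<partial>uniform_measure lborel unit_triangle)"
      by (rule expectation') auto
    also have "\<dots> = 2 * (LINT u:{0..1}|lborel. LINT v:{u..1}|lborel. folded_mean t ?G (u, v))"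
      by (rule integral_unit_triangle(1)[where C = 1]) (auto intro!: borel_measurable_folded_mean abs_folded_mean_le t)
    also have "\<dots> = 2 * crossing_integral p t"
      unfolding crossing_integral_eq[OF t assms(2,3)] ..
    finally have "2 * crossing_integral p t = (\<integral>z. ?G z \<partial>\<rho>)" by simp
    \<comment> \<open>The integral counts the weak order, the event the strict one; ties have
      probability zero.\<close>
    also have "\<dots> = P"
      unfolding P
    proof (rule integral_cong_AE)
      show "AE z in \<rho>. ?G z = of_bool (snd z < fst z)"
        using ties by eventually_elim auto
    qed auto
    finally show ?thesis by simp
  qed
  have sgn_mean: "(\<integral>z. sgn (fst z - snd z) \<partial>\<rho>) = 2 * P - 1"
  proof -
    have "(\<integral>z. sgn (fst z - snd z) \<partial>\<rho>) = (\<integral>z. 2 * of_bool (snd z < fst z) - 1 \<partial>\<rho>)"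
    proof (rule integral_cong_AE)
      show "AE z in \<rho>. sgn (fst z - snd z) = 2 * of_bool (snd z < fst z) - 1"
        using ties by eventually_elim (auto simp: sgn_if)
      have "(\<lambda>z::real \<times> real. sgn (fst z - snd z)) \<in> borel_measurable borel"
        by (simp add: borel_prod[symmetric])
      then show "(\<lambda>z. sgn (fst z - snd z)) \<in> borel_measurable \<rho>" by (simp cong: measurable_cong_sets)
    qed auto
    also have "\<dots> = 2 * P - 1"
      unfolding P
      using \<rho>.prob_space
      by (subst Bochner_Integration.integral_diff)
         (auto intro!: \<rho>.integrable_const_bound[where B = 1] integrable_mult_right)
    finally show ?thesis .
  qed
  have cosines: "(\<integral>z. cosine m (fst z) * cosine m' (snd z) \<partial>\<rho>)
       = 2 * exp (- (pi\<^sup>2 * (real m ^ 2 + real m' ^ 2) * t)) * cosine_triangle m m'" for m m'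
  proof -
    let ?G = "\<lambda>z. cosine m (fst z) * cosine m' (snd z)"
    let ?e = "exp (- (pi\<^sup>2 * (real m ^ 2 + real m' ^ 2) * t))"
    have G [measurable]: "?G \<in> borel_measurable borel" by (simp add: borel_prod[symmetric])
    have bound: "\<bar>?G z\<bar> \<le> 1" for z unfolding abs_mult by (intro mult_le_one) auto
    have "(\<integral>z. ?G z \<partial>\<rho>) = (\<integral>z. folded_mean t ?G z \<partial>uniform_measure lborel unit_triangle)"
      by (rule expectation'[OF G bound])
    \<comment> \<open>This order of integration is the one that matches
      \<open>cosine_triangle\<close>.\<close>
    also have "\<dots> = 2 * (LINT v:{0..1}|lborel. LINT u:{0..v}|lborel. folded_mean t ?G (u, v))"
      by (rule integral_unit_triangle(2)[where C = 1]) (intro borel_measurable_folded_mean abs_folded_mean_le t G bound)+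
    also have "\<dots> = 2 * (LINT v:{0..1}|lborel. LINT u:{0..v}|lborel. ?e * (cosine m u * cosine m' v))"
      unfolding folded_mean_cos[OF t] ..
    also have "\<dots> = 2 * (?e * (LINT v:{0..1}|lborel. LINT u:{0..v}|lborel. cosine m u * cosine m' v))"
      by (simp only: set_integral_mult_right)
    finally show ?thesis unfolding lebesgue_cosine_triangle by simp
  qed
  define c where "c = (\<lambda>n. pair_sum n ((pair_step n ^^ nat \<lfloor>real n ^ 3 * t\<rfloor>) sign_kernel) id)"
  have c_lim: "(\<lambda>n. c n / real n ^ 2) \<longlonglongrightarrow> (2 * P - 1) / 2"
    using pair_sum_sign_tendsto[OF \<rho>.prob_space_axioms sets_\<rho> t cosines supp ties]
    unfolding c_def sgn_mean .
  define mean where "mean = (\<lambda>n. c n / 2 + real n * (real n - 1) / 4)"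
  \<comment> \<open>The halved sign limit is \<open>(2 * P - 1) / 4\<close>, and the constant
    \<open>1 / 4\<close> from the number of pairs completes it to \<open>P / 2\<close>.\<close>
  have mean_lim: "(\<lambda>n. mean n / real n ^ 2) \<longlonglongrightarrow> P / 2"
  proof -
    have "(\<lambda>n. c n / real n ^ 2 / 2 + (real n * (real n - 1) / 4) / real n ^ 2) \<longlonglongrightarrow> (2 * P - 1) / 2 / 2 + 1 / 4"
    proof (rule tendsto_add)
      show "(\<lambda>n. c n / real n ^ 2 / 2) \<longlonglongrightarrow> (2 * P - 1) / 2 / 2"
        by (rule tendsto_divide[OF c_lim tendsto_const]) simp
      show "(\<lambda>n. (real n * (real n - 1) / 4) / real n ^ 2) \<longlonglongrightarrow> 1 / 4" by real_asymp
    qed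
    then show ?thesis by (simp add: mean_def add_divide_distrib diff_divide_distrib mult.commute)
  qed
  have "tends_in_probability M (\<lambda>n \<omega>. real (adj_dist n (X n (real n ^ 3 * t) \<omega>)) / real n ^ 2) (P / 2)"
    unfolding tends_in_probability_def
  proof (intro allI impI)
    fix \<epsilon> :: real assume \<epsilon>: "\<epsilon> > 0"
    \<comment> \<open>The deviation bound at time \<open>n ^ 3 * t\<close> with
      \<open>\<delta> = \<epsilon> * n\<^sup>2 / 8\<close> and
      \<open>a = \<epsilon> * n\<^sup>2 / 4\<close>. Both terms compare \<open>n ^ 3\<close> with
      \<open>n ^ 4\<close>, so \<open>b\<close> decays like \<open>1 / n\<close>.\<close>
    define b where "b = (\<lambda>n::nat. 2 * (real n ^ 3 * t + \<epsilon> * real n ^ 2 / 8 + 1) / (\<epsilon> * real n ^ 2 / 8 - 1)\<^sup>2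
      + 64 * (real n ^ 3 * t) / (\<epsilon> * real n ^ 2 / 4)\<^sup>2)"
    have "\<forall>\<^sub>F n in sequentially. \<bar>mean n / real n ^ 2 - P / 2\<bar> < \<epsilon> / 4"
      using tendstoD[OF mean_lim, of "\<epsilon> / 4"] \<epsilon> unfolding dist_real_def by simp
    moreover have "\<forall>\<^sub>F n in sequentially. 1 / real n ^ 2 < \<epsilon> / 4"
    proof (rule order_tendstoD(2))
      show "(\<lambda>n. 1 / real n ^ 2) \<longlonglongrightarrow> 0" by real_asymp
    qed (use \<epsilon> in auto)
    moreover have "\<forall>\<^sub>F n in sequentially. \<epsilon> * real n ^ 2 / 8 > 1"
      using \<epsilon> by real_asymp
    ultimately have "\<forall>\<^sub>F n in sequentially.
      norm (measure (M n) {\<omega> \<in> space (M n).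
        \<bar>real (adj_dist n (X n (real n ^ 3 * t) \<omega>)) / real n ^ 2 - P / 2\<bar> > \<epsilon>}) \<le> b n"
      using eventually_ge_at_top[of 5]
    proof eventually_elim
      case (elim n)
      have n: "real n > 0" and walk_n: "adjacent_transposition_walk n (M n) (X n)"
        using elim(4) walk by auto
      interpret Mn: prob_space "M n" using walk_n by (simp add: adjacent_transposition_walk_def)
      obtain A where A: "A \<in> sets (M n)" "measure (M n) A \<le> b n"
        "\<And>\<omega>. \<omega> \<in> space (M n) - A \<Longrightarrow> \<bar>real (adj_dist n (X n (real n ^ 3 * t) \<omega>)) - mean n\<bar>
           \<le> \<epsilon> * real n ^ 2 / 8 + 1 + \<epsilon> * real n ^ 2 / 4 / 2"
        using adj_dist_deviation[OF walk_n elim(4), of "real n ^ 3 * t" "\<epsilon> * real n ^ 2 / 8" "\<epsilon> * real n ^ 2 / 4"]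
          elim(3) \<epsilon> t n unfolding b_def mean_def c_def by auto
      have "{\<omega> \<in> space (M n). \<bar>real (adj_dist n (X n (real n ^ 3 * t) \<omega>)) / real n ^ 2 - P / 2\<bar> > \<epsilon>} \<subseteq> A"
      proof (rule subsetI, rule ccontr)
        fix \<omega>
        assume "\<omega> \<in> {\<omega> \<in> space (M n). \<bar>real (adj_dist n (X n (real n ^ 3 * t) \<omega>)) / real n ^ 2 - P / 2\<bar> > \<epsilon>}" "\<omega> \<notin> A"
        then have \<omega>: "\<omega> \<in> space (M n) - A" "\<bar>real (adj_dist n (X n (real n ^ 3 * t) \<omega>)) / real n ^ 2 - P / 2\<bar> > \<epsilon>"
          by auto
        let ?D = "real (adj_dist n (X n (real n ^ 3 * t) \<omega>))"
        have "\<bar>?D - mean n\<bar> / real n ^ 2 \<le> (\<epsilon> * real n ^ 2 / 8 + 1 + \<epsilon> * real n ^ 2 / 4 / 2) / real n ^ 2"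
          using A(3)[OF \<omega>(1)] by (intro divide_right_mono) auto
        also have "\<dots> = \<epsilon> / 4 + 1 / real n ^ 2" using n by (simp add: field_simps)
        finally have "\<bar>?D / real n ^ 2 - mean n / real n ^ 2\<bar> \<le> \<epsilon> / 4 + 1 / real n ^ 2"
          by (simp add: diff_divide_distrib[symmetric])
        \<comment> \<open>The fluctuation contributes \<open>\<epsilon> / 4\<close>, the rounding
          term and the error of the mean less than \<open>\<epsilon> / 4\<close> each, in total less
          than \<open>\<epsilon>\<close>.\<close>
        then show False using \<omega>(2) elim(1,2) \<epsilon> by linarith
      qed
      \<comment> \<open>Monotonicity of the measure asks for measurability of the covering set
        \<open>A\<close> only.\<close>
      then have "measure (M n) {\<omega> \<in> space (M n). \<bar>real (adj_dist n (X n (real n ^ 3 * t) \<omega>)) / real n ^ 2 - P / 2\<bar> > \<epsilon>}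
          \<le> measure (M n) A"
        by (intro Mn.finite_measure_mono A(1))
      then show ?case using A(2) by simp
    qed
    moreover have "b \<longlonglongrightarrow> 0"
      unfolding b_def using \<epsilon> t by real_asymp
    ultimately show "(\<lambda>n. measure (M n) {\<omega> \<in> space (M n).
        \<bar>real (adj_dist n (X n (real n ^ 3 * t) \<omega>)) / real n ^ 2 - P / 2\<bar> > \<epsilon>}) \<longlonglongrightarrow> 0"
      by (rule Lim_null_comparison)
  qed
  then show ?thesis unfolding crossing P_def[symmetric] by simp
qed

end
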